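(* Let $R$ be a commutative Noetherian ring with identity and let $\mathfrak{a}$ be an ideal of $R$ which is contained in the Jacobson radical of $R$. Let $M$ be an $\mathfrak{a}$-relative Cohen-Macaulay $R$-module, let $c=\operatorname{cd}(\mathfrak{a},M)$, and let $x_1,x_2,\ldots,x_c\in\mathfrak{a}$ be an $\mathfrak{a}$-relative system of parameters of $M$. Then $M/\langle x_1,x_2,\ldots,x_i\rangle M$ is $\mathfrak{a}$-relative Cohen-Macaulay for every $i=1,\ldots,c$.
   Context: All rings are commutative Noetherian with identity (not necessarily local). For an ideal $\mathfrak{a}$ of $R$ and a finitely generated $R$-module $M$, $\mathrm{H}^i_{\mathfrak{a}}(M)=\varinjlim_n \operatorname{Ext}^i_R(R/\mathfrak{a}^n,M)$ is the $i$-th local cohomology module, and $\operatorname{cd}(\mathfrak{a},M)$ is the supremum of the integers $i$ with $\mathrm{H}^i_{\mathfrak{a}}(M)\neq 0$. $\operatorname{Rad}$ denotes the radical of an ideal and $\operatorname{Ann}_R M$ the annihilator of $M$. A finitely generated $R$-module $M$ with $M\neq\mathfrak{a}M$ is called $\mathfrak{a}$-relative Cohen-Macaulay if $\operatorname{grade}(\mathfrak{a},M)=\operatorname{cd}(\mathfrak{a},M)$, where $\operatorname{grade}(\mathfrak{a},M)$ is the common length of maximal $M$-regular sequences contained in $\mathfrak{a}$. For $M\neq\mathfrak{a}M$ and $c=\operatorname{cd}(\mathfrak{a},M)$, a sequence $x_1,\ldots,x_c\in\mathfrak{a}$ (of length exactly $c$) is called an $\mathfrak{a}$-relative system of parameters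 of $M$ if $\operatorname{Rad}(\langle x_1,\ldots,x_c\rangle+\operatorname{Ann}_R M)=\operatorname{Rad}(\mathfrak{a}+\operatorname{Ann}_R M)$. *)

theory Defs
  imports
    "HOL-Algebra.Module"
    "HOL-Algebra.Ideal_Product"
    "HOL-Algebra.Ring_Divisibility"
    "HOL-Library.Extended_Real"
begin

section \<open>Ideals\<close>

definition jacobson_radical :: "('a, 'r) ring_scheme \<Rightarrow> 'a set" where
  "jacobson_radical R = carrier R \<inter> \<Inter>{I. maximalideal I R}"

definition ideal_Rad :: "('a, 'r) ring_scheme \<Rightarrow> 'a set \<Rightarrow> 'a set" where
  "ideal_Rad R I = {r \<in> carrier R. \<exists>n::nat. r [^]\<^bsub>R\<^esub> n \<in> I}"

definition annihilator :: "('a, 'r) ring_scheme \<Rightarrow> ('a, 'b, 'm) module_scheme \<Rightarrow> 'a set" where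
  "annihilator R M = {r \<in> carrier R. \<forall>x \<in> carrier M. r \<odot>\<^bsub>M\<^esub> x = \<zero>\<^bsub>M\<^esub>}"

section \<open>Modules\<close>

text \<open>The record type of modules extends that of rings; its fields \<open>mult\<close> and \<open>one\<close> play no
  role for modules and are left undefined below.\<close>

definition gen_submodule ::
    "('a, 'r) ring_scheme \<Rightarrow> ('a, 'b, 'm) module_scheme \<Rightarrow> 'b set \<Rightarrow> 'b set" where
  "gen_submodule R M S = \<Inter>{H. submodule H R M \<and> S \<subseteq> H}"

definition fin_gen_module :: "('a, 'r) ring_scheme \<Rightarrow> ('a, 'b, 'm) module_scheme \<Rightarrow> bool" where
  "fin_gen_module R M \<longleftrightarrow>
     Module.module R M \<and> (\<exists>S. finite S \<and> S \<subseteq> carrier M \<and> gen_submodule R M S = carrier M)"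

definition ideal_smult ::
    "('a, 'r) ring_scheme \<Rightarrow> 'a set \<Rightarrow> ('a, 'b, 'm) module_scheme \<Rightarrow> 'b set" where
  "ideal_smult R I M = gen_submodule R M {r \<odot>\<^bsub>M\<^esub> x | r x. r \<in> I \<and> x \<in> carrier M}"

text \<open>For \<open>C = N + x\<close> the union defining scalar multiplication is over equal cosets
  (as in \<^const>\<open>rcoset_mult\<close>).\<close>

definition quotient_module :: "('a, 'b, 'm) module_scheme \<Rightarrow> 'b set \<Rightarrow> ('a, 'b set) module" where
  "quotient_module M N =
     \<lparr>carrier = a_rcosets\<^bsub>M\<^esub> N, monoid.mult = undefined, one = undefined,
      zero = N, add = set_add M,
      smult = (\<lambda>r C. \<Union>x\<in>C. N +>\<^bsub>M\<^esub> (r \<odot>\<^bsub>M\<^esub> x))\<rparr>"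

definition self_module :: "('a, 'r) ring_scheme \<Rightarrow> ('a, 'a) module" where
  "self_module R =
     \<lparr>carrier = carrier R, monoid.mult = monoid.mult R, one = one R, zero = zero R, add = add R,
      smult = monoid.mult R\<rparr>"

definition free_module :: "('a, 'r) ring_scheme \<Rightarrow> nat \<Rightarrow> ('a, nat \<Rightarrow> 'a) module" where
  "free_module R n =
     \<lparr>carrier = {..<n} \<rightarrow>\<^sub>E carrier R, monoid.mult = undefined, one = undefined,
      zero = (\<lambda>i\<in>{..<n}. \<zero>\<^bsub>R\<^esub>),
      add = (\<lambda>v w. \<lambda>i\<in>{..<n}. v i \<oplus>\<^bsub>R\<^esub> w i),
      smult = (\<lambda>r v. \<lambda>i\<in>{..<n}. r \<otimes>\<^bsub>R\<^esub> v i)\<rparr>"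

definition module_homs ::
    "('a, 'r) ring_scheme \<Rightarrow> ('a, 'b, 'm) module_scheme \<Rightarrow> ('a, 'c, 'n) module_scheme
      \<Rightarrow> ('b \<Rightarrow> 'c) set" where
  "module_homs R P M =
     {f \<in> carrier P \<rightarrow>\<^sub>E carrier M.
        (\<forall>x\<in>carrier P. \<forall>y\<in>carrier P. f (x \<oplus>\<^bsub>P\<^esub> y) = f x \<oplus>\<^bsub>M\<^esub> f y) \<and>
        (\<forall>r\<in>carrier R. \<forall>x\<in>carrier P. f (r \<odot>\<^bsub>P\<^esub> x) = r \<odot>\<^bsub>M\<^esub> f x)}"

definition Hom_module ::
    "('a, 'r) ring_scheme \<Rightarrow> ('a, 'b, 'm) module_scheme \<Rightarrow> ('a, 'c, 'n) module_scheme
      \<Rightarrow> ('a, 'b \<Rightarrow> 'c) module" where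
  "Hom_module R P M =
     \<lparr>carrier = module_homs R P M, monoid.mult = undefined, one = undefined,
      zero = (\<lambda>x\<in>carrier P. \<zero>\<^bsub>M\<^esub>),
      add = (\<lambda>f g. \<lambda>x\<in>carrier P. f x \<oplus>\<^bsub>M\<^esub> g x),
      smult = (\<lambda>r f. \<lambda>x\<in>carrier P. r \<odot>\<^bsub>M\<^esub> f x)\<rparr>"

definition hom_kernel ::
    "('a, 'b, 'm) module_scheme \<Rightarrow> ('a, 'c, 'n) module_scheme \<Rightarrow> ('b \<Rightarrow> 'c) \<Rightarrow> 'b set" where
  "hom_kernel P M f = {x \<in> carrier P. f x = \<zero>\<^bsub>M\<^esub>}"

section \<open>Free resolutions and Ext\<close>

text \<open>A triple \<open>(r, d, e)\<close> encodes the complex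
  \<open>\<dots> \<rightarrow> R\<^bsup>r 2\<^esup> \<rightarrow> R\<^bsup>r 1\<^esup> \<rightarrow> R\<^bsup>r 0\<^esup> \<rightarrow> N \<rightarrow> 0\<close> with differentials
  \<open>d i : R\<^bsup>r (i + 1)\<^esup> \<rightarrow> R\<^bsup>r i\<^esup>\<close> and augmentation \<open>e\<close>. Over a Noetherian ring every finitely generated
  module has a resolution by free modules of finite rank, and Ext can be computed from any
  projective resolution, so nothing is lost by resolving with such modules only.\<close>

type_synonym 'a diffs = "nat \<Rightarrow> (nat \<Rightarrow> 'a) \<Rightarrow> (nat \<Rightarrow> 'a)"

definition free_resolution ::
    "('a, 'r) ring_scheme \<Rightarrow> ('a, 'b, 'm) module_scheme
      \<Rightarrow> (nat \<Rightarrow> nat) \<Rightarrow> 'a diffs \<Rightarrow> ((nat \<Rightarrow> 'a) \<Rightarrow> 'b) \<Rightarrow> bool" where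
  "free_resolution R N r d e \<longleftrightarrow>
     (let F = (\<lambda>i. free_module R (r i)) in
        e \<in> module_homs R (F 0) N \<and>
        (\<forall>i. d i \<in> module_homs R (F (Suc i)) (F i)) \<and>
        e ` carrier (F 0) = carrier N \<and>
        hom_kernel (F 0) N e = d 0 ` carrier (F 1) \<and>
        (\<forall>i. hom_kernel (F (Suc i)) (F i) (d i) = d (Suc i) ` carrier (F (Suc (Suc i)))))"

definition resolution ::
    "('a, 'r) ring_scheme \<Rightarrow> ('a, 'b, 'm) module_scheme
      \<Rightarrow> (nat \<Rightarrow> nat) \<times> 'a diffs \<times> ((nat \<Rightarrow> 'a) \<Rightarrow> 'b)" where
  "resolution R N = (SOME (r, d, e). free_resolution R N r d e)"

definition res_module ::
    "('a, 'r) ring_scheme \<Rightarrow> ('a, 'b, 'm) module_scheme \<Rightarrow> nat \<Rightarrow> ('a, nat \<Rightarrow> 'a) module" where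
  "res_module R N i = free_module R (fst (resolution R N) i)"

definition res_diff :: "('a, 'r) ring_scheme \<Rightarrow> ('a, 'b, 'm) module_scheme \<Rightarrow> 'a diffs" where
  "res_diff R N = fst (snd (resolution R N))"

definition res_aug ::
    "('a, 'r) ring_scheme \<Rightarrow> ('a, 'b, 'm) module_scheme \<Rightarrow> (nat \<Rightarrow> 'a) \<Rightarrow> 'b" where
  "res_aug R N = snd (snd (resolution R N))"

definition Ext_cocycles ::
    "('a, 'r) ring_scheme \<Rightarrow> nat \<Rightarrow> ('a, 'b, 'm) module_scheme \<Rightarrow> ('a, 'c, 'n) module_scheme
      \<Rightarrow> ((nat \<Rightarrow> 'a) \<Rightarrow> 'c) set" where
  "Ext_cocycles R i N M =
     {f \<in> module_homs R (res_module R N i) M.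
        \<forall>x \<in> carrier (res_module R N (Suc i)). f (res_diff R N i x) = \<zero>\<^bsub>M\<^esub>}"

definition Ext_coboundaries ::
    "('a, 'r) ring_scheme \<Rightarrow> nat \<Rightarrow> ('a, 'b, 'm) module_scheme \<Rightarrow> ('a, 'c, 'n) module_scheme
      \<Rightarrow> ((nat \<Rightarrow> 'a) \<Rightarrow> 'c) set" where
  "Ext_coboundaries R i N M =
     (case i of
        0 \<Rightarrow> {\<zero>\<^bsub>Hom_module R (res_module R N 0) M\<^esub>}
      | Suc j \<Rightarrow> (\<lambda>g. compose (carrier (res_module R N (Suc j))) g (res_diff R N j))
                   ` module_homs R (res_module R N j) M)"

definition Ext ::
    "('a, 'r) ring_scheme \<Rightarrow> nat \<Rightarrow> ('a, 'b, 'm) module_scheme \<Rightarrow> ('a, 'c, 'n) module_scheme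
      \<Rightarrow> ('a, ((nat \<Rightarrow> 'a) \<Rightarrow> 'c) set) module" where
  "Ext R i N M =
     quotient_module
       ((Hom_module R (res_module R N i) M)\<lparr>carrier := Ext_cocycles R i N M\<rparr>)
       (Ext_coboundaries R i N M)"

text \<open>A homomorphism \<open>h : N \<rightarrow> N'\<close> lifts to a chain map of resolutions, unique up to homotopy, and
  \<open>Ext_map\<close> is the map \<open>Ext\<^sup>i(N', M) \<rightarrow> Ext\<^sup>i(N, M)\<close> induced by \<open>h\<close>.\<close>

definition is_lift ::
    "('a, 'r) ring_scheme \<Rightarrow> ('a, 'b, 'm) module_scheme \<Rightarrow> ('a, 'c, 'n) module_scheme
      \<Rightarrow> ('b \<Rightarrow> 'c) \<Rightarrow> 'a diffs \<Rightarrow> bool" where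
  "is_lift R N N' h \<phi> \<longleftrightarrow>
     (\<forall>i. \<phi> i \<in> module_homs R (res_module R N i) (res_module R N' i)) \<and>
     (\<forall>x \<in> carrier (res_module R N 0). res_aug R N' (\<phi> 0 x) = h (res_aug R N x)) \<and>
     (\<forall>i. \<forall>x \<in> carrier (res_module R N (Suc i)).
        res_diff R N' i (\<phi> (Suc i) x) = \<phi> i (res_diff R N i x))"

definition lift ::
    "('a, 'r) ring_scheme \<Rightarrow> ('a, 'b, 'm) module_scheme \<Rightarrow> ('a, 'c, 'n) module_scheme
      \<Rightarrow> ('b \<Rightarrow> 'c) \<Rightarrow> 'a diffs" where
  "lift R N N' h = (SOME \<phi>. is_lift R N N' h \<phi>)"

definition Ext_map ::
    "('a, 'r) ring_scheme \<Rightarrow> nat \<Rightarrow> ('a, 'b, 'm) module_scheme \<Rightarrow> ('a, 'c, 'n) module_scheme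
      \<Rightarrow> ('b \<Rightarrow> 'c) \<Rightarrow> ('a, 'd, 'k) module_scheme
      \<Rightarrow> ((nat \<Rightarrow> 'a) \<Rightarrow> 'd) set \<Rightarrow> ((nat \<Rightarrow> 'a) \<Rightarrow> 'd) set" where
  "Ext_map R i N N' h M C =
     (\<Union>f\<in>C. Ext_coboundaries R i N M +>\<^bsub>Hom_module R (res_module R N i) M\<^esub>
                compose (carrier (res_module R N i)) f (lift R N N' h i))"

section \<open>Direct limits of sequences\<close>

text \<open>For a system \<open>D 0 \<rightarrow> D 1 \<rightarrow> \<dots>\<close> with transition maps \<open>t n : D n \<rightarrow> D (n + 1)\<close>,
  \<open>trans_map t n k\<close> is the composite \<open>D n \<rightarrow> D (n + k)\<close>. The limit is the disjoint union of the
  \<open>D n\<close> modulo eventual equality; its operations are defined on representatives.\<close>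

primrec trans_map :: "(nat \<Rightarrow> 'b \<Rightarrow> 'b) \<Rightarrow> nat \<Rightarrow> nat \<Rightarrow> 'b \<Rightarrow> 'b" where
  "trans_map t n 0 x = x"
| "trans_map t n (Suc k) x = t (n + k) (trans_map t n k x)"

definition limit_rel ::
    "(nat \<Rightarrow> ('a, 'b) module) \<Rightarrow> (nat \<Rightarrow> 'b \<Rightarrow> 'b) \<Rightarrow> ((nat \<times> 'b) \<times> (nat \<times> 'b)) set" where
  "limit_rel D t =
     {((n, x), (m, y)). x \<in> carrier (D n) \<and> y \<in> carrier (D m) \<and>
        (\<exists>k l. n + k = m + l \<and> trans_map t n k x = trans_map t m l y)}"

definition direct_limit ::
    "(nat \<Rightarrow> ('a, 'b) module) \<Rightarrow> (nat \<Rightarrow> 'b \<Rightarrow> 'b) \<Rightarrow> ('a, (nat \<times> 'b) set) module" where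
  "direct_limit D t =
     \<lparr>carrier = (SIGMA n:UNIV. carrier (D n)) // limit_rel D t,
      monoid.mult = undefined, one = undefined,
      zero = limit_rel D t `` {(0, \<zero>\<^bsub>D 0\<^esub>)},
      add = (\<lambda>C C'. \<Union>(n, x)\<in>C. \<Union>(m, y)\<in>C'.
               limit_rel D t `` {(n + m, trans_map t n m x \<oplus>\<^bsub>D (n + m)\<^esub> trans_map t m n y)}),
      smult = (\<lambda>r C. \<Union>(n, x)\<in>C. limit_rel D t `` {(n, r \<odot>\<^bsub>D n\<^esub> x)})\<rparr>"

section \<open>Local cohomology and cohomological dimension\<close>

definition power_quotient ::
    "('a, 'r) ring_scheme \<Rightarrow> 'a set \<Rightarrow> nat \<Rightarrow> ('a, 'a set) module" where
  "power_quotient R \<aa> n = quotient_module (self_module R) (\<aa> [^]\<^bsub>ideals_set R\<^esub> n)"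

text \<open>The canonical surjection \<open>R/\<aa>\<^bsup>n+1\<^esup> \<rightarrow> R/\<aa>\<^sup>n\<close>.\<close>

definition power_proj :: "('a, 'r) ring_scheme \<Rightarrow> 'a set \<Rightarrow> nat \<Rightarrow> 'a set \<Rightarrow> 'a set" where
  "power_proj R \<aa> n C = (\<Union>x\<in>C. (\<aa> [^]\<^bsub>ideals_set R\<^esub> n) +>\<^bsub>R\<^esub> x)"

definition local_cohomology ::
    "('a, 'r) ring_scheme \<Rightarrow> nat \<Rightarrow> 'a set \<Rightarrow> ('a, 'b, 'm) module_scheme
      \<Rightarrow> ('a, (nat \<times> ((nat \<Rightarrow> 'a) \<Rightarrow> 'b) set) set) module" where
  "local_cohomology R i \<aa> M =
     direct_limit
       (\<lambda>n. Ext R i (power_quotient R \<aa> n) M)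
       (\<lambda>n. Ext_map R i (power_quotient R \<aa> (Suc n)) (power_quotient R \<aa> n)
               (power_proj R \<aa> n) M)"

text \<open>In the extended reals the supremum of the empty set is \<open>-\<infinity>\<close>.\<close>

definition cd :: "('a, 'r) ring_scheme \<Rightarrow> 'a set \<Rightarrow> ('a, 'b, 'm) module_scheme \<Rightarrow> ereal" where
  "cd R \<aa> M =
     Sup {ereal (real i) | i.
            carrier (local_cohomology R i \<aa> M) \<noteq> {\<zero>\<^bsub>local_cohomology R i \<aa> M\<^esub>}}"

section \<open>Regular sequences and grade\<close>

definition regular_sequence ::
    "('a, 'r) ring_scheme \<Rightarrow> ('a, 'b, 'm) module_scheme \<Rightarrow> 'a list \<Rightarrow> bool" where
  "regular_sequence R M xs \<longleftrightarrow>
     set xs \<subseteq> carrier R \<and>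
     (\<forall>j < length xs.
        let Q = quotient_module M (ideal_smult R (genideal R (set (take j xs))) M) in
          \<forall>q \<in> carrier Q. xs ! j \<odot>\<^bsub>Q\<^esub> q = \<zero>\<^bsub>Q\<^esub> \<longrightarrow> q = \<zero>\<^bsub>Q\<^esub>) \<and>
     ideal_smult R (genideal R (set xs)) M \<noteq> carrier M"

definition maximal_regular_sequence ::
    "('a, 'r) ring_scheme \<Rightarrow> 'a set \<Rightarrow> ('a, 'b, 'm) module_scheme \<Rightarrow> 'a list \<Rightarrow> bool" where
  "maximal_regular_sequence R \<aa> M xs \<longleftrightarrow>
     regular_sequence R M xs \<and> set xs \<subseteq> \<aa> \<and>
     (\<forall>y \<in> \<aa>. \<not> regular_sequence R M (xs @ [y]))"

definition grade :: "('a, 'r) ring_scheme \<Rightarrow> 'a set \<Rightarrow> ('a, 'b, 'm) module_scheme \<Rightarrow> nat" where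
  "grade R \<aa> M = (THE n. length ` {xs. maximal_regular_sequence R \<aa> M xs} = {n})"

section \<open>Relative Cohen-Macaulay modules and relative systems of parameters\<close>

definition relative_CM ::
    "('a, 'r) ring_scheme \<Rightarrow> 'a set \<Rightarrow> ('a, 'b, 'm) module_scheme \<Rightarrow> bool" where
  "relative_CM R \<aa> M \<longleftrightarrow>
     fin_gen_module R M \<and> carrier M \<noteq> ideal_smult R \<aa> M \<and>
     ereal (real (grade R \<aa> M)) = cd R \<aa> M"

definition relative_sop ::
    "('a, 'r) ring_scheme \<Rightarrow> 'a set \<Rightarrow> ('a, 'b, 'm) module_scheme \<Rightarrow> 'a list \<Rightarrow> bool" where
  "relative_sop R \<aa> M xs \<longleftrightarrow>
     carrier M \<noteq> ideal_smult R \<aa> M \<and> set xs \<subseteq> \<aa> \<and>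
     ereal (real (length xs)) = cd R \<aa> M \<and>
     ideal_Rad R (genideal R (set xs) <+>\<^bsub>R\<^esub> annihilator R M) =
       ideal_Rad R (\<aa> <+>\<^bsub>R\<^esub> annihilator R M)"

end

theory Submission
  imports Defs
begin

text \<open>Let \<open>y\<close> be a nonzerodivisor on \<open>N/P\<close>. Multiplication by \<open>y \<in> \<aa>\<close> is nilpotent on the modules
  \<open>Ext\<^sup>i(R/\<aa>\<^sup>n, N/P)\<close>, so the long exact sequence of \<open>0 \<rightarrow> N/P \<rightarrow> N/P \<rightarrow> N/(P + yN) \<rightarrow> 0\<close> shows that vanishing
  of \<open>Ext\<close> or of local cohomology passes from \<open>N/(P + yN)\<close> in degree \<open>i - 1\<close> to \<open>N/P\<close> in degree \<open>i\<close>.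
  If \<open>ys\<close> is an \<open>N\<close>-regular sequence in \<open>\<aa>\<close> and \<open>N/\<langle>ys\<rangle>N\<close> is nonzero and \<open>\<aa>\<close>-torsion, then induction
  along \<open>ys\<close> gives \<open>cd(\<aa>, N) = length ys\<close>: torsion modules have no local cohomology in positive degrees
  by Artin--Rees, and a socle element of \<open>N/\<langle>ys\<rangle>N\<close> yields a class of degree \<open>length ys\<close> that survives in
  the limit. The same induction for \<open>Ext(R/\<aa>, N)\<close> is Rees' theorem on the grade.

  It remains to see that the given \<open>xs\<close> is \<open>M\<close>-regular; then the rest of \<open>xs\<close> is regular on each
  \<open>M/\<langle>x\<^sub>1, \<dots>, x\<^sub>i\<rangle>M\<close>. Since \<open>grade(\<aa>, M) = length xs\<close>, prime avoidance turns \<open>xs\<close> by a triangular change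
  of generators into a regular sequence with the same last element, which is therefore a
  nonzerodivisor, as regular sequences in the Jacobson radical may be permuted. Dividing by it and
  iterating proves the claim.

  To keep all inductions on a single module type, quotients \<open>N/P\<close> are not formed: homomorphisms from free
  modules into \<open>N/P\<close> are represented by homomorphisms into \<open>N\<close> taken modulo \<open>P\<close>.\<close>

section \<open>Congruence modulo a submodule and linear maps\<close>

text \<open>Cohen-Macaulayness enters as grade(\<aa>, M) = \<open>length xs\<close>. The radical
  condition says that each w \<in> \<aa> has a power in \<langle>xs\<rangle> + Ann M, so
  M/\<langle>xs\<rangle>M is \<aa>-torsion; dividing M/\<langle>x_1, ..., x_i\<rangle>M by the
  remaining elements gives this same module, which is why one torsion statement serves every i.

  The usual bound of cd by the number of elements generating \<aa> up to radical goes through the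
  Cech complex. With local cohomology as a limit of Ext(R/\<aa>^n, -), a torsion module may have
  nonzero Ext in positive degrees at every stage, and only the limit vanishes. Vanishing is
  therefore a statement about cocycles that become coboundaries at some later stage, and the
  exactness lemmas produce one cocycle that serves all later stages at once.

  The changes z + u alter every element but the last, so the last one is known to be a
  nonzerodivisor only after dividing by the changed others. Nakayama's lemma moves it to the front,
  and this is where the Jacobson radical is used.\<close>

definition eqmod :: "('a, 'b, 'm) module_scheme \<Rightarrow> 'b set \<Rightarrow> 'b \<Rightarrow> 'b \<Rightarrow> bool" where
  "eqmod M P x y \<longleftrightarrow> x \<in> carrier M \<and> y \<in> carrier M \<and> x \<ominus>\<^bsub>M\<^esub> y \<in> P"

text \<open>Unlike \<open>module_homs\<close>, no extensionality is demanded, so composites, sums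
  and multiples of linear maps are linear as they stand; \<open>restrict\<close> is applied only
  where the definitions of resolutions and Ext are met.\<close>

definition lin_map ::
    "('a, 'r) ring_scheme \<Rightarrow> ('a, 'b, 'm) module_scheme \<Rightarrow> ('a, 'c, 'n) module_scheme
      \<Rightarrow> ('b \<Rightarrow> 'c) \<Rightarrow> bool" where
  "lin_map R A B f \<longleftrightarrow>
     (\<forall>x\<in>carrier A. f x \<in> carrier B) \<and>
     (\<forall>x\<in>carrier A. \<forall>y\<in>carrier A. f (x \<oplus>\<^bsub>A\<^esub> y) = f x \<oplus>\<^bsub>B\<^esub> f y) \<and>
     (\<forall>r\<in>carrier R. \<forall>x\<in>carrier A. f (r \<odot>\<^bsub>A\<^esub> x) = r \<odot>\<^bsub>B\<^esub> f x)"

lemma eqmod_mono: "P \<subseteq> Q \<Longrightarrow> eqmod M P x y \<Longrightarrow> eqmod M Q x y"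
  by (auto simp: eqmod_def)

context Module.module
begin

lemma submoduleI':
  assumes "H \<subseteq> carrier M" "\<zero>\<^bsub>M\<^esub> \<in> H"
    and "\<And>a b. \<lbrakk>a \<in> H; b \<in> H\<rbrakk> \<Longrightarrow> a \<oplus>\<^bsub>M\<^esub> b \<in> H"
    and "\<And>a x. \<lbrakk>a \<in> carrier R; x \<in> H\<rbrakk> \<Longrightarrow> a \<odot>\<^bsub>M\<^esub> x \<in> H"
  shows "submodule H R M"
proof (rule submoduleI)
  fix a assume a: "a \<in> H"
  then have "\<ominus>\<^bsub>M\<^esub> a = (\<ominus> \<one>) \<odot>\<^bsub>M\<^esub> a"
    using assms(1) smult_l_minus[of \<one> a] by auto
  then show "\<ominus>\<^bsub>M\<^esub> a \<in> H"
    using assms(4)[of "\<ominus> \<one>" a] a by auto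
qed (use assms in auto)

lemma submodule_zero: "submodule P R M \<Longrightarrow> \<zero>\<^bsub>M\<^esub> \<in> P"
  using subgroup.one_closed[of P "add_monoid M"] by (auto simp: submodule_def)

lemma submodule_carrier: "submodule P R M \<Longrightarrow> x \<in> P \<Longrightarrow> x \<in> carrier M"
  using submoduleE(1) by auto

lemma submodule_diff: "submodule P R M \<Longrightarrow> x \<in> P \<Longrightarrow> y \<in> P \<Longrightarrow> x \<ominus>\<^bsub>M\<^esub> y \<in> P"
  unfolding a_minus_def by (meson submoduleE(3,5))

lemma submodule_Inter:
  assumes "\<And>H. H \<in> \<H> \<Longrightarrow> submodule H R M" "\<H> \<noteq> {}"
  shows "submodule (\<Inter>\<H>) R M"
proof (rule submoduleI')
  show "\<Inter>\<H> \<subseteq> carrier M" using assms submoduleE(1) by blast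
  show "\<zero>\<^bsub>M\<^esub> \<in> \<Inter>\<H>" using assms submodule_zero by blast
next
  fix a b assume "a \<in> \<Inter>\<H>" "b \<in> \<Inter>\<H>"
  then show "a \<oplus>\<^bsub>M\<^esub> b \<in> \<Inter>\<H>" by (simp add: submoduleE(5)[OF assms(1)])
next
  fix a x assume "a \<in> carrier R" "x \<in> \<Inter>\<H>"
  then show "a \<odot>\<^bsub>M\<^esub> x \<in> \<Inter>\<H>" by (simp add: submoduleE(4)[OF assms(1)])
qed

lemma submodule_Int: "submodule P R M \<Longrightarrow> submodule Q R M \<Longrightarrow> submodule (P \<inter> Q) R M"
  using submodule_Inter[of "{P, Q}"] by auto

lemma gen_submodule: "S \<subseteq> carrier M \<Longrightarrow> submodule (gen_submodule R M S) R M"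
  unfolding gen_submodule_def
  by (rule submodule_Inter) (use carrier_is_submodule in auto)

lemma gen_submodule_superset: "S \<subseteq> gen_submodule R M S"
  unfolding gen_submodule_def by blast

lemma gen_submodule_minimal: "submodule H R M \<Longrightarrow> S \<subseteq> H \<Longrightarrow> gen_submodule R M S \<subseteq> H"
  unfolding gen_submodule_def by blast

lemma zero_submodule: "submodule {\<zero>\<^bsub>M\<^esub>} R M"
  by (rule submoduleI') auto

lemma eqmod_carrier: "eqmod M P x y \<Longrightarrow> x \<in> carrier M" "eqmod M P x y \<Longrightarrow> y \<in> carrier M"
  unfolding eqmod_def by auto

lemma eqmod_alt:
  assumes "submodule P R M"
  shows "eqmod M P x y \<longleftrightarrow> y \<in> carrier M \<and> (\<exists>p\<in>P. x = p \<oplus>\<^bsub>M\<^esub> y)"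
proof
  assume "eqmod M P x y"
  then have *: "x \<in> carrier M" "y \<in> carrier M" "x \<ominus>\<^bsub>M\<^esub> y \<in> P" by (auto simp: eqmod_def)
  then have "x = (x \<ominus>\<^bsub>M\<^esub> y) \<oplus>\<^bsub>M\<^esub> y"
    by (simp add: a_minus_def M.a_assoc M.l_neg)
  then show "y \<in> carrier M \<and> (\<exists>p\<in>P. x = p \<oplus>\<^bsub>M\<^esub> y)" using * by blast
next
  assume "y \<in> carrier M \<and> (\<exists>p\<in>P. x = p \<oplus>\<^bsub>M\<^esub> y)"
  then obtain p where p: "y \<in> carrier M" "p \<in> P" "x = p \<oplus>\<^bsub>M\<^esub> y" by blast
  moreover from this have "p \<in> carrier M" using assms submodule_carrier by blast
  ultimately show "eqmod M P x y"
    by (simp add: eqmod_def a_minus_def M.a_assoc M.r_neg)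
qed

lemma eqmod_refl: "submodule P R M \<Longrightarrow> x \<in> carrier M \<Longrightarrow> eqmod M P x x"
  by (simp add: eqmod_def a_minus_def M.r_neg submodule_zero)

lemma eqmod_sym: 
  assumes "submodule P R M" "eqmod M P x y" shows "eqmod M P y x"
proof -
  have *: "x \<in> carrier M" "y \<in> carrier M" "x \<ominus>\<^bsub>M\<^esub> y \<in> P" using assms by (auto simp: eqmod_def)
  then have "y \<ominus>\<^bsub>M\<^esub> x = \<ominus>\<^bsub>M\<^esub> (x \<ominus>\<^bsub>M\<^esub> y)" by (simp add: a_minus_def M.minus_add M.a_comm)
  then show ?thesis using * submoduleE(3)[OF assms(1)] by (auto simp: eqmod_def)
qed

lemma eqmod_add: 
  assumes "submodule P R M" "eqmod M P x y" "eqmod M P x' y'"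
  shows "eqmod M P (x \<oplus>\<^bsub>M\<^esub> x') (y \<oplus>\<^bsub>M\<^esub> y')"
proof -
  obtain p p' where p: "p \<in> P" "p' \<in> P" "x = p \<oplus>\<^bsub>M\<^esub> y" "x' = p' \<oplus>\<^bsub>M\<^esub> y'"
    "y \<in> carrier M" "y' \<in> carrier M"
    using assms eqmod_alt by metis
  moreover from this have "p \<in> carrier M" "p' \<in> carrier M" 
    using assms(1) submodule_carrier by blast+
  ultimately have "x \<oplus>\<^bsub>M\<^esub> x' = (p \<oplus>\<^bsub>M\<^esub> p') \<oplus>\<^bsub>M\<^esub> (y \<oplus>\<^bsub>M\<^esub> y')" "p \<oplus>\<^bsub>M\<^esub> p' \<in> P"
    using submoduleE(5)[OF assms(1)] by (simp_all add: M.a_ac)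
  then show ?thesis using eqmod_alt[OF assms(1)] p by blast
qed

lemma eqmod_trans: 
  assumes "submodule P R M" "eqmod M P x y" "eqmod M P y z"
  shows "eqmod M P x z"
proof -
  obtain p p' where p: "p \<in> P" "p' \<in> P" "x = p \<oplus>\<^bsub>M\<^esub> y" "y = p' \<oplus>\<^bsub>M\<^esub> z" "z \<in> carrier M"
    using assms eqmod_alt by metis
  moreover from this have "p \<in> carrier M" "p' \<in> carrier M" 
    using assms(1) submodule_carrier by blast+
  ultimately have "x = (p \<oplus>\<^bsub>M\<^esub> p') \<oplus>\<^bsub>M\<^esub> z" "p \<oplus>\<^bsub>M\<^esub> p' \<in> P"
    using submoduleE(5)[OF assms(1)] by (simp_all add: M.a_ac)
  then show ?thesis using eqmod_alt[OF assms(1)] p by blast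
qed

lemma eqmod_smult: 
  assumes "submodule P R M" "r \<in> carrier R" "eqmod M P x y"
  shows "eqmod M P (r \<odot>\<^bsub>M\<^esub> x) (r \<odot>\<^bsub>M\<^esub> y)"
proof -
  obtain p where p: "p \<in> P" "x = p \<oplus>\<^bsub>M\<^esub> y" "y \<in> carrier M"
    using assms eqmod_alt by metis
  then have "r \<odot>\<^bsub>M\<^esub> x = r \<odot>\<^bsub>M\<^esub> p \<oplus>\<^bsub>M\<^esub> r \<odot>\<^bsub>M\<^esub> y" "r \<odot>\<^bsub>M\<^esub> p \<in> P"
    using assms submodule_carrier smult_r_distr submoduleE(4)[OF assms(1)] by blast+
  then show ?thesis using eqmod_alt[OF assms(1)] p assms(2) by blast
qed

lemma eqmod_zero_iff: 
  assumes "submodule P R M" shows "eqmod M P x \<zero>\<^bsub>M\<^esub> \<longleftrightarrow> x \<in> P"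
proof -
  have "x \<ominus>\<^bsub>M\<^esub> \<zero>\<^bsub>M\<^esub> = x" if "x \<in> carrier M" using that by (simp add: a_minus_def)
  then show ?thesis using assms submodule_carrier by (auto simp: eqmod_def)
qed

lemma eqmod_mem: 
  assumes "submodule P R M" "eqmod M P x y" shows "x \<in> P \<longleftrightarrow> y \<in> P"
  using assms eqmod_zero_iff eqmod_sym eqmod_trans by meson

lemma smult_r_diff:
  "\<lbrakk>a \<in> carrier R; x \<in> carrier M; y \<in> carrier M\<rbrakk> \<Longrightarrow> 
     a \<odot>\<^bsub>M\<^esub> (x \<ominus>\<^bsub>M\<^esub> y) = a \<odot>\<^bsub>M\<^esub> x \<ominus>\<^bsub>M\<^esub> a \<odot>\<^bsub>M\<^esub> y"
  by (simp add: a_minus_def smult_r_distr smult_r_minus)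

lemma smult_l_diff:
  "\<lbrakk>a \<in> carrier R; b \<in> carrier R; x \<in> carrier M\<rbrakk> \<Longrightarrow> 
     (a \<ominus> b) \<odot>\<^bsub>M\<^esub> x = a \<odot>\<^bsub>M\<^esub> x \<ominus>\<^bsub>M\<^esub> b \<odot>\<^bsub>M\<^esub> x"
  by (simp add: a_minus_def smult_l_distr smult_l_minus)

lemma smult_commute: 
  "\<lbrakk>a \<in> carrier R; b \<in> carrier R; x \<in> carrier M\<rbrakk> \<Longrightarrow> a \<odot>\<^bsub>M\<^esub> (b \<odot>\<^bsub>M\<^esub> x) = b \<odot>\<^bsub>M\<^esub> (a \<odot>\<^bsub>M\<^esub> x)"
  by (simp add: m_comm flip: smult_assoc1)

lemma lin_map_smult: "r \<in> carrier R \<Longrightarrow> lin_map R M M (\<lambda>x. r \<odot>\<^bsub>M\<^esub> x)"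
  by (simp add: lin_map_def smult_r_distr smult_commute)

lemma smult_left_lin_map: "x \<in> carrier M \<Longrightarrow> lin_map R (self_module R) M (\<lambda>r. r \<odot>\<^bsub>M\<^esub> x)"
  by (simp add: lin_map_def self_module_def smult_l_distr smult_assoc1)

text \<open>This is the colon ideal (P : H). For H = \<open>carrier M\<close> it is the annihilator
  of M/P, for a single element the annihilator of its class, and for M =
  \<open>self_module R\<close> a quotient of ideals.\<close>

lemma annihilating_ideal:
  assumes P: "submodule P R M" and H: "H \<subseteq> carrier M"
  shows "ideal {r \<in> carrier R. \<forall>x\<in>H. r \<odot>\<^bsub>M\<^esub> x \<in> P} R" (is "ideal ?J R")
proof (rule idealI)
  show "ring R" by (rule R.ring_axioms)
  show "subgroup ?J (add_monoid R)"
  proof (rule subgroup.intro)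
    fix a assume a: "a \<in> ?J"
    then show "inv\<^bsub>add_monoid R\<^esub> a \<in> ?J"
      using H smult_l_minus submoduleE(3)[OF P] unfolding a_inv_def[symmetric] 
      by (auto simp: subset_iff)
  qed (use H P in \<open>auto simp: subset_iff smult_l_distr submodule_zero intro: submoduleE(5)\<close>)
  fix a x assume ax: "a \<in> ?J" "x \<in> carrier R"
  show *: "x \<otimes> a \<in> ?J"
    using ax H submoduleE(4)[OF P] by (auto simp: subset_iff smult_assoc1)
  then show "a \<otimes> x \<in> ?J" using ax m_comm by auto
qed

end

section \<open>Linear maps and their action on submodules\<close>

lemma lin_mapD:
  assumes "lin_map R A B f" 
  shows lin_map_closed: "\<And>x. x \<in> carrier A \<Longrightarrow> f x \<in> carrier B"
    and lin_map_add: "\<And>x y. x \<in> carrier A \<Longrightarrow> y \<in> carrier A \<Longrightarrow> f (x \<oplus>\<^bsub>A\<^esub> y) = f x \<oplus>\<^bsub>B\<^esub> f y"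
    and lin_map_smult_comm: 
      "\<And>r x. r \<in> carrier R \<Longrightarrow> x \<in> carrier A \<Longrightarrow> f (r \<odot>\<^bsub>A\<^esub> x) = r \<odot>\<^bsub>B\<^esub> f x"
  using assms by (auto simp: lin_map_def)

lemma lin_map_zero: 
  assumes "Module.module R A" "Module.module R B" "lin_map R A B f"
  shows "f \<zero>\<^bsub>A\<^esub> = \<zero>\<^bsub>B\<^esub>"
proof -
  interpret A: Module.module R A by fact
  interpret B: Module.module R B by fact
  have "f (\<zero>\<^bsub>R\<^esub> \<odot>\<^bsub>A\<^esub> \<zero>\<^bsub>A\<^esub>) = \<zero>\<^bsub>R\<^esub> \<odot>\<^bsub>B\<^esub> f \<zero>\<^bsub>A\<^esub>" 
    by (rule lin_map_smult_comm[OF assms(3)]) auto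
  then show ?thesis using lin_map_closed[OF assms(3)] by simp
qed

lemma lin_map_minus: 
  assumes "Module.module R A" "Module.module R B" "lin_map R A B f" "x \<in> carrier A"
  shows "f (\<ominus>\<^bsub>A\<^esub> x) = \<ominus>\<^bsub>B\<^esub> f x"
proof -
  interpret A: Module.module R A by fact
  interpret B: Module.module R B by fact
  have "f ((\<ominus>\<^bsub>R\<^esub> \<one>\<^bsub>R\<^esub>) \<odot>\<^bsub>A\<^esub> x) = (\<ominus>\<^bsub>R\<^esub> \<one>\<^bsub>R\<^esub>) \<odot>\<^bsub>B\<^esub> f x" 
    by (rule lin_map_smult_comm[OF assms(3)]) (use assms(4) in auto)
  then show ?thesis using lin_map_closed[OF assms(3,4)] assms(4) 
    by (simp add: A.smult_l_minus B.smult_l_minus)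
qed

lemma lin_map_diff: 
  assumes "Module.module R A" "Module.module R B" "lin_map R A B f" "x \<in> carrier A" "y \<in> carrier A"
  shows "f (x \<ominus>\<^bsub>A\<^esub> y) = f x \<ominus>\<^bsub>B\<^esub> f y"
proof -
  interpret A: Module.module R A by fact
  show ?thesis unfolding a_minus_def using assms 
    by (simp add: lin_map_add lin_map_minus)
qed

lemma lin_map_comp: 
  "lin_map R A B f \<Longrightarrow> lin_map R B C g \<Longrightarrow> lin_map R A C (\<lambda>x. g (f x))"
  by (simp add: lin_map_def)

lemma lin_map_plus:
  assumes "Module.module R A" "Module.module R B" "lin_map R A B f" "lin_map R A B g"
  shows "lin_map R A B (\<lambda>x. f x \<oplus>\<^bsub>B\<^esub> g x)"
proof -
  interpret A: Module.module R A by fact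
  interpret B: Module.module R B by fact
  show ?thesis using assms(3,4) by (simp add: lin_map_def B.smult_r_distr B.M.a_ac)
qed

lemma lin_map_scale:
  assumes "Module.module R A" "Module.module R B" "lin_map R A B f" "r \<in> carrier R"
  shows "lin_map R A B (\<lambda>x. r \<odot>\<^bsub>B\<^esub> f x)"
proof -
  interpret B: Module.module R B by fact
  show ?thesis using lin_map_comp[OF assms(3) B.lin_map_smult[OF assms(4)]] .
qed

lemma lin_map_sub:
  assumes "Module.module R A" "Module.module R B" "lin_map R A B f" "lin_map R A B g"
  shows "lin_map R A B (\<lambda>x. f x \<ominus>\<^bsub>B\<^esub> g x)"
proof -
  interpret A: Module.module R A by fact
  interpret B: Module.module R B by fact
  have "lin_map R A B (\<lambda>x. f x \<oplus>\<^bsub>B\<^esub> (\<ominus>\<^bsub>R\<^esub> \<one>\<^bsub>R\<^esub>) \<odot>\<^bsub>B\<^esub> g x)"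
    by (intro lin_map_plus lin_map_scale assms) auto
  moreover have "x \<in> carrier A \<Longrightarrow> (\<ominus>\<^bsub>R\<^esub> \<one>\<^bsub>R\<^esub>) \<odot>\<^bsub>B\<^esub> g x = \<ominus>\<^bsub>B\<^esub> g x" for x
    using lin_map_closed[OF assms(4)] by (simp add: B.smult_l_minus)
  ultimately show ?thesis by (simp add: lin_map_def a_minus_def)
qed

lemma vimage_submodule:
  assumes "Module.module R A" "Module.module R B" "lin_map R A B f" "submodule P R B"
  shows "submodule {x \<in> carrier A. f x \<in> P} R A"
proof -
  interpret A: Module.module R A by fact
  interpret B: Module.module R B by fact
  show ?thesis
    by (rule A.submoduleI')
      (use assms(3) B.submoduleE[OF assms(4)] B.submodule_zero[OF assms(4)] lin_map_zero[OF assms(1-3)] 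
        in \<open>auto simp: lin_map_def\<close>)
qed

lemma image_submodule:
  assumes "Module.module R A" "Module.module R B" "lin_map R A B f" "submodule P R A"
  shows "submodule (f ` P) R B"
proof -
  interpret A: Module.module R A by fact
  interpret B: Module.module R B by fact
  have P: "P \<subseteq> carrier A" using A.submoduleE[OF assms(4)] by auto
  show ?thesis
  proof (rule B.submoduleI')
    show "\<zero>\<^bsub>B\<^esub> \<in> f ` P" using lin_map_zero[OF assms(1-3)] A.submodule_zero[OF assms(4)]
      by (metis imageI)
    fix a b assume "a \<in> f ` P" "b \<in> f ` P"
    then obtain x y where "x \<in> P" "y \<in> P" "a = f x" "b = f y" by blast
    then show "a \<oplus>\<^bsub>B\<^esub> b \<in> f ` P" 
      using lin_map_add[OF assms(3), of x y] A.submoduleE(5)[OF assms(4), of x y] P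
      by (metis imageI subsetD)
  next
    fix r a assume "r \<in> carrier R" "a \<in> f ` P" 
    then obtain x where "x \<in> P" "a = f x" by blast
    then show "r \<odot>\<^bsub>B\<^esub> a \<in> f ` P" 
      using lin_map_smult_comm[OF assms(3), of r x] A.submoduleE(4)[OF assms(4), of r x] P
       \<open>r \<in> carrier R\<close> by (metis imageI subsetD)
  qed (use P lin_map_closed[OF assms(3)] in auto)
qed

lemma eqmod_submodule:
  assumes "Module.module R A" "Module.module R B" "lin_map R A B f" "lin_map R A B g" 
    "submodule P R B"
  shows "submodule {x \<in> carrier A. eqmod B P (f x) (g x)} R A"
proof -
  interpret A: Module.module R A by fact
  interpret B: Module.module R B by fact
  have "{x \<in> carrier A. eqmod B P (f x) (g x)} = {x \<in> carrier A. f x \<ominus>\<^bsub>B\<^esub> g x \<in> P}"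
    using assms(3,4) by (auto simp: eqmod_def lin_map_def)
  then show ?thesis
    using vimage_submodule[OF assms(1,2) lin_map_sub[OF assms(1-4)] assms(5)] by simp
qed

lemma lin_map_eqmod:
  assumes "Module.module R A" "Module.module R B" "lin_map R A B f" 
    "eqmod A P x y" "\<And>p. p \<in> P \<Longrightarrow> f p \<in> Q"
  shows "eqmod B Q (f x) (f y)"
  using assms(4,5) lin_map_closed[OF assms(3)] lin_map_diff[OF assms(1-3), of x y] 
  by (metis eqmod_def)

lemma self_module: 
  assumes "cring R" shows "Module.module R (self_module R)"
proof -
  interpret cring R by fact
  show ?thesis
  proof (rule moduleI)
    show "abelian_group (self_module R)"
      by (rule abelian_groupI)
         (auto simp: self_module_def a_ac intro: bexI[of _ "\<ominus>\<^bsub>R\<^esub> _"] l_neg)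
  qed (auto simp: self_module_def assms l_distr r_distr m_assoc)
qed

lemma submodule_self_iff_ideal: 
  assumes "cring R" shows "submodule I R (self_module R) \<longleftrightarrow> ideal I R"
proof -
  interpret cring R by fact
  interpret S: Module.module R "self_module R" by (rule self_module) fact
  have eq: "subgroup I (add_monoid (self_module R)) \<longleftrightarrow> subgroup I (add_monoid R)" 
    by (simp add: subgroup_def self_module_def m_inv_def)
  show ?thesis
  proof
    assume "submodule I R (self_module R)"
    then have sg: "subgroup I (add_monoid R)" 
      and *: "\<And>r x. r \<in> carrier R \<Longrightarrow> x \<in> I \<Longrightarrow> r \<otimes>\<^bsub>R\<^esub> x \<in> I"
      using S.submoduleE(4)[of I] by (auto simp: submodule_def eq) (simp add: self_module_def)
    moreover have "x \<in> I \<Longrightarrow> x \<in> carrier R" for x using subgroup.subset[OF sg] by auto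
    ultimately show "ideal I R"
      by (intro idealI) (auto simp: ring_axioms, metis m_comm)
  next
    assume "ideal I R" 
    then interpret I: ideal I R .
    show "submodule I R (self_module R)"
      by (rule submodule.intro) 
         (use I.a_subgroup in \<open>simp_all only: eq, auto simp: submodule_axioms_def self_module_def I.I_l_closed\<close>)
  qed
qed

section \<open>Free modules of finite rank\<close>

definition unit_vec :: "('a, 'r) ring_scheme \<Rightarrow> nat \<Rightarrow> nat \<Rightarrow> nat \<Rightarrow> 'a" where
  "unit_vec R n i = (\<lambda>j\<in>{..<n}. if j = i then \<one>\<^bsub>R\<^esub> else \<zero>\<^bsub>R\<^esub>)"

context cring
begin

lemma free_module: "Module.module R (free_module R n)"
proof (rule moduleI)
  show "abelian_group (free_module R n)"
  proof (rule abelian_groupI)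
    fix v assume v: "v \<in> carrier (free_module R n)"
    then show "\<exists>w\<in>carrier (free_module R n). w \<oplus>\<^bsub>free_module R n\<^esub> v = \<zero>\<^bsub>free_module R n\<^esub>"
      by (intro bexI[of _ "\<lambda>i\<in>{..<n}. \<ominus> v i"]) 
         (auto simp: free_module_def PiE_iff intro!: restrict_ext l_neg)
    show "\<zero>\<^bsub>free_module R n\<^esub> \<oplus>\<^bsub>free_module R n\<^esub> v = v"
      using v by (auto simp: free_module_def PiE_iff extensional_def fun_eq_iff)
  qed (auto simp: free_module_def PiE_iff a_ac intro!: restrict_ext)
qed (auto simp: free_module_def PiE_iff l_distr r_distr m_assoc extensional_def fun_eq_iff 
       intro: is_cring intro!: restrict_ext)

lemma unit_vec_closed: "unit_vec R n i \<in> carrier (free_module R n)"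
  by (auto simp: unit_vec_def free_module_def)

lemma free_module_coord: "v \<in> carrier (free_module R n) \<Longrightarrow> i < n \<Longrightarrow> v i \<in> carrier R"
  by (auto simp: free_module_def)

lemma coord_lin_map: "i < n \<Longrightarrow> lin_map R (free_module R n) (self_module R) (\<lambda>v. v i)"
  by (auto simp: lin_map_def free_module_def self_module_def)

lemma free_module_eqI:
  assumes "v \<in> carrier (free_module R n)" "w \<in> carrier (free_module R n)" "\<And>i. i < n \<Longrightarrow> v i = w i"
  shows "v = w"
  using assms PiE_ext[of v "{..<n}" "\<lambda>_. carrier R" w] by (auto simp: free_module_def)

lemma unit_vec_generate:
  assumes Q: "submodule Q R (free_module R n)" and u: "\<And>i. i < n \<Longrightarrow> unit_vec R n i \<in> Q"
  shows "Q = carrier (free_module R n)"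
proof -
  interpret F: Module.module R "free_module R n" by (rule free_module)
  \<comment> \<open>Induction on the number k of leading coordinates kept; truncating v after k
    coordinates avoids writing v as a finite sum.\<close>
  have *: "k \<le> n \<Longrightarrow> v \<in> carrier (free_module R n) \<Longrightarrow> (\<lambda>i\<in>{..<n}. if i < k then v i else \<zero>) \<in> Q" for k v
  proof (induction k)
    case 0
    then show ?case using F.submodule_zero[OF Q] by (simp add: free_module_def restrict_def)
  next
    case (Suc k)
    have "(\<lambda>i\<in>{..<n}. if i < Suc k then v i else \<zero>) = (\<lambda>i\<in>{..<n}. if i < k then v i else \<zero>)
        \<oplus>\<^bsub>free_module R n\<^esub> v k \<odot>\<^bsub>free_module R n\<^esub> unit_vec R n k"
      using Suc free_module_coord[OF Suc.prems(2)] 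
      by (auto simp: free_module_def unit_vec_def fun_eq_iff less_Suc_eq)
    moreover have "v k \<odot>\<^bsub>free_module R n\<^esub> unit_vec R n k \<in> Q"
      using Suc.prems F.submoduleE(4)[OF Q] u free_module_coord[OF Suc.prems(2), of k] by simp
    moreover have "(\<lambda>i\<in>{..<n}. if i < k then v i else \<zero>) \<in> Q"
      using Suc by (simp add: restrict_def)
    ultimately show ?case 
      using F.submoduleE(5)[OF Q] by metis
  qed
  have "v \<in> Q" if "v \<in> carrier (free_module R n)" for v
  proof -
    have "(\<lambda>i\<in>{..<n}. if i < n then v i else \<zero>) = v"
      using that by (auto simp: free_module_def PiE_iff extensional_def fun_eq_iff)
    then show ?thesis using *[OF le_refl that] by simp
  qed
  then show ?thesis using F.submoduleE(1)[OF Q] by blast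
qed

end

lemma (in Module.module) free_module_map:
  assumes a: "\<And>i. i < n \<Longrightarrow> a i \<in> carrier M"
  obtains g where "lin_map R (free_module R n) M g" "\<And>i. i < n \<Longrightarrow> g (unit_vec R n i) = a i"
proof -
  define g where "g v = (\<Oplus>\<^bsub>M\<^esub>i\<in>{..<n}. v i \<odot>\<^bsub>M\<^esub> a i)" for v
  have "lin_map R (free_module R n) M g"
    unfolding lin_map_def
  proof (intro conjI ballI)
    fix v w assume v: "v \<in> carrier (free_module R n)" and w: "w \<in> carrier (free_module R n)"
    note [simp] = R.free_module_coord[OF v] R.free_module_coord[OF w] a
    show "g v \<in> carrier M" by (auto simp: g_def)
    have "g v \<oplus>\<^bsub>M\<^esub> g w = (\<Oplus>\<^bsub>M\<^esub>i\<in>{..<n}. v i \<odot>\<^bsub>M\<^esub> a i \<oplus>\<^bsub>M\<^esub> w i \<odot>\<^bsub>M\<^esub> a i)"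
      unfolding g_def by (rule M.finsum_addf[symmetric]) auto
    also have "\<dots> = g (v \<oplus>\<^bsub>free_module R n\<^esub> w)"
      unfolding g_def 
      by (rule M.finsum_cong') (auto simp: free_module_def smult_l_distr)
    finally show "g (v \<oplus>\<^bsub>free_module R n\<^esub> w) = g v \<oplus>\<^bsub>M\<^esub> g w" by simp
  next
    fix r v assume r: "r \<in> carrier R" and v: "v \<in> carrier (free_module R n)"
    note [simp] = R.free_module_coord[OF v] r a
    have "r \<odot>\<^bsub>M\<^esub> g v = (\<Oplus>\<^bsub>M\<^esub>i\<in>{..<n}. r \<odot>\<^bsub>M\<^esub> (v i \<odot>\<^bsub>M\<^esub> a i))"
      unfolding g_def by (rule finsum_smult_ldistr) auto
    also have "\<dots> = g (r \<odot>\<^bsub>free_module R n\<^esub> v)"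
      unfolding g_def 
      by (rule M.finsum_cong') (auto simp: free_module_def smult_assoc1)
    finally show "g (r \<odot>\<^bsub>free_module R n\<^esub> v) = r \<odot>\<^bsub>M\<^esub> g v" by simp
  qed
  moreover have "g (unit_vec R n i) = a i" if "i < n" for i
  proof -
    have "g (unit_vec R n i) = (\<Oplus>\<^bsub>M\<^esub>j\<in>{..<n}. if i = j then a j else \<zero>\<^bsub>M\<^esub>)"
      unfolding g_def by (rule M.finsum_cong') (auto simp: unit_vec_def a that)
    also have "\<dots> = a i" by (rule M.finsum_singleton) (use a that in auto)
    finally show ?thesis .
  qed
  ultimately show ?thesis using that by blast
qed

text \<open>Projectivity of a finite free module, modulo P: preimages are chosen for the unit
  vectors, and the elements where the congruence holds form a submodule containing them. Lifts of
  chain maps, null-homotopies and connecting cocycles are all instances.\<close>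

lemma free_module_lift:
  fixes R :: "('a, 'r) ring_scheme" and n :: nat
  defines "F \<equiv> free_module R n"
  assumes A: "Module.module R A" and B: "Module.module R B"
    and f: "lin_map R F B f" and h: "lin_map R A B h" and P: "submodule P R B"
    and ex: "\<And>x. x \<in> carrier F \<Longrightarrow> \<exists>y\<in>carrier A. eqmod B P (f x) (h y)"
  obtains g where "lin_map R F A g" "\<And>x. x \<in> carrier F \<Longrightarrow> eqmod B P (f x) (h (g x))"
proof -
  interpret A: Module.module R A by fact
  have F: "Module.module R F" unfolding F_def by (rule A.R.free_module)
  have "\<exists>y. y \<in> carrier A \<and> eqmod B P (f (unit_vec R n i)) (h y)" for i
    using ex[of "unit_vec R n i"] A.R.unit_vec_closed[of n i] by (auto simp: F_def)
  then obtain a where a: "\<And>i. a i \<in> carrier A \<and> eqmod B P (f (unit_vec R n i)) (h (a i))"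
    by metis
  then obtain g where g: "lin_map R F A g" "\<And>i. i < n \<Longrightarrow> g (unit_vec R n i) = a i"
    using A.free_module_map[of n a] by (auto simp: F_def)
  have "submodule {x \<in> carrier F. eqmod B P (f x) (h (g x))} R F"
    by (rule eqmod_submodule[OF F B f lin_map_comp[OF g(1) h] P])
  then have "{x \<in> carrier F. eqmod B P (f x) (h (g x))} = carrier F"
    unfolding F_def by (rule A.R.unit_vec_generate) (use a g A.R.unit_vec_closed in \<open>auto simp: F_def\<close>)
  then show ?thesis using that g by blast
qed

section \<open>Noetherian modules\<close>

definition noetherian_module :: "('a, 'r) ring_scheme \<Rightarrow> ('a, 'b, 'm) module_scheme \<Rightarrow> bool" where
  "noetherian_module R M \<longleftrightarrow> 
     (\<forall>H. submodule H R M \<longrightarrow> (\<exists>S. finite S \<and> S \<subseteq> H \<and> gen_submodule R M S = H))"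

text \<open>Zorn's lemma: the union of a chain is finitely generated, and its generators already lie
  in one member.\<close>

lemma (in Module.module) noetherian_module_maximal:
  assumes N: "noetherian_module R M" and C: "C \<noteq> {}" "\<And>H. H \<in> C \<Longrightarrow> submodule H R M"
  shows "\<exists>H\<in>C. \<forall>K\<in>C. H \<subseteq> K \<longrightarrow> K = H"
proof -
  have "\<Union>\<C> \<in> C" if ne: "\<C> \<noteq> {}" and ch: "subset.chain C \<C>" for \<C>
  proof -
    have CC: "\<C> \<subseteq> C" using ch by (auto simp: pred_on.chain_def)
    have comparable: "X \<subseteq> Y \<or> Y \<subseteq> X" if "X \<in> \<C>" "Y \<in> \<C>" for X Y
      using ch that unfolding pred_on.chain_def by blast
    have fin: "\<exists>X\<in>\<C>. S \<subseteq> X" if "finite S" "S \<subseteq> \<Union>\<C>" for S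
      using that
    proof (induction S)
      case empty then show ?case using ne by auto
    next
      case (insert x S)
      then obtain X Y where "X \<in> \<C>" "S \<subseteq> X" "Y \<in> \<C>" "x \<in> Y" by auto
      then show ?case using comparable[of X Y] by blast
    qed
    have "submodule (\<Union>\<C>) R M"
    proof (rule submoduleI')
      show "\<Union>\<C> \<subseteq> carrier M" using CC C submoduleE(1) by blast
      show "\<zero>\<^bsub>M\<^esub> \<in> \<Union>\<C>" using CC C ne submodule_zero by blast
      fix a b assume "a \<in> \<Union>\<C>" "b \<in> \<Union>\<C>"
      then obtain X where "X \<in> \<C>" "a \<in> X" "b \<in> X" using fin[of "{a, b}"] by auto
      then show "a \<oplus>\<^bsub>M\<^esub> b \<in> \<Union>\<C>" using C(2) CC submoduleE(5) by blast
    next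
      fix r a assume "r \<in> carrier R" "a \<in> \<Union>\<C>"
      then show "r \<odot>\<^bsub>M\<^esub> a \<in> \<Union>\<C>" using C(2) CC submoduleE(4) by blast
    qed
    then obtain S where S: "finite S" "S \<subseteq> \<Union>\<C>" "gen_submodule R M S = \<Union>\<C>"
      using N by (auto simp: noetherian_module_def)
    then obtain X where X: "X \<in> \<C>" "S \<subseteq> X" using fin by blast
    then have "\<Union>\<C> \<subseteq> X" using S gen_submodule_minimal C CC by (metis subsetD)
    then have "\<Union>\<C> = X" using X by blast
    then show ?thesis using X CC by auto
  qed
  from subset_Zorn_nonempty[OF C(1) this] show ?thesis by blast
qed

lemma (in noetherian_ring) maximal_ideal_in:
  assumes C: "C \<noteq> {}" "\<And>I. I \<in> C \<Longrightarrow> ideal I R"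
  shows "\<exists>I\<in>C. \<forall>J\<in>C. I \<subseteq> J \<longrightarrow> J = I"
proof -
  have "\<Union>\<C> \<in> C" if ne: "\<C> \<noteq> {}" and ch: "subset.chain C \<C>" for \<C>
  proof -
    have "\<C> \<subseteq> C" "subset.chain {I. ideal I R} \<C>" using ch C by (auto simp: pred_on.chain_def)
    then show ?thesis using ideal_chain_is_trivial[OF ne] by blast
  qed
  from subset_Zorn_nonempty[OF C(1) this] show ?thesis by blast
qed

text \<open>Induction along the filtration by U k, the vectors supported in the first k coordinates.
  The last coordinates of H \<inter> U (k + 1) form an ideal; lifts of its finitely many generators,
  together with generators of H \<inter> U k, generate H \<inter> U (k + 1).\<close>

lemma (in cring) free_module_noetherian:
  assumes "noetherian_ring R"
  shows "noetherian_module R (free_module R n)"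
  unfolding noetherian_module_def
proof (intro allI impI)
  let ?F = "free_module R n"
  interpret F: Module.module R ?F by (rule free_module)
  interpret S: Module.module R "self_module R" by (rule self_module) (rule is_cring)
  fix H assume H: "submodule H R ?F"
  define U where "U k = {h \<in> carrier ?F. \<forall>i. k \<le> i \<longrightarrow> i < n \<longrightarrow> h i = \<zero>}" for k
  have U: "submodule (U k) R ?F" for k
    by (rule F.submoduleI') (auto simp: U_def free_module_def)
  have "\<exists>S. finite S \<and> S \<subseteq> H \<inter> U k \<and> gen_submodule R ?F S = H \<inter> U k" if "k \<le> n" for k
    using that
  proof (induction k)
    case 0
    have "U 0 = {\<zero>\<^bsub>?F\<^esub>}"
      using F.M.zero_closed
      by (auto simp: U_def intro!: free_module_eqI[of _ n]) (auto simp: free_module_def)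
    moreover have "gen_submodule R ?F {} = {\<zero>\<^bsub>?F\<^esub>}"
      using F.gen_submodule_minimal[OF F.zero_submodule, of "{}"] 
        F.submodule_zero[OF F.gen_submodule[of "{}"]] by auto
    ultimately show ?case using F.submodule_zero[OF H] by (intro exI[of _ "{}"]) auto
  next
    case (Suc k)
    then have k: "k < n" and "k \<le> n" by auto
    then obtain S where S: "finite S" "S \<subseteq> H \<inter> U k" "gen_submodule R ?F S = H \<inter> U k"
      using Suc.IH by blast
    let ?c = "\<lambda>v. v k"
    note c = coord_lin_map[OF k]
    have "ideal (?c ` (H \<inter> U (Suc k))) R"
      using image_submodule[OF free_module S.module_axioms c F.submodule_Int[OF H U]]
        submodule_self_iff_ideal[OF is_cring] by blast
    then obtain A where A: "finite A" "?c ` (H \<inter> U (Suc k)) = Idl A" "A \<subseteq> carrier R"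
      using noetherian_ring.finetely_gen[OF assms] by metis
    have "\<forall>a\<in>A. \<exists>h. h \<in> H \<inter> U (Suc k) \<and> h k = a"
    proof
      fix a assume "a \<in> A"
      then have "a \<in> ?c ` (H \<inter> U (Suc k))" using A(2) genideal_self[OF A(3)] by blast
      then show "\<exists>h. h \<in> H \<inter> U (Suc k) \<and> h k = a" by auto
    qed
    then obtain h where h: "\<And>a. a \<in> A \<Longrightarrow> h a \<in> H \<inter> U (Suc k) \<and> h a k = a" by metis
    let ?T = "S \<union> h ` A"
    have "U k \<subseteq> U (Suc k)" by (auto simp: U_def)
    then have T: "?T \<subseteq> H \<inter> U (Suc k)" using S h by blast
    have sub: "submodule (gen_submodule R ?F ?T) R ?F"
      by (rule F.gen_submodule) (use T in \<open>auto simp: U_def\<close>)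
    have "H \<inter> U (Suc k) \<subseteq> gen_submodule R ?F ?T"
    proof
      fix v assume v: "v \<in> H \<inter> U (Suc k)"
      have "ideal (?c ` gen_submodule R ?F ?T) R"
        using image_submodule[OF free_module S.module_axioms c sub]
          submodule_self_iff_ideal[OF is_cring] by blast
      moreover have "A \<subseteq> ?c ` gen_submodule R ?F ?T"
      proof
        fix a assume a: "a \<in> A"
        then have "h a \<in> gen_submodule R ?F ?T" using F.gen_submodule_superset[of ?T] by blast
        then show "a \<in> ?c ` gen_submodule R ?F ?T" using h[OF a] by (metis imageI)
      qed
      ultimately have "Idl A \<subseteq> ?c ` gen_submodule R ?F ?T" by (rule genideal_minimal)
      then obtain w where w: "w \<in> gen_submodule R ?F ?T" "v k = w k" using A(2) v by blast
      have wH: "w \<in> H \<inter> U (Suc k)" 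
        using F.gen_submodule_minimal[OF F.submodule_Int[OF H U] T] w by blast
      have d: "v \<ominus>\<^bsub>?F\<^esub> w \<in> H \<inter> U (Suc k)" 
        by (rule F.submodule_diff[OF F.submodule_Int[OF H U] v wH])
      have wv: "v \<in> carrier ?F" "w \<in> carrier ?F" using v wH by (auto simp: U_def)
      have "(v \<ominus>\<^bsub>?F\<^esub> w) k = v k \<ominus>\<^bsub>self_module R\<^esub> w k" 
        by (rule lin_map_diff[OF free_module S.module_axioms c wv])
      also have "\<dots> = \<zero>\<^bsub>self_module R\<^esub>" using w(2) lin_map_closed[OF c wv(2)]
        by (simp add: a_minus_def S.M.r_neg)
      finally have "(v \<ominus>\<^bsub>?F\<^esub> w) k = \<zero>" by (simp add: self_module_def)
      then have "v \<ominus>\<^bsub>?F\<^esub> w \<in> U k" using d by (auto simp: U_def) (metis le_antisym not_less_eq_eq)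
      then have "v \<ominus>\<^bsub>?F\<^esub> w \<in> gen_submodule R ?F S" using S d by auto
      then have "v \<ominus>\<^bsub>?F\<^esub> w \<in> gen_submodule R ?F ?T"
        using F.gen_submodule_minimal[OF sub, of S] F.gen_submodule_superset[of ?T] by blast
      then have "(v \<ominus>\<^bsub>?F\<^esub> w) \<oplus>\<^bsub>?F\<^esub> w \<in> gen_submodule R ?F ?T"
        using F.submoduleE(5)[OF sub] w by blast
      then show "v \<in> gen_submodule R ?F ?T"
        using wv by (simp add: a_minus_def F.M.a_assoc F.M.l_neg)
    qed
    then show ?case using F.gen_submodule_minimal[OF F.submodule_Int[OF H U] T] T S(1) A(1)
      by (intro exI[of _ ?T]) auto
  qed
  from this[of n] have "\<exists>S. finite S \<and> S \<subseteq> H \<inter> U n \<and> gen_submodule R ?F S = H \<inter> U n" by simp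
  moreover have "H \<inter> U n = H" using F.submoduleE(1)[OF H] by (auto simp: U_def)
  ultimately show "\<exists>S. finite S \<and> S \<subseteq> H \<and> gen_submodule R ?F S = H" by simp
qed

section \<open>Finitely generated modules over a Noetherian ring are Noetherian\<close>

lemma lin_map_gen_submodule:
  assumes A: "Module.module R A" and B: "Module.module R B" and f: "lin_map R A B f" 
    and S: "S \<subseteq> carrier A"
  shows "f ` gen_submodule R A S = gen_submodule R B (f ` S)"
proof
  interpret A: Module.module R A by fact
  interpret B: Module.module R B by fact
  have fS: "f ` S \<subseteq> carrier B" using S lin_map_closed[OF f] by blast
  show "gen_submodule R B (f ` S) \<subseteq> f ` gen_submodule R A S"
    by (rule B.gen_submodule_minimal[OF image_submodule[OF A B f A.gen_submodule[OF S]]])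
       (use A.gen_submodule_superset[of S] in blast)
  have "gen_submodule R A S \<subseteq> {x \<in> carrier A. f x \<in> gen_submodule R B (f ` S)}"
    by (rule A.gen_submodule_minimal[OF vimage_submodule[OF A B f B.gen_submodule[OF fS]]])
       (use B.gen_submodule_superset[of "f ` S"] S in blast)
  then show "f ` gen_submodule R A S \<subseteq> gen_submodule R B (f ` S)" by blast
qed

lemma noetherian_module_image:
  assumes A: "Module.module R A" and B: "Module.module R B" and f: "lin_map R A B f" 
    and surj: "f ` carrier A = carrier B" and N: "noetherian_module R A"
  shows "noetherian_module R B"
  unfolding noetherian_module_def
proof (intro allI impI)
  interpret A: Module.module R A by fact
  interpret B: Module.module R B by fact
  fix H assume H: "submodule H R B"
  let ?K = "{x \<in> carrier A. f x \<in> H}"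
  obtain S where S: "finite S" "S \<subseteq> ?K" "gen_submodule R A S = ?K"
    using N[unfolded noetherian_module_def, rule_format, OF vimage_submodule[OF A B f H]] by blast
  have "f ` ?K = H"
  proof
    show "H \<subseteq> f ` ?K" 
    proof
      fix y assume y: "y \<in> H"
      then have "y \<in> f ` carrier A" using surj B.submoduleE(1)[OF H] by blast
      then show "y \<in> f ` ?K" using y by blast
    qed
  qed auto
  then have "gen_submodule R B (f ` S) = H"
    using lin_map_gen_submodule[OF A B f, of S] S by auto
  then show "\<exists>S. finite S \<and> S \<subseteq> H \<and> gen_submodule R B S = H"
    using S by (intro exI[of _ "f ` S"]) auto
qed

lemma (in Module.module) finite_generators_surj:
  assumes "finite S" "S \<subseteq> carrier M"
  shows "\<exists>n f. lin_map R (free_module R n) M f \<and> 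
    f ` carrier (free_module R n) = gen_submodule R M S"
proof -
  obtain s where s: "bij_betw s {..<card S} S"
    using ex_bij_betw_nat_finite[OF assms(1)] by (auto simp: atLeast0LessThan)
  let ?F = "free_module R (card S)"
  obtain f where f: "lin_map R ?F M f" "\<And>i. i < card S \<Longrightarrow> f (unit_vec R (card S) i) = s i"
    by (rule free_module_map[of "card S" s]) (use s assms(2) in \<open>auto simp: bij_betw_def\<close>)
  let ?E = "unit_vec R (card S) ` {..<card S}"
  have E: "?E \<subseteq> carrier ?F" using R.unit_vec_closed by blast
  interpret F: Module.module R ?F by (rule R.free_module)
  have "gen_submodule R ?F ?E = carrier ?F"
    by (rule R.unit_vec_generate[OF F.gen_submodule[OF E]]) (use F.gen_submodule_superset[of ?E] in blast)
  moreover have "f ` ?E = S" using f(2) s by (auto simp: bij_betw_def image_image)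
  ultimately have "f ` carrier ?F = gen_submodule R M S"
    using lin_map_gen_submodule[OF F.module_axioms module_axioms f(1) E] by simp
  then show ?thesis using f(1) by blast
qed

lemma fin_gen_noetherian:
  assumes "noetherian_ring R" "fin_gen_module R M"
  shows "noetherian_module R M"
proof -
  interpret Module.module R M using assms(2) by (simp add: fin_gen_module_def)
  obtain S where S: "finite S" "S \<subseteq> carrier M" "gen_submodule R M S = carrier M"
    using assms(2) by (auto simp: fin_gen_module_def)
  obtain n f where f: "lin_map R (free_module R n) M f" "f ` carrier (free_module R n) = carrier M"
    using finite_generators_surj[OF S(1,2)] unfolding S(3) by blast
  show ?thesis
    by (rule noetherian_module_image[OF R.free_module module_axioms f R.free_module_noetherian[OF assms(1)]])
qed

section \<open>Powers of an ideal and the Artin--Rees property\<close>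

abbreviation ideal_pow :: "('a, 'r) ring_scheme \<Rightarrow> 'a set \<Rightarrow> nat \<Rightarrow> 'a set" where
  "ideal_pow R \<aa> n \<equiv> \<aa> [^]\<^bsub>ideals_set R\<^esub> n"

text \<open>The submodule IZ. Artin--Rees needs it for proper submodules Z, while
  \<open>ideal_smult\<close> is the case Z = M.\<close>

definition ideal_sub :: 
    "('a, 'r) ring_scheme \<Rightarrow> 'a set \<Rightarrow> ('a, 'b, 'm) module_scheme \<Rightarrow> 'b set \<Rightarrow> 'b set" where
  "ideal_sub R I M Z = gen_submodule R M {r \<odot>\<^bsub>M\<^esub> z | r z. r \<in> I \<and> z \<in> Z}"

lemma ideal_smult_eq: "ideal_smult R I M = ideal_sub R I M (carrier M)"
  by (simp add: ideal_smult_def ideal_sub_def)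

context cring
begin

lemma ideal_pow:
  assumes "ideal \<aa> R"
  shows ideal_pow_ideal: "ideal (ideal_pow R \<aa> n) R"
    and ideal_pow_add: "ideal_pow R \<aa> (m + n) = ideal_pow R \<aa> m \<cdot> ideal_pow R \<aa> n"
    and ideal_pow_Suc: "ideal_pow R \<aa> (Suc n) = ideal_pow R \<aa> n \<cdot> \<aa>"
    and ideal_pow_0: "ideal_pow R \<aa> 0 = carrier R"
proof -
  interpret I: comm_monoid "ideals_set R" by (rule ideals_set_is_comm_monoid)
  have a: "\<aa> \<in> carrier (ideals_set R)" using assms by (simp add: ideals_set_def)
  show "ideal (ideal_pow R \<aa> n) R" using I.nat_pow_closed[OF a, of n] by (simp add: ideals_set_def)
  show "ideal_pow R \<aa> (m + n) = ideal_pow R \<aa> m \<cdot> ideal_pow R \<aa> n"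
    using I.nat_pow_mult[OF a, of m n] by (simp add: ideals_set_def)
  show "ideal_pow R \<aa> (Suc n) = ideal_pow R \<aa> n \<cdot> \<aa>" "ideal_pow R \<aa> 0 = carrier R"
    by (simp_all add: ideals_set_def)
qed

lemma ideal_pow_1: "ideal \<aa> R \<Longrightarrow> ideal_pow R \<aa> (Suc 0) = \<aa>"
  by (metis ideal_pow_Suc ideal_pow_0 ideal_prod_commute ideal_prod_one oneideal)

lemma ideal_pow_antimono:
  assumes "ideal \<aa> R" shows "ideal_pow R \<aa> (n + k) \<subseteq> ideal_pow R \<aa> n"
  unfolding ideal_pow_add[OF assms]
  using ideal_prod_inter[OF ideal_pow_ideal[OF assms] ideal_pow_ideal[OF assms]] by blast

lemma ideal_pow_antimono':
  assumes "ideal \<aa> R" "n \<le> m" shows "ideal_pow R \<aa> m \<subseteq> ideal_pow R \<aa> n"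
  using ideal_pow_antimono[OF assms(1), of n "m - n"] assms(2) by simp

lemma pow_mem_ideal_pow: "ideal \<aa> R \<Longrightarrow> y \<in> \<aa> \<Longrightarrow> y [^] n \<in> ideal_pow R \<aa> n"
proof (induction n)
  case 0
  then show ?case using ideal_pow_0[of \<aa>] by simp
next
  case (Suc n)
  then show ?case unfolding ideal_pow_Suc[OF Suc.prems(1)] by (simp add: ideal_prod.prod)
qed

text \<open>Noetherian induction instead of generators and multinomials. For W maximal among the
  counterexamples, the colon ideals Q = (W : y) and Q' = (W : Q) are both strictly larger than W and
  satisfy Q'Q \<subseteq> W, so powers of \<aa> inside Q' and Q multiply to a power inside
  W.\<close>

lemma ideal_pow_subset_ideal:
  assumes N: "noetherian_ring R" and a: "ideal \<aa> R" and W0: "ideal W0 R" 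
    and pw: "\<And>w. w \<in> \<aa> \<Longrightarrow> \<exists>k::nat. w [^] k \<in> W0"
  shows "\<exists>K. ideal_pow R \<aa> K \<subseteq> W0"
proof (rule ccontr)
  assume neg: "\<not> ?thesis"
  interpret S: Module.module R "self_module R" by (rule self_module) (rule is_cring)
  let ?C = "{W. ideal W R \<and> W0 \<subseteq> W \<and> \<not> (\<exists>K. ideal_pow R \<aa> K \<subseteq> W)}"
  have "?C \<noteq> {}" using W0 neg by blast
  then have "\<exists>W\<in>?C. \<forall>J\<in>?C. W \<subseteq> J \<longrightarrow> J = W"
    by (rule noetherian_ring.maximal_ideal_in[OF N]) blast
  then obtain W where W: "W \<in> ?C" and max': "\<forall>J\<in>?C. W \<subseteq> J \<longrightarrow> J = W" by (rule bexE)
  note max = max'[rule_format]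
  have WI: "ideal W R" and "W0 \<subseteq> W" and nW: "\<And>K. \<not> ideal_pow R \<aa> K \<subseteq> W" using W by auto
  interpret W: ideal W R by (rule WI)
  have a_car: "\<aa> \<subseteq> carrier R" using a by (simp add: additive_subgroup.a_subset ideal.axioms(1))
  obtain x where x: "x \<in> \<aa>" "x \<notin> W" using nW[of "Suc 0"] ideal_pow_1[OF a] by blast
  then have xc: "x \<in> carrier R" using a_car by blast
  \<comment> \<open>The element y below is the last power of x outside W: then x lies in Q and y in
    Q', while neither lies in W, which makes both ideals strictly larger.\<close>
  define n where "n = (LEAST n::nat. x [^] n \<in> W)"
  have ex: "\<exists>n::nat. x [^] n \<in> W" using pw x \<open>W0 \<subseteq> W\<close> by blast
  have n: "x [^] n \<in> W" unfolding n_def by (rule LeastI_ex[OF ex])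
  have "n \<noteq> 0"
  proof
    assume "n = 0"
    then have "W = carrier R" using n W.one_imp_carrier by simp
    then show False using nW[of 0] ideal_pow_0[OF a] by simp
  qed
  then obtain m where m: "n = Suc m" by (cases n) auto
  define y where "y = x [^] m"
  have y: "y \<notin> W" "y \<in> carrier R" using not_less_Least[of m "\<lambda>n. x [^] n \<in> W"] m xc 
    by (auto simp: y_def n_def)
  have yx: "x \<otimes> y \<in> W" using n m xc by (simp add: y_def m_comm)
  have col: "ideal {r \<in> carrier R. \<forall>s\<in>H. r \<otimes> s \<in> W} R" if "H \<subseteq> carrier R" for H
    using S.annihilating_ideal[of W H] that WI submodule_self_iff_ideal[OF is_cring, of W]
    by (simp add: self_module_def)
  define Q where "Q = {r \<in> carrier R. \<forall>s\<in>{y}. r \<otimes> s \<in> W}"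
  define Q' where "Q' = {r \<in> carrier R. \<forall>s\<in>Q. r \<otimes> s \<in> W}"
  have Q: "ideal Q R" unfolding Q_def by (rule col) (use y in auto)
  have Q': "ideal Q' R" unfolding Q'_def by (rule col) (auto simp: Q_def)
  have "W \<subseteq> Q" using W.I_r_closed y(2) W.a_subset by (auto simp: Q_def)
  have "W \<subseteq> Q'" using W.I_r_closed W.a_subset by (auto simp: Q'_def Q_def)
  have "x \<in> Q" using yx xc by (simp add: Q_def)
  have "y \<in> Q'" using y by (auto simp: Q'_def Q_def m_comm)
  have "Q \<noteq> W" "Q' \<noteq> W" using \<open>x \<in> Q\<close> \<open>y \<in> Q'\<close> x y by auto
  then obtain K L where KL: "ideal_pow R \<aa> K \<subseteq> Q'" "ideal_pow R \<aa> L \<subseteq> Q"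
    using max[of Q] max[of Q'] Q Q' \<open>W \<subseteq> Q\<close> \<open>W \<subseteq> Q'\<close> \<open>W0 \<subseteq> W\<close> by blast
  have "ideal_pow R \<aa> (K + L) \<subseteq> W"
  proof
    fix r assume "r \<in> ideal_pow R \<aa> (K + L)"
    then have "r \<in> ideal_pow R \<aa> K \<cdot> ideal_pow R \<aa> L" using ideal_pow_add[OF a] by simp
    then show "r \<in> W"
    proof (induction r rule: ideal_prod.induct)
      case (prod i j)
      then show ?case using KL by (auto simp: Q'_def)
    qed auto
  qed
  then show False using nW by blast
qed

end

text \<open>The submodule P + yM. Passing from P to it replaces M/P by its quotient by y.\<close>

definition add_mult :: "('a, 'b, 'm) module_scheme \<Rightarrow> 'b set \<Rightarrow> 'a \<Rightarrow> 'b set" where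
  "add_mult M P y = {p \<oplus>\<^bsub>M\<^esub> y \<odot>\<^bsub>M\<^esub> m | p m. p \<in> P \<and> m \<in> carrier M}"

context Module.module
begin

lemma ideal_sub_submodule:
  assumes "I \<subseteq> carrier R" "Z \<subseteq> carrier M" shows "submodule (ideal_sub R I M Z) R M"
  unfolding ideal_sub_def by (rule gen_submodule) (use assms in auto)

lemma ideal_sub_mem: "r \<in> I \<Longrightarrow> z \<in> Z \<Longrightarrow> r \<odot>\<^bsub>M\<^esub> z \<in> ideal_sub R I M Z"
  unfolding ideal_sub_def 
  using gen_submodule_superset[of "{r \<odot>\<^bsub>M\<^esub> z | r z. r \<in> I \<and> z \<in> Z}"] by blast

lemma ideal_sub_minimal:
  assumes "submodule H R M" "\<And>r z. r \<in> I \<Longrightarrow> z \<in> Z \<Longrightarrow> r \<odot>\<^bsub>M\<^esub> z \<in> H"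
  shows "ideal_sub R I M Z \<subseteq> H"
  unfolding ideal_sub_def by (rule gen_submodule_minimal) (use assms in auto)

lemma add_mult_submodule:
  assumes P: "submodule P R M" and y: "y \<in> carrier R" shows "submodule (add_mult M P y) R M"
proof (rule submoduleI')
  note P' = submodule_carrier[OF P]
  show "add_mult M P y \<subseteq> carrier M" using P' y by (auto simp: add_mult_def)
  show "\<zero>\<^bsub>M\<^esub> \<in> add_mult M P y" using submodule_zero[OF P] y unfolding add_mult_def
    by (intro CollectI exI[of _ "\<zero>\<^bsub>M\<^esub>"]) auto
  fix a b assume "a \<in> add_mult M P y" "b \<in> add_mult M P y"
  then obtain p m p' m' where *: "p \<in> P" "p' \<in> P" "m \<in> carrier M" "m' \<in> carrier M" 
    "a = p \<oplus>\<^bsub>M\<^esub> y \<odot>\<^bsub>M\<^esub> m" "b = p' \<oplus>\<^bsub>M\<^esub> y \<odot>\<^bsub>M\<^esub> m'" unfolding add_mult_def by blast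
  then have "a \<oplus>\<^bsub>M\<^esub> b = (p \<oplus>\<^bsub>M\<^esub> p') \<oplus>\<^bsub>M\<^esub> y \<odot>\<^bsub>M\<^esub> (m \<oplus>\<^bsub>M\<^esub> m')"
    using y P' by (simp add: smult_r_distr M.a_ac)
  then show "a \<oplus>\<^bsub>M\<^esub> b \<in> add_mult M P y"
    unfolding add_mult_def using * submoduleE(5)[OF P] by blast
next
  fix r a assume r: "r \<in> carrier R" and "a \<in> add_mult M P y"
  then obtain p m where *: "p \<in> P" "m \<in> carrier M" "a = p \<oplus>\<^bsub>M\<^esub> y \<odot>\<^bsub>M\<^esub> m" 
    unfolding add_mult_def by blast
  then have "r \<odot>\<^bsub>M\<^esub> a = r \<odot>\<^bsub>M\<^esub> p \<oplus>\<^bsub>M\<^esub> y \<odot>\<^bsub>M\<^esub> (r \<odot>\<^bsub>M\<^esub> m)"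
    using y r submodule_carrier[OF P] by (simp add: smult_r_distr smult_commute)
  then show "r \<odot>\<^bsub>M\<^esub> a \<in> add_mult M P y"
    unfolding add_mult_def using * r submoduleE(4)[OF P] by blast
qed

lemma add_mult_superset: 
  assumes P: "submodule P R M" and y: "y \<in> carrier R" shows "P \<subseteq> add_mult M P y"
proof
  fix p assume p: "p \<in> P"
  then have "p = p \<oplus>\<^bsub>M\<^esub> y \<odot>\<^bsub>M\<^esub> \<zero>\<^bsub>M\<^esub>" using y submodule_carrier[OF P] by simp
  then show "p \<in> add_mult M P y" using p unfolding add_mult_def by blast
qed

lemma add_mult_mem: 
  assumes P: "submodule P R M" and y: "y \<in> carrier R" and m: "m \<in> carrier M" 
  shows "y \<odot>\<^bsub>M\<^esub> m \<in> add_mult M P y"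
proof -
  have "y \<odot>\<^bsub>M\<^esub> m = \<zero>\<^bsub>M\<^esub> \<oplus>\<^bsub>M\<^esub> y \<odot>\<^bsub>M\<^esub> m" using y m by simp
  then show ?thesis using submodule_zero[OF P] m unfolding add_mult_def by blast
qed

lemma add_mult_minimal:
  assumes "submodule H R M" "P \<subseteq> H" "\<And>m. m \<in> carrier M \<Longrightarrow> y \<odot>\<^bsub>M\<^esub> m \<in> H"
  shows "add_mult M P y \<subseteq> H"
  using assms submoduleE(5)[OF assms(1)] by (auto simp: add_mult_def)

lemma eqmod_add_multE:
  assumes P: "submodule P R M" and y: "y \<in> carrier R" and "eqmod M (add_mult M P y) x w"
  shows "\<exists>m\<in>carrier M. eqmod M P x (w \<oplus>\<^bsub>M\<^esub> y \<odot>\<^bsub>M\<^esub> m)"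
proof -
  obtain q where q: "q \<in> add_mult M P y" "x = q \<oplus>\<^bsub>M\<^esub> w" "w \<in> carrier M"
    using assms(3) eqmod_alt[OF add_mult_submodule[OF P y]] by blast
  then obtain p m where pm: "p \<in> P" "m \<in> carrier M" "q = p \<oplus>\<^bsub>M\<^esub> y \<odot>\<^bsub>M\<^esub> m"
    by (auto simp: add_mult_def)
  then have "x = p \<oplus>\<^bsub>M\<^esub> (w \<oplus>\<^bsub>M\<^esub> y \<odot>\<^bsub>M\<^esub> m)"
    using q y submodule_carrier[OF P] by (simp add: M.a_ac)
  then have "eqmod M P x (w \<oplus>\<^bsub>M\<^esub> y \<odot>\<^bsub>M\<^esub> m)"
    unfolding eqmod_alt[OF P] using pm q y by blast
  then show ?thesis using pm by blast
qed

lemma eqmod_add_multI: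
  assumes P: "submodule P R M" and y: "y \<in> carrier R" and "eqmod M P x (w \<oplus>\<^bsub>M\<^esub> y \<odot>\<^bsub>M\<^esub> m)"
    and "w \<in> carrier M" "m \<in> carrier M"
  shows "eqmod M (add_mult M P y) x w"
proof -
  note am = add_mult_submodule[OF P y]
  have "eqmod M (add_mult M P y) x (w \<oplus>\<^bsub>M\<^esub> y \<odot>\<^bsub>M\<^esub> m)"
    by (rule eqmod_mono[OF add_mult_superset[OF P y] assms(3)])
  moreover have "eqmod M (add_mult M P y) (w \<oplus>\<^bsub>M\<^esub> y \<odot>\<^bsub>M\<^esub> m) (w \<oplus>\<^bsub>M\<^esub> \<zero>\<^bsub>M\<^esub>)"
    by (rule eqmod_add[OF am eqmod_refl[OF am]])
       (use assms add_mult_mem[OF P y] eqmod_zero_iff[OF am] in auto)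
  ultimately show ?thesis using eqmod_trans[OF am] assms by simp
qed

text \<open>Krull's trick: a submodule \<open>W\<close> maximal with \<open>W \<inter> Z = JZ\<close> absorbs a power of each element
  of \<open>\<aa>\<close>.\<close>

lemma artin_rees:
  assumes N: "noetherian_ring R" and NM: "noetherian_module R M" and a: "ideal \<aa> R" and J: "ideal J R"
    and pw: "\<And>w. w \<in> \<aa> \<Longrightarrow> \<exists>k::nat. w [^] k \<in> J" and Z: "submodule Z R M"
  shows "\<exists>c. ideal_sub R (ideal_pow R \<aa> c) M (carrier M) \<inter> Z \<subseteq> ideal_sub R J M Z"
proof -
  have a_car: "\<aa> \<subseteq> carrier R" using a by (simp add: additive_subgroup.a_subset ideal.axioms(1))
  have Jc: "J \<subseteq> carrier R" using J by (simp add: additive_subgroup.a_subset ideal.axioms(1))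
  have Zc: "Z \<subseteq> carrier M" using submoduleE(1)[OF Z] .
  let ?JZ = "ideal_sub R J M Z"
  have JZ: "submodule ?JZ R M" by (rule ideal_sub_submodule[OF Jc Zc])
  let ?C = "{W. submodule W R M \<and> ?JZ \<subseteq> W \<and> W \<inter> Z \<subseteq> ?JZ}"
  have "?C \<noteq> {}" using JZ by blast
  then have "\<exists>W\<in>?C. \<forall>K\<in>?C. W \<subseteq> K \<longrightarrow> K = W"
    by (rule noetherian_module_maximal[OF NM]) blast
  then obtain W where W: "W \<in> ?C" and max': "\<forall>K\<in>?C. W \<subseteq> K \<longrightarrow> K = W" by (rule bexE)
  note max = max'[rule_format]
  have Ws: "submodule W R M" using W by blast
  have "\<exists>k::nat. w [^] k \<in> {r \<in> carrier R. \<forall>m\<in>carrier M. r \<odot>\<^bsub>M\<^esub> m \<in> W}" if w: "w \<in> \<aa>" for w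
  proof -
    have wc: "w \<in> carrier R" using w a_car by blast
    obtain k :: nat where k: "w [^] k \<in> J" using pw w by blast
    define b where "b = w [^] k"
    have b: "b \<in> carrier R" "b \<in> J" using k wc by (auto simp: b_def)
    \<comment> \<open>The ascending chain (W : b^n) of submodules of M becomes stationary at some n,
      from which on b^(n+1) m \<in> W already gives b^n m \<in> W.\<close>
    define U where "U n = {m \<in> carrier M. b [^] n \<odot>\<^bsub>M\<^esub> m \<in> W}" for n :: nat
    have "submodule (U n) R M" for n
      unfolding U_def
      by (rule vimage_submodule[OF module_axioms module_axioms lin_map_smult Ws]) (use b in simp)
    then have "\<exists>H\<in>range U. \<forall>K\<in>range U. H \<subseteq> K \<longrightarrow> K = H"
      by (intro noetherian_module_maximal[OF NM]) auto
    then obtain n where Hmax: "\<forall>K\<in>range U. U n \<subseteq> K \<longrightarrow> K = U n" by (auto simp only: image_iff)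
    have "U n \<subseteq> U (Suc n)"
      using b submoduleE(4)[OF Ws] by (auto simp: U_def smult_assoc1 smult_commute[of _ b])
    then have Un: "U (Suc n) = U n" using Hmax[rule_format, of "U (Suc n)"] by blast
    have bn: "b [^] n \<in> carrier R" using b by simp
    let ?W = "add_mult M W (b [^] n)"
    \<comment> \<open>W + b^n M is still admissible: if x = v + b^n m lies in Z, then bx \<in> JZ
      \<subseteq> W because b \<in> J, hence b^(n+1) m \<in> W, so b^n m \<in> W and x \<in> W
      \<inter> Z. Maximality of W then gives b^n M \<subseteq> W.\<close>
    have "?W \<inter> Z \<subseteq> ?JZ"
    proof
      fix x assume x: "x \<in> ?W \<inter> Z"
      then obtain v m where vm: "v \<in> W" "m \<in> carrier M" "x = v \<oplus>\<^bsub>M\<^esub> b [^] n \<odot>\<^bsub>M\<^esub> m"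
        by (auto simp: add_mult_def)
      have vc: "v \<in> carrier M" using vm(1) submodule_carrier[OF Ws] by blast
      have "b \<odot>\<^bsub>M\<^esub> x \<in> W" using ideal_sub_mem[of b J x Z] b x W by blast
      moreover have "b \<odot>\<^bsub>M\<^esub> x \<ominus>\<^bsub>M\<^esub> b \<odot>\<^bsub>M\<^esub> v = b [^] Suc n \<odot>\<^bsub>M\<^esub> m"
      proof -
        have "b \<odot>\<^bsub>M\<^esub> x = b \<odot>\<^bsub>M\<^esub> v \<oplus>\<^bsub>M\<^esub> b [^] Suc n \<odot>\<^bsub>M\<^esub> m"
          using vm vc b bn by (simp add: smult_r_distr smult_assoc1 smult_commute[of b "b [^] n"])
        then show ?thesis
          using vm vc b bn by (simp add: a_minus_def M.a_ac M.r_neg1 M.r_neg2)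
      qed
      moreover have "b \<odot>\<^bsub>M\<^esub> v \<in> W" using submoduleE(4)[OF Ws b(1) vm(1)] .
      ultimately have "b [^] Suc n \<odot>\<^bsub>M\<^esub> m \<in> W" using submodule_diff[OF Ws] by metis
      then have "m \<in> U (Suc n)" using vm by (simp add: U_def)
      then have "m \<in> U n" using Un by simp
      then have "b [^] n \<odot>\<^bsub>M\<^esub> m \<in> W" by (simp add: U_def)
      then have "x \<in> W" using vm submoduleE(5)[OF Ws] by blast
      then show "x \<in> ?JZ" using W x by blast
    qed
    then have "?W = W"
      using max[of ?W] add_mult_submodule[OF Ws bn] add_mult_superset[OF Ws bn] W by blast
    then have "b [^] n \<odot>\<^bsub>M\<^esub> m \<in> W" if "m \<in> carrier M" for m 
      using add_mult_mem[OF Ws bn that] by simp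
    then have "w [^] (k * n) \<in> {r \<in> carrier R. \<forall>m\<in>carrier M. r \<odot>\<^bsub>M\<^esub> m \<in> W}"
      using bn by (simp add: b_def R.nat_pow_pow[OF wc])
    then show ?thesis by blast
  qed
  \<comment> \<open>Each w \<in> \<aa> has its own power that kills M/W; this turns them into a
    single power of \<aa>.\<close>
  from R.ideal_pow_subset_ideal[OF N a annihilating_ideal[OF Ws order_refl] this]
  obtain c where c: "ideal_pow R \<aa> c \<subseteq> {r \<in> carrier R. \<forall>m\<in>carrier M. r \<odot>\<^bsub>M\<^esub> m \<in> W}" by blast
  have "ideal_sub R (ideal_pow R \<aa> c) M (carrier M) \<subseteq> W"
    by (rule ideal_sub_minimal[OF Ws]) (use c in blast)
  then show ?thesis using W by blast
qed

end

section \<open>Regular sequences relative to a submodule\<close>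

definition nonzd :: "('a, 'b, 'm) module_scheme \<Rightarrow> 'b set \<Rightarrow> 'a \<Rightarrow> bool" where
  "nonzd M P y \<longleftrightarrow> (\<forall>m\<in>carrier M. y \<odot>\<^bsub>M\<^esub> m \<in> P \<longrightarrow> m \<in> P)"

primrec add_mults :: "('a, 'b, 'm) module_scheme \<Rightarrow> 'b set \<Rightarrow> 'a list \<Rightarrow> 'b set" where
  "add_mults M P [] = P"
| "add_mults M P (x # xs) = add_mults M (add_mult M P x) xs"

text \<open>Weak regularity: the condition that the quotient by the whole sequence be nonzero is
  carried separately, as \<open>add_mults M P xs \<noteq> carrier M\<close> or through M \<noteq>
  \<aa>M.\<close>

primrec reg_seq :: "('a, 'b, 'm) module_scheme \<Rightarrow> 'b set \<Rightarrow> 'a list \<Rightarrow> bool" where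
  "reg_seq M P [] \<longleftrightarrow> True"
| "reg_seq M P (x # xs) \<longleftrightarrow> nonzd M P x \<and> reg_seq M (add_mult M P x) xs"

lemma add_mults_append: "add_mults M P (xs @ ys) = add_mults M (add_mults M P xs) ys"
  by (induction xs arbitrary: P) auto

lemma reg_seq_append: "reg_seq M P (xs @ ys) \<longleftrightarrow> reg_seq M P xs \<and> reg_seq M (add_mults M P xs) ys"
  by (induction xs arbitrary: P) auto

context Module.module
begin

lemma add_mults_submodule:
  "submodule P R M \<Longrightarrow> set xs \<subseteq> carrier R \<Longrightarrow> submodule (add_mults M P xs) R M"
  by (induction xs arbitrary: P) (auto simp: add_mult_submodule)

lemma add_mults_superset:
  "submodule P R M \<Longrightarrow> set xs \<subseteq> carrier R \<Longrightarrow> P \<subseteq> add_mults M P xs"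
proof (induction xs arbitrary: P)
  case (Cons x xs)
  then have "P \<subseteq> add_mult M P x" "add_mult M P x \<subseteq> add_mults M (add_mult M P x) xs"
    using add_mult_superset[of P x] Cons.IH[of "add_mult M P x"] add_mult_submodule[of P x] by auto
  then show ?case by simp
qed simp

lemma add_mults_mem:
  "submodule P R M \<Longrightarrow> set xs \<subseteq> carrier R \<Longrightarrow> x \<in> set xs \<Longrightarrow> m \<in> carrier M \<Longrightarrow> 
     x \<odot>\<^bsub>M\<^esub> m \<in> add_mults M P xs"
proof (induction xs arbitrary: P)
  case (Cons y xs)
  have s: "submodule (add_mult M P y) R M" using Cons.prems by (simp add: add_mult_submodule)
  show ?case
  proof (cases "x = y")
    case True
    then show ?thesis
      using add_mult_mem[of P y m] add_mults_superset[OF s, of xs] Cons.prems by auto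
  next
    case False
    then show ?thesis using Cons.IH[OF s] Cons.prems by auto
  qed
qed simp

lemma add_mults_minimal:
  assumes "submodule H R M"
  shows "P \<subseteq> H \<Longrightarrow> (\<And>x m. x \<in> set xs \<Longrightarrow> m \<in> carrier M \<Longrightarrow> x \<odot>\<^bsub>M\<^esub> m \<in> H) \<Longrightarrow> add_mults M P xs \<subseteq> H"
proof (induction xs arbitrary: P)
  case (Cons y xs)
  have "add_mult M P y \<subseteq> H" by (rule add_mult_minimal) (use Cons.prems assms in auto)
  then show ?case using Cons by simp
qed simp

lemma ideal_smult_add_mults:
  assumes xs: "set xs \<subseteq> carrier R"
  shows "ideal_smult R (Idl (set xs)) M = add_mults M {\<zero>\<^bsub>M\<^esub>} xs"
proof
  note am = add_mults_submodule[OF zero_submodule xs]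
  have Ic: "Idl (set xs) \<subseteq> carrier R"
    by (meson xs R.genideal_ideal additive_subgroup.a_subset ideal.axioms(1))
  have "set xs \<subseteq> {r \<in> carrier R. \<forall>x\<in>carrier M. r \<odot>\<^bsub>M\<^esub> x \<in> add_mults M {\<zero>\<^bsub>M\<^esub>} xs}"
    using add_mults_mem[OF zero_submodule xs] xs by auto
  then have *: "Idl (set xs) \<subseteq> {r \<in> carrier R. \<forall>x\<in>carrier M. r \<odot>\<^bsub>M\<^esub> x \<in> add_mults M {\<zero>\<^bsub>M\<^esub>} xs}"
    by (rule R.genideal_minimal[OF annihilating_ideal[OF am order_refl]])
  show "ideal_smult R (Idl (set xs)) M \<subseteq> add_mults M {\<zero>\<^bsub>M\<^esub>} xs"
    unfolding ideal_smult_eq by (rule ideal_sub_minimal[OF am]) (use * in blast)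
  note isub = ideal_sub_submodule[OF Ic order_refl]
  show "add_mults M {\<zero>\<^bsub>M\<^esub>} xs \<subseteq> ideal_smult R (Idl (set xs)) M"
    unfolding ideal_smult_eq
    by (rule add_mults_minimal[OF isub]) 
       (use submodule_zero[OF isub] R.genideal_self[OF xs] in \<open>auto intro!: ideal_sub_mem\<close>)
qed

section \<open>Nakayama's lemma and permuting regular sequences\<close>

lemma add_mult_commute:
  assumes "submodule P R M" "y \<in> carrier R" "z \<in> carrier R"
  shows "add_mult M (add_mult M P y) z = add_mult M (add_mult M P z) y"
proof -
  have "add_mult M (add_mult M P y) z \<subseteq> add_mult M (add_mult M P z) y" 
    if yz: "y \<in> carrier R" "z \<in> carrier R" for y z
  proof -
    note sz = add_mult_submodule[OF assms(1) yz(2)]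
    show ?thesis
      using add_mult_superset[OF sz yz(1)] add_mult_superset[OF assms(1) yz(2)] 
        add_mult_mem[OF sz yz(1)] add_mult_mem[OF assms(1) yz(2)]
      by (intro add_mult_minimal add_mult_submodule sz yz) auto
  qed
  then show ?thesis using assms by blast
qed

text \<open>If \<open>K \<noteq> P\<close>, take a maximal submodule \<open>W\<close> between \<open>P\<close> and \<open>K\<close>: since \<open>K / W\<close> is simple, its
  annihilator is a maximal ideal, so \<open>y\<close> kills it.\<close>

lemma nakayama:
  assumes NM: "noetherian_module R M" and y: "y \<in> jacobson_radical R"
    and P: "submodule P R M" and K: "submodule K R M" and "P \<subseteq> K"
    and KyK: "\<And>k. k \<in> K \<Longrightarrow> \<exists>p\<in>P. \<exists>k'\<in>K. k = p \<oplus>\<^bsub>M\<^esub> y \<odot>\<^bsub>M\<^esub> k'"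
  shows "K = P"
proof (rule ccontr)
  assume "K \<noteq> P"
  let ?C = "{W. submodule W R M \<and> P \<subseteq> W \<and> W \<subset> K}"
  have yc: "y \<in> carrier R" using y by (auto simp: jacobson_radical_def)
  have "?C \<noteq> {}" using P \<open>P \<subseteq> K\<close> \<open>K \<noteq> P\<close> by blast
  then have "\<exists>W\<in>?C. \<forall>K\<in>?C. W \<subseteq> K \<longrightarrow> K = W"
    by (rule noetherian_module_maximal[OF NM]) blast
  then obtain W where W: "W \<in> ?C" and max: "\<forall>K\<in>?C. W \<subseteq> K \<longrightarrow> K = W" by (rule bexE)
  have Ws: "submodule W R M" and WK: "W \<subseteq> K" and PW: "P \<subseteq> W" using W by auto
  obtain k where k: "k \<in> K" "k \<notin> W" using W by blast
  have kc: "k \<in> carrier M" using k submodule_carrier[OF K] by blast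
  define I where "I = {r \<in> carrier R. \<forall>x\<in>{k}. r \<odot>\<^bsub>M\<^esub> x \<in> W}"
  have I: "ideal I R" unfolding I_def by (rule annihilating_ideal[OF Ws]) (use kc in simp)
  have "maximalideal I R"
  proof (rule maximalidealI[OF I])
    show "carrier R \<noteq> I" using k kc by (auto simp: I_def set_eq_iff intro!: exI[of _ \<one>])
    fix J assume J: "ideal J R" "I \<subseteq> J" "J \<subseteq> carrier R"
    interpret J: ideal J R by fact
    show "J = I \<or> J = carrier R"
    proof (rule disjCI)
      assume "J \<noteq> carrier R"
      show "J = I"
      proof (rule ccontr)
        assume "J \<noteq> I"
        then obtain r where r: "r \<in> J" "r \<notin> I" using J by blast
        have rc: "r \<in> carrier R" using r J by blast
        have rk: "r \<odot>\<^bsub>M\<^esub> k \<notin> W" "r \<odot>\<^bsub>M\<^esub> k \<in> K" 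
          using r rc k submoduleE(4)[OF K] by (auto simp: I_def)
        \<comment> \<open>V = W + R(rk) lies strictly above W, hence equals K. So k = w + s(rk), the
          element 1 - sr lies in I \<subseteq> J, and J contains 1.\<close>
        define V where "V = {w \<oplus>\<^bsub>M\<^esub> s | w s. w \<in> W \<and> s \<in> (\<lambda>s. s \<odot>\<^bsub>M\<^esub> (r \<odot>\<^bsub>M\<^esub> k)) ` carrier R}"
        have Vs: "submodule V R M"
        proof (rule submoduleI')
          show "V \<subseteq> carrier M" using submodule_carrier[OF Ws] rc kc by (auto simp: V_def)
          show "\<zero>\<^bsub>M\<^esub> \<in> V" unfolding V_def using submodule_zero[OF Ws] rc kc
            by (intro CollectI exI[of _ "\<zero>\<^bsub>M\<^esub>"]) (auto intro!: image_eqI[of _ _ \<zero>])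
          fix a b assume "a \<in> V" "b \<in> V"
          then obtain w w' s s' where *: "w \<in> W" "w' \<in> W" "s \<in> carrier R" "s' \<in> carrier R"
            "a = w \<oplus>\<^bsub>M\<^esub> s \<odot>\<^bsub>M\<^esub> (r \<odot>\<^bsub>M\<^esub> k)" "b = w' \<oplus>\<^bsub>M\<^esub> s' \<odot>\<^bsub>M\<^esub> (r \<odot>\<^bsub>M\<^esub> k)"
            unfolding V_def by blast
          then have "a \<oplus>\<^bsub>M\<^esub> b = (w \<oplus>\<^bsub>M\<^esub> w') \<oplus>\<^bsub>M\<^esub> (s \<oplus> s') \<odot>\<^bsub>M\<^esub> (r \<odot>\<^bsub>M\<^esub> k)"
            using submodule_carrier[OF Ws] rc kc by (simp add: smult_l_distr M.a_ac)
          then show "a \<oplus>\<^bsub>M\<^esub> b \<in> V" using * submoduleE(5)[OF Ws] unfolding V_def by blast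
        next
          fix q a assume q: "q \<in> carrier R" and "a \<in> V"
          then obtain w s where *: "w \<in> W" "s \<in> carrier R" "a = w \<oplus>\<^bsub>M\<^esub> s \<odot>\<^bsub>M\<^esub> (r \<odot>\<^bsub>M\<^esub> k)" 
            unfolding V_def by blast
          then have "q \<odot>\<^bsub>M\<^esub> a = q \<odot>\<^bsub>M\<^esub> w \<oplus>\<^bsub>M\<^esub> (q \<otimes> s) \<odot>\<^bsub>M\<^esub> (r \<odot>\<^bsub>M\<^esub> k)"
            using submodule_carrier[OF Ws] rc kc q by (simp add: smult_r_distr smult_assoc1)
          then show "q \<odot>\<^bsub>M\<^esub> a \<in> V" using * q submoduleE(4)[OF Ws] unfolding V_def by blast
        qed
        have "V \<subseteq> K" using WK submoduleE(4,5)[OF K] rk by (auto simp: V_def)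
        have "W \<subseteq> V"
        proof
          fix w assume w: "w \<in> W"
          then have "w = w \<oplus>\<^bsub>M\<^esub> \<zero> \<odot>\<^bsub>M\<^esub> (r \<odot>\<^bsub>M\<^esub> k)" using submodule_carrier[OF Ws] rc kc by simp
          then show "w \<in> V" unfolding V_def using w by blast
        qed
        have "r \<odot>\<^bsub>M\<^esub> k = \<zero>\<^bsub>M\<^esub> \<oplus>\<^bsub>M\<^esub> \<one> \<odot>\<^bsub>M\<^esub> (r \<odot>\<^bsub>M\<^esub> k)" using rc kc by simp
        then have "r \<odot>\<^bsub>M\<^esub> k \<in> V" unfolding V_def using submodule_zero[OF Ws] by blast
        then have "V \<noteq> W" using rk by auto
        then have "V = K"
          using max[rule_format, of V] Vs \<open>V \<subseteq> K\<close> \<open>W \<subseteq> V\<close> PW by blast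
        then obtain w s where ws: "w \<in> W" "s \<in> carrier R" "k = w \<oplus>\<^bsub>M\<^esub> s \<odot>\<^bsub>M\<^esub> (r \<odot>\<^bsub>M\<^esub> k)"
          using k by (auto simp: V_def)
        have "(\<one> \<ominus> s \<otimes> r) \<odot>\<^bsub>M\<^esub> k = k \<ominus>\<^bsub>M\<^esub> s \<odot>\<^bsub>M\<^esub> (r \<odot>\<^bsub>M\<^esub> k)"
          using ws(2) rc kc by (simp add: smult_l_diff smult_assoc1)
        also have "\<dots> = w"
          using ws submodule_carrier[OF Ws] rc kc
          by (metis M.add.inv_solve_right' M.minus_eq a_minus_def smult_closed)
        finally have "\<one> \<ominus> s \<otimes> r \<in> I" using ws rc by (simp add: I_def)
        then have "(\<one> \<ominus> s \<otimes> r) \<oplus> s \<otimes> r \<in> J" using J r ws J.I_l_closed J.a_closed by blast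
        then have "\<one> \<in> J" using rc ws by (simp add: a_minus_def R.a_assoc R.l_neg)
        then show False using J.one_imp_carrier \<open>J \<noteq> carrier R\<close> by simp
      qed
    qed
  qed
  then have "y \<in> I" using y by (auto simp: jacobson_radical_def)
  then have yk: "y \<odot>\<^bsub>M\<^esub> k \<in> W" by (simp add: I_def)
  show False
  proof -
    \<comment> \<open>So far y kills only the class of k. The part of K that y carries into W
      contains W and k, hence is K by maximality; then K \<subseteq> P + yK lies in W.\<close>
    define U where "U = {x \<in> K. y \<odot>\<^bsub>M\<^esub> x \<in> W}"
    have Us: "submodule U R M"
    proof -
      have "U = K \<inter> {x \<in> carrier M. y \<odot>\<^bsub>M\<^esub> x \<in> W}" using submodule_carrier[OF K] by (auto simp: U_def)
      then show ?thesis 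
        using submodule_Int[OF K vimage_submodule[OF module_axioms module_axioms lin_map_smult[OF yc] Ws]]
        by simp
    qed
    have "W \<subseteq> U" using WK submoduleE(4)[OF Ws yc] by (auto simp: U_def)
    have "k \<in> U" using k yk by (simp add: U_def)
    then have "U = K" using max[rule_format, of U] Us \<open>W \<subseteq> U\<close> k(2) PW by (auto simp: U_def)
    then have "K \<subseteq> W" 
      using KyK PW submoduleE(5)[OF Ws] unfolding U_def by blast
    then show False using W by blast
  qed
qed

text \<open>For the first claim let K = (P : z). Regularity of z modulo y puts m \<in> K into P +
  yM, say m = p + ym'; then y(zm') \<in> P, so m' \<in> K. Thus K = P + yK and Nakayama gives K = P.
  The second claim is a cancellation of y.\<close>

lemma nonzd_swap:
  assumes NM: "noetherian_module R M" and P: "submodule P R M" 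
    and y: "y \<in> jacobson_radical R" and z: "z \<in> carrier R" 
    and reg: "nonzd M P y" "nonzd M (add_mult M P y) z"
  shows "nonzd M P z" "nonzd M (add_mult M P z) y"
proof -
  have yc: "y \<in> carrier R" using y by (auto simp: jacobson_radical_def)
  note Py = add_mult_submodule[OF P yc] and Pz = add_mult_submodule[OF P z]
  let ?K = "{m \<in> carrier M. z \<odot>\<^bsub>M\<^esub> m \<in> P}"
  have Ks: "submodule ?K R M"
    by (rule vimage_submodule[OF module_axioms module_axioms lin_map_smult[OF z] P])
  have "?K = P"
  proof (rule nakayama[OF NM y P Ks])
    show "P \<subseteq> ?K" using submoduleE(1,4)[OF P] z by auto
    fix m assume m: "m \<in> ?K"
    then have "m \<in> add_mult M P y" 
      using reg(2) add_mult_superset[OF P yc] by (auto simp: nonzd_def)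
    then obtain p m' where pm: "p \<in> P" "m' \<in> carrier M" "m = p \<oplus>\<^bsub>M\<^esub> y \<odot>\<^bsub>M\<^esub> m'"
      by (auto simp: add_mult_def)
    then have "z \<odot>\<^bsub>M\<^esub> m = z \<odot>\<^bsub>M\<^esub> p \<oplus>\<^bsub>M\<^esub> y \<odot>\<^bsub>M\<^esub> (z \<odot>\<^bsub>M\<^esub> m')"
      using z yc submodule_carrier[OF P] by (simp add: smult_r_distr smult_commute)
    then have "eqmod M P (z \<odot>\<^bsub>M\<^esub> m) (y \<odot>\<^bsub>M\<^esub> (z \<odot>\<^bsub>M\<^esub> m'))"
      using eqmod_alt[OF P] submoduleE(4)[OF P z pm(1)] pm z yc by auto
    then have "y \<odot>\<^bsub>M\<^esub> (z \<odot>\<^bsub>M\<^esub> m') \<in> P" using eqmod_mem[OF P] m by blast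
    then have "z \<odot>\<^bsub>M\<^esub> m' \<in> P" using reg(1) z pm by (auto simp: nonzd_def)
    then show "\<exists>p\<in>P. \<exists>k'\<in>?K. m = p \<oplus>\<^bsub>M\<^esub> y \<odot>\<^bsub>M\<^esub> k'" using pm by blast
  qed
  then show "nonzd M P z" by (auto simp: nonzd_def)
  show "nonzd M (add_mult M P z) y"
    unfolding nonzd_def
  proof (intro ballI impI)
    fix m assume m: "m \<in> carrier M" "y \<odot>\<^bsub>M\<^esub> m \<in> add_mult M P z"
    then obtain p n where pn: "p \<in> P" "n \<in> carrier M" "y \<odot>\<^bsub>M\<^esub> m = p \<oplus>\<^bsub>M\<^esub> z \<odot>\<^bsub>M\<^esub> n"
      by (auto simp: add_mult_def)
    have "eqmod M P (y \<odot>\<^bsub>M\<^esub> m) (z \<odot>\<^bsub>M\<^esub> n)"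
      unfolding eqmod_alt[OF P] using pn z by blast
    then have e: "eqmod M (add_mult M P y) (y \<odot>\<^bsub>M\<^esub> m) (z \<odot>\<^bsub>M\<^esub> n)" "eqmod M P (z \<odot>\<^bsub>M\<^esub> n) (y \<odot>\<^bsub>M\<^esub> m)"
      using eqmod_mono[OF add_mult_superset[OF P yc]] eqmod_sym[OF P] by blast+
    then have "z \<odot>\<^bsub>M\<^esub> n \<in> add_mult M P y"
      using eqmod_mem[OF Py] add_mult_mem[OF P yc m(1)] by blast
    then have "n \<in> add_mult M P y" using reg(2) pn by (auto simp: nonzd_def)
    \<comment> \<open>Modulo P, ym = zn and n = yq, so y(m - zq) = 0, and cancelling y leaves m =
      zq.\<close>
    then obtain p' q where q: "p' \<in> P" "q \<in> carrier M" "n = p' \<oplus>\<^bsub>M\<^esub> y \<odot>\<^bsub>M\<^esub> q"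
      by (auto simp: add_mult_def)
    have "eqmod M P n (y \<odot>\<^bsub>M\<^esub> q)"
      unfolding eqmod_alt[OF P] using q yc by blast
    then have "eqmod M P (z \<odot>\<^bsub>M\<^esub> n) (y \<odot>\<^bsub>M\<^esub> (z \<odot>\<^bsub>M\<^esub> q))"
      using eqmod_smult[OF P z] smult_commute[OF z yc q(2)] by metis
    then have "eqmod M P (y \<odot>\<^bsub>M\<^esub> m) (y \<odot>\<^bsub>M\<^esub> (z \<odot>\<^bsub>M\<^esub> q))"
      using eqmod_trans[OF P] eqmod_sym[OF P e(2)] by blast
    then have "y \<odot>\<^bsub>M\<^esub> (m \<ominus>\<^bsub>M\<^esub> z \<odot>\<^bsub>M\<^esub> q) \<in> P"
      using smult_r_diff m q yc z by (simp add: eqmod_def)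
    then have "m \<ominus>\<^bsub>M\<^esub> z \<odot>\<^bsub>M\<^esub> q \<in> P"
      using reg(1) m q z unfolding nonzd_def by (meson M.minus_closed smult_closed)
    then have "eqmod M P m (z \<odot>\<^bsub>M\<^esub> q)" using m q z by (simp add: eqmod_def)
    then show "m \<in> add_mult M P z"
      using eqmod_mono[OF add_mult_superset[OF P z]] eqmod_mem[OF Pz] add_mult_mem[OF P z q(2)] by blast
  qed
qed

text \<open>Adjacent exchanges by \<open>nonzd_swap\<close>; after each one the two orders have the
  same submodule P + zM + wM by \<open>add_mult_commute\<close>.\<close>

lemma reg_seq_rotate:
  assumes NM: "noetherian_module R M"
  shows "submodule P R M \<Longrightarrow> set (z # zs) \<subseteq> jacobson_radical R \<Longrightarrow> reg_seq M P (z # zs) 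
    \<Longrightarrow> reg_seq M P (zs @ [z])"
proof (induction zs arbitrary: P)
  case (Cons w ws)
  have c: "z \<in> carrier R" "w \<in> carrier R" using Cons.prems by (auto simp: jacobson_radical_def)
  have sw: "nonzd M P w" "nonzd M (add_mult M P w) z"
    using nonzd_swap[OF NM Cons.prems(1), of z w] Cons.prems c by auto
  then have "reg_seq M (add_mult M P w) (z # ws)"
    using Cons.prems c by (simp add: add_mult_commute)
  then have "reg_seq M (add_mult M P w) (ws @ [z])"
    using Cons.IH[OF add_mult_submodule[OF Cons.prems(1) c(2)]] Cons.prems by auto
  then show ?case using sw by simp
qed simp

section \<open>Associated primes and coset avoidance\<close>

text \<open>Choose from each \<open>I t\<close> an element outside p; their product lies in every
  \<open>I t\<close> and, p being prime, outside p. Here p is a set with the prime property, so that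
  \<open>max_colon_prime\<close> and \<open>max_colon_one\<close> plug in directly.\<close>

lemma prime_contains_factor:
  assumes "finite T" "\<And>t. t \<in> T \<Longrightarrow> ideal (I t) R" "\<And>t. t \<in> T \<Longrightarrow> \<not> I t \<subseteq> p"
    and pr: "\<And>r s. r \<in> carrier R \<Longrightarrow> s \<in> carrier R \<Longrightarrow> r \<otimes> s \<in> p \<Longrightarrow> r \<in> p \<or> s \<in> p" and one: "\<one> \<notin> p"
  shows "\<exists>r\<in>carrier R. r \<notin> p \<and> (\<forall>t\<in>T. r \<in> I t)"
  using assms(1-3)
proof (induction T)
  case empty then show ?case using one by auto
next
  case (insert t T)
  then obtain r where r: "r \<in> carrier R" "r \<notin> p" "\<forall>t\<in>T. r \<in> I t" by auto
  obtain s where s: "s \<in> I t" "s \<notin> p" using insert.prems by blast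
  have sc: "s \<in> carrier R" using s insert.prems(1)[of t] ideal.Icarr by fastforce
  have "r \<otimes> s \<notin> p" using pr r s sc by blast
  moreover have "\<forall>u\<in>insert t T. r \<otimes> s \<in> I u"
  proof
    fix u assume u: "u \<in> insert t T"
    interpret u: ideal "I u" R using insert.prems(1) u by blast
    show "r \<otimes> s \<in> I u" using u r s sc u.I_l_closed u.I_r_closed by blast
  qed
  ultimately show ?case using r sc by blast
qed

definition colon :: "'c set \<Rightarrow> 'c \<Rightarrow> 'a set" where
  "colon P v = {r \<in> carrier R. r \<odot>\<^bsub>M\<^esub> v \<in> P}"

lemma colon_ideal: "submodule P R M \<Longrightarrow> v \<in> carrier M \<Longrightarrow> ideal (colon P v) R"
  using annihilating_ideal[of P "{v}"] by (simp add: colon_def)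

text \<open>The ideals \<open>colon P v\<close> for these v are the maximal ones among the
  annihilators of nonzero elements of M/P. They are prime, finitely many, and their union is the set
  of zero divisors on M/P, so they stand in for the associated primes in prime avoidance.\<close>

definition max_colon :: "'c set \<Rightarrow> 'c \<Rightarrow> bool" where
  "max_colon P v \<longleftrightarrow> v \<in> carrier M \<and> v \<notin> P \<and> 
     (\<forall>w\<in>carrier M. w \<notin> P \<longrightarrow> colon P v \<subseteq> colon P w \<longrightarrow> colon P w = colon P v)"

lemma max_colon_prime:
  assumes P: "submodule P R M" and v: "max_colon P v" and rs: "r \<in> carrier R" "s \<in> carrier R"
    "r \<otimes> s \<in> colon P v"
  shows "r \<in> colon P v \<or> s \<in> colon P v"
proof (rule disjCI)
  have vc: "v \<in> carrier M" using v by (simp add: max_colon_def)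
  assume "s \<notin> colon P v"
  then have sv: "s \<odot>\<^bsub>M\<^esub> v \<notin> P" "s \<odot>\<^bsub>M\<^esub> v \<in> carrier M" using rs vc by (auto simp: colon_def)
  have "colon P v \<subseteq> colon P (s \<odot>\<^bsub>M\<^esub> v)" 
    using vc rs submoduleE(4)[OF P] by (auto simp: colon_def smult_commute[of _ s])
  then have "colon P (s \<odot>\<^bsub>M\<^esub> v) = colon P v" using v sv by (simp add: max_colon_def)
  moreover have "r \<in> colon P (s \<odot>\<^bsub>M\<^esub> v)" using rs vc by (simp add: colon_def smult_assoc1)
  ultimately show "r \<in> colon P v" by simp
qed

lemma max_colon_one: "max_colon P v \<Longrightarrow> \<one> \<notin> colon P v"
  by (simp add: max_colon_def colon_def)

lemma zero_divisor_max_colon: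
  assumes N: "noetherian_ring R" and P: "submodule P R M" and w: "w \<in> carrier R" "\<not> nonzd M P w"
  shows "\<exists>v. max_colon P v \<and> w \<in> colon P v"
proof -
  obtain m where m: "m \<in> carrier M" "w \<odot>\<^bsub>M\<^esub> m \<in> P" "m \<notin> P" using w by (auto simp: nonzd_def)
  let ?V = "{v \<in> carrier M. v \<notin> P \<and> colon P m \<subseteq> colon P v}"
  have "\<exists>I\<in>colon P ` ?V. \<forall>J\<in>colon P ` ?V. I \<subseteq> J \<longrightarrow> J = I"
    by (rule noetherian_ring.maximal_ideal_in[OF N]) (use m colon_ideal[OF P] in auto)
  then obtain v where v: "v \<in> ?V" and "\<forall>J\<in>colon P ` ?V. colon P v \<subseteq> J \<longrightarrow> J = colon P v" by blast
  then have "max_colon P v" unfolding max_colon_def by blast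
  moreover have "w \<in> colon P v" using m w v by (auto simp: colon_def)
  ultimately show ?thesis by blast
qed

text \<open>For a finite set T of such v with the submodule generated by P and T maximal, that
  submodule contains every such v. If no \<open>colon P t\<close> were inside
  \<open>colon P v\<close>, some r outside \<open>colon P v\<close> would lie in all
  \<open>colon P t\<close>, carry T into P, and hence also v. The inclusion found is an equality
  because \<open>colon P t\<close> is maximal.\<close>

lemma finitely_many_max_colon:
  assumes NM: "noetherian_module R M" and P: "submodule P R M"
  shows "\<exists>T. finite T \<and> (\<forall>v\<in>T. max_colon P v) \<and> (\<forall>v. max_colon P v \<longrightarrow> (\<exists>t\<in>T. colon P t = colon P v))"
proof -
  let ?V = "{v. max_colon P v}"
  have Vc: "?V \<subseteq> carrier M" by (auto simp: max_colon_def)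
  have Pc: "P \<subseteq> carrier M" using submoduleE(1)[OF P] .
  let ?G = "\<lambda>T. gen_submodule R M (P \<union> T)"
  have G: "submodule (?G T) R M" if "T \<subseteq> ?V" for T 
    by (rule gen_submodule) (use Vc Pc that in blast)
  let ?C = "?G ` {T. finite T \<and> T \<subseteq> ?V}"
  have "\<exists>W\<in>?C. \<forall>K\<in>?C. W \<subseteq> K \<longrightarrow> K = W"
    by (rule noetherian_module_maximal[OF NM]) (use G in blast)+
  then obtain T where T: "finite T" "T \<subseteq> ?V" and max: "\<forall>K\<in>?C. ?G T \<subseteq> K \<longrightarrow> K = ?G T" by blast
  have "\<exists>t\<in>T. colon P t = colon P v" if v: "max_colon P v" for v
  proof -
    have "?G T \<subseteq> ?G (insert v T)"
      by (rule gen_submodule_minimal[OF G]) 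
         (use v T gen_submodule_superset[of "P \<union> insert v T"] in auto)
    then have "?G (insert v T) = ?G T" using max v T by blast
    then have vG: "v \<in> ?G T" using gen_submodule_superset[of "P \<union> insert v T"] by auto
    have "\<exists>t\<in>T. colon P t \<subseteq> colon P v"
    proof (rule ccontr)
      assume neg: "\<not> ?thesis"
      have "\<exists>r\<in>carrier R. r \<notin> colon P v \<and> (\<forall>t\<in>T. r \<in> colon P t)"
        by (rule prime_contains_factor[OF T(1)]) 
           (use T Vc colon_ideal[OF P] neg max_colon_prime[OF P v] max_colon_one[OF v] in blast)+
      then obtain r where r: "r \<in> carrier R" "r \<notin> colon P v" "\<forall>t\<in>T. r \<in> colon P t" by blast
      have "?G T \<subseteq> {x \<in> carrier M. r \<odot>\<^bsub>M\<^esub> x \<in> P}"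
      proof (rule gen_submodule_minimal)
        show "submodule {x \<in> carrier M. r \<odot>\<^bsub>M\<^esub> x \<in> P} R M"
          by (rule vimage_submodule[OF module_axioms module_axioms lin_map_smult[OF r(1)] P])
        show "P \<union> T \<subseteq> {x \<in> carrier M. r \<odot>\<^bsub>M\<^esub> x \<in> P}"
          using r Pc T Vc submoduleE(4)[OF P r(1)] by (auto simp: colon_def)
      qed
      then have "r \<in> colon P v" using vG r by (auto simp: colon_def)
      then show False using r by simp
    qed
    then show ?thesis using T v by (auto simp: max_colon_def)
  qed
  then show ?thesis using T by blast
qed

text \<open>Prime avoidance for the coset x + J: by \<open>h\<close> no nonzero element of M/P is
  killed by x and J together, so no maximal annihilator contains both. With x = 0 this yields a
  nonzerodivisor inside J as soon as J kills no nonzero element of M/P.\<close>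

lemma coset_avoidance:
  assumes N: "noetherian_ring R" and NM: "noetherian_module R M" and P: "submodule P R M"
    and J: "ideal J R" and x: "x \<in> carrier R"
    and h: "\<And>v. v \<in> carrier M \<Longrightarrow> x \<odot>\<^bsub>M\<^esub> v \<in> P \<Longrightarrow> (\<And>j. j \<in> J \<Longrightarrow> j \<odot>\<^bsub>M\<^esub> v \<in> P) \<Longrightarrow> v \<in> P"
  shows "\<exists>u\<in>J. nonzd M P (x \<oplus> u)"
proof -
  interpret J: ideal J R by fact
  obtain T where T: "finite T" "\<And>v. v \<in> T \<Longrightarrow> max_colon P v" 
    "\<And>v. max_colon P v \<Longrightarrow> \<exists>t\<in>T. colon P t = colon P v"
    using finitely_many_max_colon[OF NM P] by blast
  have "finite S \<Longrightarrow> S \<subseteq> colon P ` T \<Longrightarrow> \<exists>u\<in>J. \<forall>p\<in>S. x \<oplus> u \<notin> p" for S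
  proof (induction S rule: finite_induct)
    case empty
    then show ?case using J.zero_closed by blast
  next
    case (insert p S)
    then obtain u where u: "u \<in> J" "\<forall>p\<in>S. x \<oplus> u \<notin> p" by blast
    obtain v where v: "v \<in> T" "p = colon P v" using insert.prems by blast
    have mv: "max_colon P v" and vc: "v \<in> carrier M" and vP: "v \<notin> P" 
      using T(2)[OF v(1)] by (auto simp: max_colon_def)
    interpret p: ideal p R unfolding v(2) by (rule colon_ideal[OF P vc])
    have uc: "u \<in> carrier R" using u J.Icarr by blast
    show ?case
    proof (cases "x \<oplus> u \<in> p")
      case True
      \<comment> \<open>Otherwise x = (x + u) - u would lie in p as well, and the class of v would
        be killed by x and by J.\<close>
      have "\<not> J \<subseteq> p"
      proof
        assume "J \<subseteq> p"
        then have "j \<odot>\<^bsub>M\<^esub> v \<in> P" if "j \<in> J" for j using that v(2) unfolding colon_def by blast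
        moreover have "(x \<oplus> u) \<ominus> u \<in> p" using True \<open>J \<subseteq> p\<close> u unfolding a_minus_def by blast
        then have "x \<in> p" using x uc by (simp add: a_minus_def R.a_assoc R.r_neg)
        then have "x \<odot>\<^bsub>M\<^esub> v \<in> P" unfolding v(2) colon_def by blast
        ultimately show False using h[OF vc] vP by metis
      qed
      then obtain j where j: "j \<in> J" "j \<notin> p" by blast
      have jc: "j \<in> carrier R" using j J.Icarr by blast
      \<comment> \<open>Distinct maximal annihilators are incomparable, so some r outside p lies in
        all primes of S. Adding jr to u moves x + u out of p without changing it modulo those
        primes.\<close>
      have "\<exists>r\<in>carrier R. r \<notin> p \<and> (\<forall>q\<in>S. r \<in> q)"
      proof (rule prime_contains_factor[of S "\<lambda>q. q"])
        fix q assume q: "q \<in> S"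
        then obtain t where t: "t \<in> T" "q = colon P t" using insert.prems by blast
        have mt: "max_colon P t" using T(2)[OF t(1)] .
        show "ideal q R" unfolding t(2) using colon_ideal[OF P] mt by (simp add: max_colon_def)
        show "\<not> q \<subseteq> p" using mt vc vP insert.hyps(2) q unfolding t(2) v(2) max_colon_def by metis
      qed (use insert.hyps(1) max_colon_prime[OF P mv] max_colon_one[OF mv] in \<open>unfold v(2), auto\<close>)
      then obtain r where r: "r \<in> carrier R" "r \<notin> p" "\<forall>q\<in>S. r \<in> q" by blast
      have jr: "j \<otimes> r \<notin> p" "j \<otimes> r \<in> J" "j \<otimes> r \<in> carrier R" 
        using max_colon_prime[OF P mv jc r(1)] j(2) r(2) jc r(1) J.I_r_closed[OF j(1) r(1)] unfolding v(2) 
        by auto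
      have "x \<oplus> (u \<oplus> j \<otimes> r) \<notin> q" if q: "q \<in> insert p S" for q
      proof
        assume *: "x \<oplus> (u \<oplus> j \<otimes> r) \<in> q"
        obtain t where t: "t \<in> T" "q = colon P t" using insert.prems q by blast
        interpret q: ideal q R unfolding t(2) using colon_ideal[OF P] T(2)[OF t(1)] by (simp add: max_colon_def)
        have e: "x \<oplus> (u \<oplus> j \<otimes> r) = (x \<oplus> u) \<oplus> j \<otimes> r" using x uc jr by (simp add: R.a_assoc)
        show False
        proof (cases "q = p")
          case True
          then have "(x \<oplus> (u \<oplus> j \<otimes> r)) \<ominus> (x \<oplus> u) \<in> p" 
            using * \<open>x \<oplus> u \<in> p\<close> unfolding a_minus_def by blast
          then show False using jr x uc by (simp add: e a_minus_def R.a_ac R.r_neg1 R.r_neg2 R.minus_add)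
        next
          case False
          then have "q \<in> S" using q by simp
          then have "j \<otimes> r \<in> q" using r q.I_l_closed jc by blast
          then have "(x \<oplus> (u \<oplus> j \<otimes> r)) \<ominus> j \<otimes> r \<in> q" using * unfolding a_minus_def by blast
          moreover have "(x \<oplus> (u \<oplus> j \<otimes> r)) \<ominus> j \<otimes> r = x \<oplus> u" 
            using jr x uc by (simp add: a_minus_def R.a_assoc R.r_neg)
          ultimately show False using u \<open>q \<in> S\<close> by auto
        qed
      qed
      then show ?thesis using u jr J.a_closed by blast
    qed (use u in blast)
  qed
  from this[of "colon P ` T"] T(1) obtain u where u: "u \<in> J" "\<forall>p\<in>colon P ` T. x \<oplus> u \<notin> p" by blast
  have "nonzd M P (x \<oplus> u)"
  proof (rule ccontr)
    assume "\<not> ?thesis"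
    then obtain v where "max_colon P v" "x \<oplus> u \<in> colon P v"
      using zero_divisor_max_colon[OF N P, of "x \<oplus> u"] x u(1) J.Icarr by blast
    then show False using T(3)[of v] u(2) by blast
  qed
  then show ?thesis using u by blast
qed

end

section \<open>Cocycles and coboundaries modulo a submodule\<close>

definition cocycle ::
    "('a, 'r) ring_scheme \<Rightarrow> (nat \<Rightarrow> nat) \<Rightarrow> 'a diffs \<Rightarrow> ('a, 'b, 'm) module_scheme \<Rightarrow> 'b set \<Rightarrow> nat
      \<Rightarrow> ((nat \<Rightarrow> 'a) \<Rightarrow> 'b) \<Rightarrow> bool" where
  "cocycle R r d N P i f \<longleftrightarrow> lin_map R (free_module R (r i)) N f \<and>
     (\<forall>x\<in>carrier (free_module R (r (Suc i))). f (d i x) \<in> P)"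

definition coboundary ::
    "('a, 'r) ring_scheme \<Rightarrow> (nat \<Rightarrow> nat) \<Rightarrow> 'a diffs \<Rightarrow> ('a, 'b, 'm) module_scheme \<Rightarrow> 'b set \<Rightarrow> nat
      \<Rightarrow> ((nat \<Rightarrow> 'a) \<Rightarrow> 'b) \<Rightarrow> bool" where
  "coboundary R r d N P i f \<longleftrightarrow> (case i of
       0 \<Rightarrow> \<forall>x\<in>carrier (free_module R (r 0)). f x \<in> P
     | Suc j \<Rightarrow> \<exists>u. lin_map R (free_module R (r j)) N u \<and> 
         (\<forall>x\<in>carrier (free_module R (r (Suc j))). eqmod N P (f x) (u (d j x))))"

lemma coboundary_0: 
  "coboundary R r d N P 0 f \<longleftrightarrow> (\<forall>x\<in>carrier (free_module R (r 0)). f x \<in> P)"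
  by (simp add: coboundary_def)

lemma coboundary_Suc: 
  "coboundary R r d N P (Suc j) f \<longleftrightarrow> (\<exists>u. lin_map R (free_module R (r j)) N u \<and> 
     (\<forall>x\<in>carrier (free_module R (r (Suc j))). eqmod N P (f x) (u (d j x))))"
  by (simp add: coboundary_def)

text \<open>The bound e is exclusive, so that a regular sequence of length e corresponds to
  vanishing in degrees 0 to e - 1.\<close>

definition ext_vanish ::
    "('a, 'r) ring_scheme \<Rightarrow> (nat \<Rightarrow> nat) \<Rightarrow> 'a diffs \<Rightarrow> ('a, 'b, 'm) module_scheme \<Rightarrow> 'b set \<Rightarrow> nat
      \<Rightarrow> bool" where
  "ext_vanish R r d N P e \<longleftrightarrow> 
     (\<forall>i f. i < e \<longrightarrow> cocycle R r d N P i f \<longrightarrow> coboundary R r d N P i f)"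

definition chain_map ::
    "('a, 'r) ring_scheme \<Rightarrow> (nat \<Rightarrow> nat) \<Rightarrow> 'a diffs \<Rightarrow> (nat \<Rightarrow> nat) \<Rightarrow> 'a diffs \<Rightarrow> 'a diffs \<Rightarrow> bool" where
  "chain_map R r d r' d' \<phi> \<longleftrightarrow>
     (\<forall>i. lin_map R (free_module R (r i)) (free_module R (r' i)) (\<phi> i)) \<and>
     (\<forall>i. \<forall>x\<in>carrier (free_module R (r (Suc i))). d' i (\<phi> (Suc i) x) = \<phi> i (d i x))"

text \<open>A resolution of \<open>R / I\<close> by finite free modules; the augmentation is represented by a
  linear map \<open>\<rho> : R\<^bsup>r 0\<^esup> \<rightarrow> R\<close> that lifts it.\<close>

locale cyclic_resolution = cring R for R (structure) +
  fixes I :: "'a set" and r :: "nat \<Rightarrow> nat" and d :: "'a diffs" and \<rho> :: "(nat \<Rightarrow> 'a) \<Rightarrow> 'a"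
  assumes I: "ideal I R"
    and d: "\<And>i. lin_map R (free_module R (r (Suc i))) (free_module R (r i)) (d i)"
    and \<rho>: "lin_map R (free_module R (r 0)) (self_module R) \<rho>"
    and aug_exact: "\<And>x. x \<in> carrier (free_module R (r 0)) \<Longrightarrow> 
       \<rho> x \<in> I \<longleftrightarrow> (\<exists>y\<in>carrier (free_module R (r (Suc 0))). x = d 0 y)"
    and exact: "\<And>i x. x \<in> carrier (free_module R (r (Suc i))) \<Longrightarrow> 
       d i x = \<zero>\<^bsub>free_module R (r i)\<^esub> \<longleftrightarrow> (\<exists>y\<in>carrier (free_module R (r (Suc (Suc i)))). x = d (Suc i) y)"
    and aug_surj: "\<exists>t\<in>carrier (free_module R (r 0)). \<rho> t \<ominus> \<one> \<in> I"
begin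

abbreviation "F i \<equiv> free_module R (r i)"

lemma F: "Module.module R (F i)" by (rule free_module)

lemma self: "Module.module R (self_module R)" by (rule self_module) (rule is_cring)

lemma d_closed: "x \<in> carrier (F (Suc i)) \<Longrightarrow> d i x \<in> carrier (F i)"
  using lin_map_closed[OF d] .

lemma d_d: "x \<in> carrier (F (Suc (Suc i))) \<Longrightarrow> d i (d (Suc i) x) = \<zero>\<^bsub>F i\<^esub>"
  using exact[OF d_closed] by blast

lemma \<rho>_closed: "x \<in> carrier (F 0) \<Longrightarrow> \<rho> x \<in> carrier R"
  using lin_map_closed[OF \<rho>] by (simp add: self_module_def)

lemma \<rho>_d: "x \<in> carrier (F (Suc 0)) \<Longrightarrow> \<rho> (d 0 x) \<in> I"
  using aug_exact[OF d_closed] by blast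

end

section \<open>Changing the submodule and pulling back along chain maps\<close>

lemma coboundary_mono: 
  "coboundary R r d N P i f \<Longrightarrow> P \<subseteq> Q \<Longrightarrow> coboundary R r d N Q i f"
  by (cases i) (auto simp: coboundary_0 coboundary_Suc dest: eqmod_mono)

lemma coboundary_cong:
  assumes "Module.module R N" "submodule P R N" "coboundary R r d N P i f"
    "\<And>x. x \<in> carrier (free_module R (r i)) \<Longrightarrow> eqmod N P (g x) (f x)"
  shows "coboundary R r d N P i g"
proof (cases i)
  interpret N: Module.module R N by fact
  case 0
  then show ?thesis using assms(3,4) N.eqmod_mem[OF assms(2)] by (auto simp: coboundary_0)
next
  interpret N: Module.module R N by fact
  case (Suc j)
  then obtain u where u: "lin_map R (free_module R (r j)) N u"
     "\<And>x. x\<in>carrier (free_module R (r (Suc j))) \<Longrightarrow> eqmod N P (f x) (u (d j x))"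
    using assms(3) by (auto simp: coboundary_Suc)
  then have "\<And>x. x\<in>carrier (free_module R (r (Suc j))) \<Longrightarrow> eqmod N P (g x) (u (d j x))"
    using assms(4) N.eqmod_trans[OF assms(2)] Suc by blast
  then show ?thesis using u(1) Suc by (auto simp: coboundary_Suc)
qed

lemma cocycle_comp:
  assumes "chain_map R r d r' d' \<phi>" "cocycle R r' d' N P i f"
  shows "cocycle R r d N P i (\<lambda>x. f (\<phi> i x))"
  unfolding cocycle_def
proof (intro conjI ballI)
  have \<phi>: "\<And>i. lin_map R (free_module R (r i)) (free_module R (r' i)) (\<phi> i)"
    using assms(1) by (simp add: chain_map_def)
  have f: "lin_map R (free_module R (r' i)) N f" using assms(2) by (simp add: cocycle_def)
  show "lin_map R (free_module R (r i)) N (\<lambda>x. f (\<phi> i x))" by (rule lin_map_comp[OF \<phi> f])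
  fix x assume x: "x \<in> carrier (free_module R (r (Suc i)))"
  then have "\<phi> i (d i x) = d' i (\<phi> (Suc i) x)" using assms(1) by (simp add: chain_map_def)
  then show "f (\<phi> i (d i x)) \<in> P" using assms(2) lin_map_closed[OF \<phi> x] by (simp add: cocycle_def)
qed

lemma coboundary_comp:
  assumes "chain_map R r d r' d' \<phi>" "coboundary R r' d' N P i f"
  shows "coboundary R r d N P i (\<lambda>x. f (\<phi> i x))"
proof -
  have \<phi>: "\<And>i. lin_map R (free_module R (r i)) (free_module R (r' i)) (\<phi> i)"
    using assms(1) by (simp add: chain_map_def)
  show ?thesis
  proof (cases i)
    case 0
    then show ?thesis using assms(2) lin_map_closed[OF \<phi>] by (auto simp: coboundary_0)
  next
    case (Suc j)
    then obtain u where u: "lin_map R (free_module R (r' j)) N u"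
     "\<And>x. x\<in>carrier (free_module R (r' (Suc j))) \<Longrightarrow> eqmod N P (f x) (u (d' j x))"
      using assms(2) by (auto simp: coboundary_Suc)
    have "eqmod N P (f (\<phi> i x)) (u (\<phi> j (d j x)))" if "x\<in>carrier (free_module R (r (Suc j)))" for x
      using u(2)[OF lin_map_closed[OF \<phi> that]] that assms(1) by (simp add: chain_map_def Suc)
    then show ?thesis using lin_map_comp[OF \<phi> u(1)] unfolding Suc coboundary_Suc 
      by (intro exI[of _ "\<lambda>x. u (\<phi> j x)"]) blast
  qed
qed

lemma chain_map_id: "chain_map R r d r d (\<lambda>i x. x)"
  by (simp add: chain_map_def lin_map_def)

section \<open>Exactness around multiplication by a nonzerodivisor\<close>

context cyclic_resolution
begin

text \<open>Subtracting a coboundary vd from u does not change ud, since dd = 0. So u may be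
  replaced by a map g with values in P + yN, and by projectivity g is y times a map w modulo
  P.\<close>

lemma coboundary_add_mult:
  assumes N: "Module.module R N" and P: "submodule P R N" and y: "y \<in> carrier R"
    and u: "lin_map R (F j) N u" and cob: "coboundary R r d N (add_mult N P y) j u"
  shows "\<exists>w. lin_map R (F j) N w \<and> (\<forall>x\<in>carrier (F (Suc j)). eqmod N P (u (d j x)) (y \<odot>\<^bsub>N\<^esub> w (d j x)))"
proof -
  interpret N: Module.module R N by fact
  note Py = N.add_mult_submodule[OF P y]
  have "\<exists>g. lin_map R (F j) N g \<and> (\<forall>x\<in>carrier (F (Suc j)). g (d j x) = u (d j x)) \<and> 
      (\<forall>x\<in>carrier (F j). g x \<in> add_mult N P y)"
  proof (cases j)
    case 0
    then show ?thesis using u cob by (auto simp: coboundary_0)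
  next
    case (Suc k)
    then obtain v where v: "lin_map R (F k) N v"
     "\<And>x. x\<in>carrier (F j) \<Longrightarrow> eqmod N (add_mult N P y) (u x) (v (d k x))"
      using cob by (auto simp: coboundary_Suc)
    have dk: "lin_map R (F j) (F k) (d k)" using d[of k] Suc by simp
    let ?g = "\<lambda>x. u x \<ominus>\<^bsub>N\<^esub> v (d k x)"
    have "lin_map R (F j) N ?g"
      by (rule lin_map_sub[OF F N u lin_map_comp[OF dk v(1)]])
    moreover have "?g x \<in> add_mult N P y" if "x \<in> carrier (F j)" for x
      using v(2)[OF that] by (simp add: eqmod_def)
    moreover have "?g (d j x) = u (d j x)" if "x \<in> carrier (F (Suc j))" for x
    proof -
      have "d k (d j x) = \<zero>\<^bsub>F k\<^esub>" using d_d[of x k] that Suc by simp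
      then have "v (d k (d j x)) = \<zero>\<^bsub>N\<^esub>" using lin_map_zero[OF F N v(1)] by simp
      then show ?thesis using lin_map_closed[OF u d_closed[OF that]] by (simp add: a_minus_def)
    qed
    ultimately show ?thesis by blast
  qed
  then obtain g where g: "lin_map R (F j) N g" "\<And>x. x\<in>carrier (F (Suc j)) \<Longrightarrow> g (d j x) = u (d j x)"
      "\<And>x. x\<in>carrier (F j) \<Longrightarrow> g x \<in> add_mult N P y" by blast
  have "\<exists>m\<in>carrier N. eqmod N P (g x) (y \<odot>\<^bsub>N\<^esub> m)" if x: "x \<in> carrier (F j)" for x
  proof -
    have "eqmod N (add_mult N P y) (g x) \<zero>\<^bsub>N\<^esub>" using g(3)[OF x] N.eqmod_zero_iff[OF Py] by blast
    then obtain m where "m \<in> carrier N" "eqmod N P (g x) (\<zero>\<^bsub>N\<^esub> \<oplus>\<^bsub>N\<^esub> y \<odot>\<^bsub>N\<^esub> m)"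
      using N.eqmod_add_multE[OF P y] by blast
    then show ?thesis using y by auto
  qed
  then obtain w where w: "lin_map R (F j) N w" 
    "\<And>x. x \<in> carrier (F j) \<Longrightarrow> eqmod N P (g x) (y \<odot>\<^bsub>N\<^esub> w x)"
    using free_module_lift[OF N N g(1) N.lin_map_smult[OF y] P] by blast
  then have "\<forall>x\<in>carrier (F (Suc j)). eqmod N P (u (d j x)) (y \<odot>\<^bsub>N\<^esub> w (d j x))"
    using g(2) d_closed by metis
  then show ?thesis using w(1) by blast
qed

end

lemma nonzd_cancel:
  assumes N: "Module.module R N" and P: "submodule P R N" and y: "y \<in> carrier R" "nonzd N P y"
    and ab: "a \<in> carrier N" "b \<in> carrier N" "eqmod N P (y \<odot>\<^bsub>N\<^esub> a) (y \<odot>\<^bsub>N\<^esub> b)"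
  shows "eqmod N P a b"
proof -
  interpret N: Module.module R N by fact
  have "y \<odot>\<^bsub>N\<^esub> (a \<ominus>\<^bsub>N\<^esub> b) \<in> P" using ab y by (simp add: eqmod_def N.smult_r_diff)
  then have "a \<ominus>\<^bsub>N\<^esub> b \<in> P" using y(2) ab by (simp add: nonzd_def)
  then show ?thesis using ab by (simp add: eqmod_def)
qed

text \<open>The long exact sequence of \<open>0 \<rightarrow> N/P \<rightarrow> N/P \<rightarrow> N/(P + yN) \<rightarrow> 0\<close> at two places: the kernel of
  \<open>y\<close> on degree \<open>i\<close> cohomology comes from degree \<open>i - 1\<close>, and the connecting map from degree \<open>i\<close>.\<close>

lemma smult_coboundary_cocycle:
  assumes res: "cyclic_resolution R I r d \<rho>"
    and N: "Module.module R N" and P: "submodule P R N" and y: "y \<in> carrier R" "nonzd N P y"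
    and f: "cocycle R r d N P (Suc j) f" 
    and yf: "coboundary R r d N P (Suc j) (\<lambda>x. y \<odot>\<^bsub>N\<^esub> f x)"
  shows "\<exists>u. cocycle R r d N (add_mult N P y) j u \<and> (\<forall>r' d' \<phi> I' \<rho>'. 
     cyclic_resolution R I' r' d' \<rho>' \<longrightarrow> chain_map R r' d' r d \<phi> \<longrightarrow> 
     coboundary R r' d' N (add_mult N P y) j (\<lambda>x. u (\<phi> j x)) \<longrightarrow>
     coboundary R r' d' N P (Suc j) (\<lambda>x. f (\<phi> (Suc j) x)))"
proof -
  interpret cyclic_resolution R I r d \<rho> by fact
  interpret N: Module.module R N by fact
  have fl: "lin_map R (F (Suc j)) N f" using f by (simp add: cocycle_def)
  \<comment> \<open>u represents a class of degree j for N/(P + yN), and the connecting map sends it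
    to the class of f, since ud = yf modulo P.\<close>
  obtain u where u: "lin_map R (F j) N u"
    "\<And>x. x\<in>carrier (F (Suc j)) \<Longrightarrow> eqmod N P (y \<odot>\<^bsub>N\<^esub> f x) (u (d j x))"
    using yf by (auto simp: coboundary_Suc)
  have "u (d j x) \<in> add_mult N P y" if x: "x \<in> carrier (F (Suc j))" for x
    using eqmod_mono[OF N.add_mult_superset[OF P y(1)] u(2)[OF x]]
      N.eqmod_mem[OF N.add_mult_submodule[OF P y(1)]] N.add_mult_mem[OF P y(1)] 
      lin_map_closed[OF fl x] by blast
  then have "cocycle R r d N (add_mult N P y) j u" using u(1) by (simp add: cocycle_def)
  \<comment> \<open>One u has to work for every resolution mapping to this one: in a tower, u may
    become a coboundary only after a transition map, and f must then do so at the same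
    stage.\<close>
  moreover have "coboundary R r' d' N P (Suc j) (\<lambda>x. f (\<phi> (Suc j) x))"
    if res': "cyclic_resolution R I' r' d' \<rho>'" and \<phi>: "chain_map R r' d' r d \<phi>" 
      and cob: "coboundary R r' d' N (add_mult N P y) j (\<lambda>x. u (\<phi> j x))" for I' r' d' \<rho>' \<phi>
  proof -
    interpret F': cyclic_resolution R I' r' d' \<rho>' by fact
    have \<phi>l: "lin_map R (F'.F j) (F j) (\<phi> j)" for j using \<phi> by (simp add: chain_map_def)
    obtain w where w: "lin_map R (F'.F j) N w" 
      "\<And>x. x\<in>carrier (F'.F (Suc j)) \<Longrightarrow> eqmod N P (u (\<phi> j (d' j x))) (y \<odot>\<^bsub>N\<^esub> w (d' j x))"
      using F'.coboundary_add_mult[OF N P y(1) lin_map_comp[OF \<phi>l u(1)] cob] by blast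
    have "eqmod N P (f (\<phi> (Suc j) x)) (w (d' j x))" if x: "x \<in> carrier (F'.F (Suc j))" for x
    proof (rule nonzd_cancel[OF N P y])
      note \<phi>x = lin_map_closed[OF \<phi>l x]
      have "d j (\<phi> (Suc j) x) = \<phi> j (d' j x)" using \<phi> x by (simp add: chain_map_def)
      then show "eqmod N P (y \<odot>\<^bsub>N\<^esub> f (\<phi> (Suc j) x)) (y \<odot>\<^bsub>N\<^esub> w (d' j x))"
        using u(2)[OF \<phi>x] w(2)[OF x] N.eqmod_trans[OF P] by metis
      show "f (\<phi> (Suc j) x) \<in> carrier N" using lin_map_closed[OF fl \<phi>x] .
      show "w (d' j x) \<in> carrier N" using lin_map_closed[OF w(1) F'.d_closed[OF x]] .
    qed
    then show ?thesis using w(1) unfolding coboundary_Suc by blast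
  qed
  ultimately show ?thesis by blast
qed

lemma smult_coboundary_0:
  assumes "cocycle R r d N P 0 f" "coboundary R r d N P 0 (\<lambda>x. y \<odot>\<^bsub>N\<^esub> f x)" "nonzd N P y"
  shows "coboundary R r d N P 0 f"
  using assms lin_map_closed[of R "free_module R (r 0)" N f] 
  by (auto simp: coboundary_0 nonzd_def cocycle_def)

text \<open>h is fd divided by y, the image of f under the connecting map. If h\<phi> = ud' modulo
  P, then f\<phi> - yu is a cocycle modulo P; vanishing in degree i makes it a coboundary, and
  f\<phi> agrees with it modulo yN. So vanishing for N/P in degree i makes the connecting map
  injective.\<close>

lemma connecting_cocycle:
  assumes res: "cyclic_resolution R I r d \<rho>"
    and N: "Module.module R N" and P: "submodule P R N" and y: "y \<in> carrier R" "nonzd N P y"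
    and f: "cocycle R r d N (add_mult N P y) i f"
  shows "\<exists>h. cocycle R r d N P (Suc i) h \<and> (\<forall>r' d' \<phi> I' \<rho>'. cyclic_resolution R I' r' d' \<rho>' \<longrightarrow>
     chain_map R r' d' r d \<phi> \<longrightarrow> ext_vanish R r' d' N P (Suc i) \<longrightarrow> 
     coboundary R r' d' N P (Suc i) (\<lambda>x. h (\<phi> (Suc i) x)) \<longrightarrow>
     coboundary R r' d' N (add_mult N P y) i (\<lambda>x. f (\<phi> i x)))"
proof -
  interpret cyclic_resolution R I r d \<rho> by fact
  interpret N: Module.module R N by fact
  note Py = N.add_mult_submodule[OF P y(1)]
  have fl: "lin_map R (F i) N f" using f by (simp add: cocycle_def)
  have fd: "lin_map R (F (Suc i)) N (\<lambda>x. f (d i x))" by (rule lin_map_comp[OF d fl])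
  have "\<exists>m\<in>carrier N. eqmod N P (f (d i x)) (y \<odot>\<^bsub>N\<^esub> m)" if x: "x \<in> carrier (F (Suc i))" for x
  proof -
    have "eqmod N (add_mult N P y) (f (d i x)) \<zero>\<^bsub>N\<^esub>" 
      using f x N.eqmod_zero_iff[OF Py] by (simp add: cocycle_def)
    then obtain m where "m \<in> carrier N" "eqmod N P (f (d i x)) (\<zero>\<^bsub>N\<^esub> \<oplus>\<^bsub>N\<^esub> y \<odot>\<^bsub>N\<^esub> m)"
      using N.eqmod_add_multE[OF P y(1)] by blast
    then show ?thesis using y(1) by auto
  qed
  then obtain h where h: "lin_map R (F (Suc i)) N h" 
    "\<And>x. x \<in> carrier (F (Suc i)) \<Longrightarrow> eqmod N P (f (d i x)) (y \<odot>\<^bsub>N\<^esub> h x)"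
    using free_module_lift[OF N N fd N.lin_map_smult[OF y(1)] P] by blast
  have "h (d (Suc i) x) \<in> P" if x: "x \<in> carrier (F (Suc (Suc i)))" for x
  proof -
    have "f (d i (d (Suc i) x)) = \<zero>\<^bsub>N\<^esub>" using d_d[OF x] lin_map_zero[OF F N fl] by simp
    then have "y \<odot>\<^bsub>N\<^esub> h (d (Suc i) x) \<in> P" 
      using h(2)[OF d_closed[OF x]] N.submodule_zero[OF P] N.eqmod_mem[OF P] by auto
    then show ?thesis using y(2) lin_map_closed[OF h(1) d_closed[OF x]] by (simp add: nonzd_def)
  qed
  then have "cocycle R r d N P (Suc i) h" using h(1) by (simp add: cocycle_def)
  moreover have "coboundary R r' d' N (add_mult N P y) i (\<lambda>x. f (\<phi> i x))" 
    if res': "cyclic_resolution R I' r' d' \<rho>'" and \<phi>: "chain_map R r' d' r d \<phi>" 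
      and van: "ext_vanish R r' d' N P (Suc i)"
      and cob: "coboundary R r' d' N P (Suc i) (\<lambda>x. h (\<phi> (Suc i) x))" for I' r' d' \<rho>' \<phi>
  proof -
    interpret F': cyclic_resolution R I' r' d' \<rho>' by fact
    have \<phi>l: "lin_map R (F'.F j) (F j) (\<phi> j)" for j using \<phi> by (simp add: chain_map_def)
    obtain u where u: "lin_map R (F'.F i) N u"
      "\<And>x. x\<in>carrier (F'.F (Suc i)) \<Longrightarrow> eqmod N P (h (\<phi> (Suc i) x)) (u (d' i x))"
      using cob by (auto simp: coboundary_Suc)
    have f\<phi>: "lin_map R (F'.F i) N (\<lambda>x. f (\<phi> i x))" by (rule lin_map_comp[OF \<phi>l fl])
    define g where "g x = f (\<phi> i x) \<ominus>\<^bsub>N\<^esub> y \<odot>\<^bsub>N\<^esub> u x" for x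
    have gl: "lin_map R (F'.F i) N g"
      unfolding g_def by (rule lin_map_sub[OF F'.F N f\<phi> lin_map_scale[OF F'.F N u(1) y(1)]])
    have "g (d' i x) \<in> P" if x: "x \<in> carrier (F'.F (Suc i))" for x
    proof -
      have \<phi>x: "\<phi> (Suc i) x \<in> carrier (F (Suc i))" using lin_map_closed[OF \<phi>l x] .
      have "d i (\<phi> (Suc i) x) = \<phi> i (d' i x)" using \<phi> x by (simp add: chain_map_def)
      then have "eqmod N P (f (\<phi> i (d' i x))) (y \<odot>\<^bsub>N\<^esub> h (\<phi> (Suc i) x))"
        using h(2)[OF \<phi>x] by simp
      then have "eqmod N P (f (\<phi> i (d' i x))) (y \<odot>\<^bsub>N\<^esub> u (d' i x))"
        using N.eqmod_trans[OF P _ N.eqmod_smult[OF P y(1) u(2)[OF x]]] by blast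
      then show ?thesis by (simp add: eqmod_def g_def)
    qed
    then have "coboundary R r' d' N P i g"
      using van gl unfolding ext_vanish_def cocycle_def by blast
    then have g: "coboundary R r' d' N (add_mult N P y) i g"
      by (rule coboundary_mono) (rule N.add_mult_superset[OF P y(1)])
    show ?thesis
    proof (rule coboundary_cong[OF N Py g])
      fix x assume x: "x \<in> carrier (F'.F i)"
      note c = lin_map_closed[OF f\<phi> x] lin_map_closed[OF u(1) x]
      have "f (\<phi> i x) = g x \<oplus>\<^bsub>N\<^esub> y \<odot>\<^bsub>N\<^esub> u x"
        using c y(1) by (simp add: g_def a_minus_def N.M.a_assoc N.M.l_neg)
      then show "eqmod N (add_mult N P y) (f (\<phi> i x)) (g x)"
        using N.eqmod_add_multI[OF P y(1), of _ "g x" "u x"] N.eqmod_refl[OF P] c 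
          lin_map_closed[OF gl x] by metis
    qed
  qed
  ultimately show ?thesis by blast
qed

section \<open>Multiplication by elements of I, and vanishing along regular sequences\<close>

context cyclic_resolution
begin

text \<open>A null-homotopy \<open>z = ds + sd\<close> enters only through its consequence \<open>zd = dsd\<close>.\<close>

lemma null_homotopy:
  assumes z: "z \<in> I"
  shows "\<exists>s. lin_map R (F i) (F (Suc i)) s \<and> 
    (\<forall>x\<in>carrier (F (Suc i)). z \<odot>\<^bsub>F i\<^esub> d i x = d i (s (d i x)))"
proof -
  have zc: "z \<in> carrier R" using ideal.Icarr[OF I z] .
  have zl: "lin_map R (F i) (F i) (\<lambda>x. z \<odot>\<^bsub>F i\<^esub> x)" for i
    by (rule module.lin_map_smult[OF F zc])
  have lift: "\<exists>s. lin_map R (F i) (F (Suc i)) s \<and> (\<forall>x\<in>carrier (F i). g x = d i (s x))"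
    if g: "lin_map R (F i) (F i) g" and ex: "\<And>x. x \<in> carrier (F i) \<Longrightarrow> \<exists>y\<in>carrier (F (Suc i)). g x = d i y"
    for i g
  proof -
    interpret Fi: Module.module R "F i" by (rule F)
    have ez: "eqmod (F i) {\<zero>\<^bsub>F i\<^esub>} a b \<longleftrightarrow> a = b" if "a \<in> carrier (F i)" "b \<in> carrier (F i)" for a b
      using that Fi.eqmod_alt[OF Fi.zero_submodule, of a b] by auto
    obtain s where "lin_map R (F i) (F (Suc i)) s" 
       "\<And>x. x \<in> carrier (F i) \<Longrightarrow> eqmod (F i) {\<zero>\<^bsub>F i\<^esub>} (g x) (d i (s x))"
    proof (rule free_module_lift[OF F F g d Fi.zero_submodule])
      fix x assume "x \<in> carrier (F i)"
      then show "\<exists>y\<in>carrier (F (Suc i)). eqmod (F i) {\<zero>\<^bsub>F i\<^esub>} (g x) (d i y)"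
        using ex[of x] ez lin_map_closed[OF g] d_closed by metis
    qed blast
    then show ?thesis using ez lin_map_closed[OF g] d_closed lin_map_closed by metis
  qed
  show ?thesis
  proof (induction i)
    case 0
    interpret F0: Module.module R "F 0" by (rule F)
    have "\<exists>y\<in>carrier (F (Suc 0)). z \<odot>\<^bsub>F 0\<^esub> x = d 0 y" if x: "x \<in> carrier (F 0)" for x
    proof -
      have "\<rho> (z \<odot>\<^bsub>F 0\<^esub> x) = z \<otimes> \<rho> x" 
        using lin_map_smult_comm[OF \<rho> zc x] by (simp add: self_module_def)
      also have "\<dots> \<in> I" using ideal.I_r_closed[OF I z \<rho>_closed[OF x]] .
      finally show ?thesis using aug_exact[of "z \<odot>\<^bsub>F 0\<^esub> x"] x zc by blast
    qed
    from lift[OF zl this] obtain s where "lin_map R (F 0) (F (Suc 0)) s" 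
      "\<forall>x\<in>carrier (F 0). z \<odot>\<^bsub>F 0\<^esub> x = d 0 (s x)" by blast
    then show ?case using d_closed by blast
  next
    case (Suc i)
    then obtain s where s: "lin_map R (F i) (F (Suc i)) s" 
      "\<And>x. x\<in>carrier (F (Suc i)) \<Longrightarrow> z \<odot>\<^bsub>F i\<^esub> d i x = d i (s (d i x))" by blast
    interpret Fi: Module.module R "F i" by (rule F)
    interpret FS: Module.module R "F (Suc i)" by (rule F)
    \<comment> \<open>By the induction hypothesis d kills zx - s(dx), so exactness writes it as
      d(s'x). On boundaries the s-term drops out because dd = 0, leaving zd = ds'd.\<close>
    let ?g = "\<lambda>x. z \<odot>\<^bsub>F (Suc i)\<^esub> x \<ominus>\<^bsub>F (Suc i)\<^esub> s (d i x)"
    have g: "lin_map R (F (Suc i)) (F (Suc i)) ?g"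
      by (rule lin_map_sub[OF F F zl lin_map_comp[OF d s(1)]])
    have "\<exists>y\<in>carrier (F (Suc (Suc i))). ?g x = d (Suc i) y" if x: "x \<in> carrier (F (Suc i))" for x
    proof -
      have c: "s (d i x) \<in> carrier (F (Suc i))" using lin_map_closed[OF s(1) d_closed[OF x]] .
      have "d i (?g x) = d i (z \<odot>\<^bsub>F (Suc i)\<^esub> x) \<ominus>\<^bsub>F i\<^esub> d i (s (d i x))"
        by (rule lin_map_diff[OF F F d]) (use x zc c in auto)
      also have "\<dots> = \<zero>\<^bsub>F i\<^esub>"
        using lin_map_smult_comm[OF d zc x] s(2)[OF x] d_closed[OF c] by (simp add: a_minus_def Fi.M.r_neg)
      finally show ?thesis using exact[OF lin_map_closed[OF g x]] by blast
    qed
    from lift[OF g this] obtain s' where s': "lin_map R (F (Suc i)) (F (Suc (Suc i))) s'" 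
      "\<forall>x\<in>carrier (F (Suc i)). ?g x = d (Suc i) (s' x)" by blast
    have "z \<odot>\<^bsub>F (Suc i)\<^esub> d (Suc i) x = d (Suc i) (s' (d (Suc i) x))" if x: "x \<in> carrier (F (Suc (Suc i)))" for x
    proof -
      have "s (d i (d (Suc i) x)) = \<zero>\<^bsub>F (Suc i)\<^esub>" using d_d[OF x] lin_map_zero[OF F F s(1)] by simp
      then have "?g (d (Suc i) x) = z \<odot>\<^bsub>F (Suc i)\<^esub> d (Suc i) x" 
        using zc d_closed[OF x] by (simp add: a_minus_def)
      then show ?thesis using s'(2) d_closed[OF x] by metis
    qed
    then show ?case using s'(1) by blast
  qed
qed

text \<open>Multiplication by z is null-homotopic on the resolution of R/I: in positive degrees zx -
  s(dx) is a cycle, hence a boundary, where f vanishes modulo P. So zf is the coboundary of fs, and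
  I annihilates Ext(R/I, N/P).\<close>

lemma smult_coboundary:
  assumes N: "Module.module R N" and P: "submodule P R N" and z: "z \<in> I" and f: "cocycle R r d N P i f"
  shows "coboundary R r d N P i (\<lambda>x. z \<odot>\<^bsub>N\<^esub> f x)"
proof -
  interpret N: Module.module R N by fact
  have zc: "z \<in> carrier R" using ideal.Icarr[OF I z] .
  have fl: "lin_map R (F i) N f" using f by (simp add: cocycle_def)
  show ?thesis
  proof (cases i)
    case 0
    have "z \<odot>\<^bsub>N\<^esub> f x \<in> P" if x: "x \<in> carrier (F 0)" for x
    proof -
      interpret F0: Module.module R "F 0" by (rule F)
      have "\<rho> (z \<odot>\<^bsub>F 0\<^esub> x) = z \<otimes> \<rho> x" 
        using lin_map_smult_comm[OF \<rho> zc x] by (simp add: self_module_def)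
      also have "\<dots> \<in> I" using ideal.I_r_closed[OF I z \<rho>_closed[OF x]] .
      finally obtain y where "y \<in> carrier (F (Suc 0))" "z \<odot>\<^bsub>F 0\<^esub> x = d 0 y" 
        using aug_exact[of "z \<odot>\<^bsub>F 0\<^esub> x"] x zc by blast
      then have "f (z \<odot>\<^bsub>F 0\<^esub> x) \<in> P" using f 0 by (simp add: cocycle_def)
      then show ?thesis using lin_map_smult_comm[OF fl zc] x 0 by simp
    qed
    then show ?thesis using 0 by (simp add: coboundary_0)
  next
    case (Suc j)
    interpret Fj: Module.module R "F j" by (rule F)
    interpret FS: Module.module R "F (Suc j)" by (rule F)
    obtain s where s: "lin_map R (F j) (F (Suc j)) s"
      "\<And>x. x\<in>carrier (F (Suc j)) \<Longrightarrow> z \<odot>\<^bsub>F j\<^esub> d j x = d j (s (d j x))" 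
      using null_homotopy[OF z] by blast
    have "eqmod N P (z \<odot>\<^bsub>N\<^esub> f x) (f (s (d j x)))" if x: "x \<in> carrier (F (Suc j))" for x
    proof -
      have c: "s (d j x) \<in> carrier (F (Suc j))" using lin_map_closed[OF s(1) d_closed[OF x]] .
      let ?x = "z \<odot>\<^bsub>F (Suc j)\<^esub> x \<ominus>\<^bsub>F (Suc j)\<^esub> s (d j x)"
      have "d j ?x = d j (z \<odot>\<^bsub>F (Suc j)\<^esub> x) \<ominus>\<^bsub>F j\<^esub> d j (s (d j x))"
        by (rule lin_map_diff[OF F F d]) (use x zc c in auto)
      also have "\<dots> = \<zero>\<^bsub>F j\<^esub>"
        using lin_map_smult_comm[OF d zc x] s(2)[OF x] d_closed[OF c] by (simp add: a_minus_def Fj.M.r_neg)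
      finally obtain y where "y \<in> carrier (F (Suc (Suc j)))" "?x = d (Suc j) y" 
        using exact[of ?x j] x c zc by auto
      then have "f ?x \<in> P" using f Suc by (simp add: cocycle_def)
      moreover have "f ?x = f (z \<odot>\<^bsub>F (Suc j)\<^esub> x) \<ominus>\<^bsub>N\<^esub> f (s (d j x))"
        by (rule lin_map_diff[OF F N]) (use fl Suc x zc c in auto)
      moreover have "f (z \<odot>\<^bsub>F (Suc j)\<^esub> x) = z \<odot>\<^bsub>N\<^esub> f x"
        using lin_map_smult_comm[OF fl zc] x Suc by simp
      ultimately show ?thesis using lin_map_closed[OF fl] x c zc Suc by (simp add: eqmod_def)
    qed
    moreover have "lin_map R (F j) N (\<lambda>x. f (s x))" 
      by (rule lin_map_comp[OF s(1)]) (use fl Suc in simp)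
    ultimately show ?thesis unfolding Suc coboundary_Suc 
      by (intro exI[of _ "\<lambda>x. f (s x)"]) blast
  qed
qed

lemma cocycle_smult:
  assumes N: "Module.module R N" and P: "submodule P R N" and z: "z \<in> carrier R" and f: "cocycle R r d N P i f"
  shows "cocycle R r d N P i (\<lambda>x. z \<odot>\<^bsub>N\<^esub> f x)"
proof -
  interpret N: Module.module R N by fact
  show ?thesis using f lin_map_scale[OF F N _ z] N.submoduleE(4)[OF P z] by (simp add: cocycle_def)
qed

text \<open>y^q annihilates the cohomology since it lies in I, and vanishing for N/(P + yN) one
  degree lower makes y injective on it; so the factors y are cancelled one at a time. The exponent q
  allows the lemma to serve all the rings R/\<aa>^n at once.\<close>

lemma ext_vanish_of_quotient:
  assumes N: "Module.module R N" and P: "submodule P R N" and y: "y \<in> carrier R" "nonzd N P y"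
    and yq: "y [^] (q::nat) \<in> I" and van: "ext_vanish R r d N (add_mult N P y) e"
  shows "ext_vanish R r d N P (Suc e)"
  unfolding ext_vanish_def
proof (intro allI impI)
  interpret N: Module.module R N by fact
  fix i f assume i: "i < Suc e" and f: "cocycle R r d N P i f"
  have "coboundary R r d N P i (\<lambda>x. y [^] q \<odot>\<^bsub>N\<^esub> f x) \<Longrightarrow> coboundary R r d N P i f" for q :: nat
  proof (induction q)
    case 0
    have "\<And>x. x \<in> carrier (F i) \<Longrightarrow> f x \<in> carrier N" 
      using f lin_map_closed[of R "F i" N f] unfolding cocycle_def by blast
    then show ?case using 0 
      by (intro coboundary_cong[OF N P 0]) (simp add: N.eqmod_refl[OF P])
  next
    case (Suc q)
    have fc: "\<And>x. x \<in> carrier (F i) \<Longrightarrow> f x \<in> carrier N" 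
      using f lin_map_closed[of R "F i" N f] unfolding cocycle_def by blast
    have c: "coboundary R r d N P i (\<lambda>x. y \<odot>\<^bsub>N\<^esub> (y [^] q \<odot>\<^bsub>N\<^esub> f x))"
      by (rule coboundary_cong[OF N P Suc.prems])
         (use fc y in \<open>simp add: N.eqmod_refl[OF P] N.smult_assoc1 N.smult_commute[of y]\<close>)
    have fq: "cocycle R r d N P i (\<lambda>x. y [^] q \<odot>\<^bsub>N\<^esub> f x)" by (rule cocycle_smult[OF N P _ f]) (use y in simp)
    have "coboundary R r d N P i (\<lambda>x. y [^] q \<odot>\<^bsub>N\<^esub> f x)"
    proof (cases i)
      case 0
      then show ?thesis using smult_coboundary_0[of R r d N P _ y] fq c y(2) by blast
    next
      case (Suc j)
      then obtain u where "cocycle R r d N (add_mult N P y) j u"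
        "coboundary R r d N (add_mult N P y) j u \<Longrightarrow> coboundary R r d N P i (\<lambda>x. y [^] q \<odot>\<^bsub>N\<^esub> f x)"
        using smult_coboundary_cocycle[OF cyclic_resolution_axioms N P y, of j "\<lambda>x. y [^] q \<odot>\<^bsub>N\<^esub> f x"] fq c
          cyclic_resolution_axioms chain_map_id[of R r d] by blast
      then show ?thesis using van i Suc unfolding ext_vanish_def by blast
    qed
    then show ?case by (rule Suc.IH)
  qed
  then show "coboundary R r d N P i f" using smult_coboundary[OF N P yq f] by blast
qed

lemma ext_vanish_reg_seq:
  assumes N: "Module.module R N"
  shows "submodule P R N \<Longrightarrow> reg_seq N P ys \<Longrightarrow> set ys \<subseteq> carrier R \<Longrightarrow> 
    (\<And>y. y \<in> set ys \<Longrightarrow> \<exists>q::nat. y [^] q \<in> I) \<Longrightarrow> ext_vanish R r d N P (length ys)"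
proof (induction ys arbitrary: P)
  case Nil
  then show ?case by (simp add: ext_vanish_def)
next
  case (Cons y ys)
  interpret N: Module.module R N by fact
  obtain q :: nat where q: "y [^] q \<in> I" using Cons.prems by auto
  have "ext_vanish R r d N (add_mult N P y) (length ys)"
    using Cons.IH[OF N.add_mult_submodule] Cons.prems by simp
  then show ?case using ext_vanish_of_quotient[OF N Cons.prems(1) _ _ q] Cons.prems by simp
qed

lemma ext_vanish_quotient:
  assumes N: "Module.module R N" and P: "submodule P R N" and y: "y \<in> carrier R" "nonzd N P y"
    and van: "ext_vanish R r d N P (Suc e)"
  shows "ext_vanish R r d N (add_mult N P y) e"
  unfolding ext_vanish_def
proof (intro allI impI)
  fix i f assume i: "i < e" and f: "cocycle R r d N (add_mult N P y) i f"
  obtain h where h: "cocycle R r d N P (Suc i) h" 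
    "ext_vanish R r d N P (Suc i) \<Longrightarrow> coboundary R r d N P (Suc i) h \<Longrightarrow> 
     coboundary R r d N (add_mult N P y) i f"
    using connecting_cocycle[OF cyclic_resolution_axioms N P y f] cyclic_resolution_axioms chain_map_id[of R r d] by blast
  then show "coboundary R r d N (add_mult N P y) i f"
    using van i by (auto simp: ext_vanish_def)
qed

text \<open>This is the homomorphism R/I \<rightarrow> N/P with 1 \<mapsto> v, written on the free
  cover through \<rho>.\<close>

lemma socle_cocycle:
  assumes N: "Module.module R N" and P: "submodule P R N" and v: "v \<in> carrier N" 
    and Iv: "\<And>z. z \<in> I \<Longrightarrow> z \<odot>\<^bsub>N\<^esub> v \<in> P"
  shows "cocycle R r d N P 0 (\<lambda>x. \<rho> x \<odot>\<^bsub>N\<^esub> v)"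
  using lin_map_comp[OF \<rho> module.smult_left_lin_map[OF N v]] Iv \<rho>_d 
  by (auto simp: cocycle_def)

lemma socle_mem:
  assumes N: "Module.module R N" and P: "submodule P R N" and v: "v \<in> carrier N" 
    and J: "ideal J R" and Jv: "\<And>z. z \<in> J \<Longrightarrow> z \<odot>\<^bsub>N\<^esub> v \<in> P" 
    and c: "c \<in> carrier R" "c \<ominus> \<one> \<in> J" "c \<odot>\<^bsub>N\<^esub> v \<in> P"
  shows "v \<in> P"
proof -
  interpret N: Module.module R N by fact
  have "(c \<ominus> \<one>) \<odot>\<^bsub>N\<^esub> v = c \<odot>\<^bsub>N\<^esub> v \<ominus>\<^bsub>N\<^esub> v" using c v by (simp add: N.smult_l_diff)
  then have "eqmod N P (c \<odot>\<^bsub>N\<^esub> v) v" using Jv[OF c(2)] c v by (simp add: eqmod_def)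
  then show ?thesis using N.eqmod_mem[OF P] c by blast
qed

text \<open>Since Hom(R/I, N/P) = 0, the homomorphism 1 \<mapsto> v is zero; evaluate it at t with
  \<rho>(t) congruent to 1 modulo I.\<close>

lemma ext_vanish_socle:
  assumes N: "Module.module R N" and P: "submodule P R N" and v: "v \<in> carrier N" 
    and Iv: "\<And>z. z \<in> I \<Longrightarrow> z \<odot>\<^bsub>N\<^esub> v \<in> P" and van: "ext_vanish R r d N P (Suc e)"
  shows "v \<in> P"
proof -
  obtain t where t: "t \<in> carrier (F 0)" "\<rho> t \<ominus> \<one> \<in> I" using aug_surj by blast
  have "coboundary R r d N P 0 (\<lambda>x. \<rho> x \<odot>\<^bsub>N\<^esub> v)"
    using van socle_cocycle[OF N P v Iv] by (simp add: ext_vanish_def)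
  then have "\<rho> t \<odot>\<^bsub>N\<^esub> v \<in> P" using t by (simp add: coboundary_0)
  then show ?thesis using socle_mem[OF N P v I Iv] t \<rho>_closed by blast
qed

end

section \<open>Towers of resolutions\<close>

lemma chain_map_comp:
  assumes "chain_map R r d r' d' \<phi>" "chain_map R r' d' r'' d'' \<psi>"
  shows "chain_map R r d r'' d'' (\<lambda>i x. \<psi> i (\<phi> i x))"
  using assms lin_map_comp[of R _ _ _ _ "\<psi> _"] unfolding chain_map_def lin_map_def by simp

lemma ideal_sub_image:
  assumes A: "Module.module R A" and B: "Module.module R B" and f: "lin_map R A B f" and I: "I \<subseteq> carrier R"
  shows "ideal_sub R I B (f ` carrier A) \<subseteq> f ` ideal_sub R I A (carrier A)"
proof -
  interpret A: Module.module R A by fact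
  interpret B: Module.module R B by fact
  show ?thesis
  proof (rule B.ideal_sub_minimal)
    show "submodule (f ` ideal_sub R I A (carrier A)) R B"
      by (rule image_submodule[OF A B f A.ideal_sub_submodule[OF I order_refl]])
    fix r z assume "r \<in> I" "z \<in> f ` carrier A"
    then obtain x where x: "x \<in> carrier A" "z = f x" by blast
    then have "r \<odot>\<^bsub>B\<^esub> z = f (r \<odot>\<^bsub>A\<^esub> x)" using lin_map_smult_comm[OF f] I \<open>r \<in> I\<close> by (metis subsetD)
    moreover have "r \<odot>\<^bsub>A\<^esub> x \<in> ideal_sub R I A (carrier A)" by (rule A.ideal_sub_mem) fact+
    ultimately show "r \<odot>\<^bsub>B\<^esub> z \<in> f ` ideal_sub R I A (carrier A)" by blast
  qed
qed

text \<open>Resolutions of all R/\<aa>^n linked by chain maps over the projections R/\<aa>^(n+1)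
  \<rightarrow> R/\<aa>^n; \<open>\<phi>_aug\<close> expresses the latter on the representatives
  \<rho>. Chain maps go from stage n + 1 to stage n, so cocycles are pulled back towards larger
  n.\<close>

locale resolution_tower = cring R for R (structure) +
  fixes \<aa> :: "'a set" and r :: "nat \<Rightarrow> nat \<Rightarrow> nat" and d :: "nat \<Rightarrow> 'a diffs" 
    and \<rho> :: "nat \<Rightarrow> (nat \<Rightarrow> 'a) \<Rightarrow> 'a" and \<phi> :: "nat \<Rightarrow> 'a diffs"
  assumes \<aa>: "ideal \<aa> R"
    and res: "\<And>n. cyclic_resolution R (ideal_pow R \<aa> n) (r n) (d n) (\<rho> n)"
    and \<phi>: "\<And>n. chain_map R (r (Suc n)) (d (Suc n)) (r n) (d n) (\<phi> n)"
    and \<phi>_aug: "\<And>n x. x \<in> carrier (free_module R (r (Suc n) 0)) \<Longrightarrow> 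
      \<rho> n (\<phi> n 0 x) \<ominus> \<rho> (Suc n) x \<in> ideal_pow R \<aa> n"
begin

abbreviation "F n i \<equiv> free_module R (r n i)"

lemma F: "Module.module R (F n i)" by (rule free_module)

primrec \<Phi> :: "nat \<Rightarrow> nat \<Rightarrow> 'a diffs" where
  "\<Phi> n 0 = (\<lambda>i x. x)"
| "\<Phi> n (Suc k) = (\<lambda>i x. \<Phi> n k i (\<phi> (n + k) i x))"

lemma \<Phi>_chain: "chain_map R (r (n + k)) (d (n + k)) (r n) (d n) (\<Phi> n k)"
proof (induction k)
  case (Suc k)
  show ?case using chain_map_comp[OF \<phi>[of "n + k"] Suc] by simp
qed (simp add: chain_map_id)

lemma \<Phi>_lin: "lin_map R (F (n + k) i) (F n i) (\<Phi> n k i)"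
  using \<Phi>_chain by (simp add: chain_map_def)

lemma \<Phi>_d: "x \<in> carrier (F (n + k) (Suc i)) \<Longrightarrow> d n i (\<Phi> n k (Suc i) x) = \<Phi> n k i (d (n + k) i x)"
  using \<Phi>_chain by (simp add: chain_map_def)

lemma \<Phi>_add: "\<Phi> n (k + l) i x = \<Phi> n k i (\<Phi> (n + k) l i x)"
  by (induction l arbitrary: x) (simp_all add: add.assoc)

lemma res_closed:
  "x \<in> carrier (F n 0) \<Longrightarrow> \<rho> n x \<in> carrier R"
  "x \<in> carrier (F n (Suc i)) \<Longrightarrow> d n i x \<in> carrier (F n i)"
  using cyclic_resolution.\<rho>_closed[OF res] cyclic_resolution.d_closed[OF res] by auto

lemma \<phi>_lin: "lin_map R (F (Suc n) i) (F n i) (\<phi> n i)"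
  using \<phi> by (simp add: chain_map_def)

lemma \<Phi>_aug: "x \<in> carrier (F (n + k) 0) \<Longrightarrow> \<rho> n (\<Phi> n k 0 x) \<ominus> \<rho> (n + k) x \<in> ideal_pow R \<aa> n"
proof (induction k arbitrary: x)
  case 0
  then show ?case 
    using res_closed ideal_pow_ideal[OF \<aa>, of n] 
    by (simp add: a_minus_def r_neg additive_subgroup.zero_closed ideal.axioms(1))
next
  case (Suc k)
  interpret An: ideal "ideal_pow R \<aa> n" R by (rule ideal_pow_ideal[OF \<aa>])
  let ?y = "\<phi> (n + k) 0 x"
  have x: "x \<in> carrier (F (Suc (n + k)) 0)" using Suc.prems by simp
  have y: "?y \<in> carrier (F (n + k) 0)" using lin_map_closed[OF \<phi>_lin x] .
  have "\<rho> n (\<Phi> n k 0 ?y) \<ominus> \<rho> (n + k) ?y \<in> ideal_pow R \<aa> n" using Suc.IH[OF y] .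
  moreover have "\<rho> (n + k) ?y \<ominus> \<rho> (Suc (n + k)) x \<in> ideal_pow R \<aa> n"
    using \<phi>_aug[OF x] ideal_pow_antimono[OF \<aa>] by blast
  ultimately have "(\<rho> n (\<Phi> n k 0 ?y) \<ominus> \<rho> (n + k) ?y) \<oplus> (\<rho> (n + k) ?y \<ominus> \<rho> (Suc (n + k)) x) \<in> ideal_pow R \<aa> n"
    by blast
  moreover have "\<rho> n (\<Phi> n k 0 ?y) \<in> carrier R" "\<rho> (n + k) ?y \<in> carrier R" "\<rho> (Suc (n + k)) x \<in> carrier R"
    using res_closed x y lin_map_closed[OF \<Phi>_lin] by auto
  ultimately show ?case by (simp add: a_minus_def a_assoc r_neg1 r_neg2)
qed

lemma pow_in_ideal_pow: "w \<in> \<aa> \<Longrightarrow> \<exists>k::nat. w [^] k \<in> ideal_pow R \<aa> c"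
  using pow_mem_ideal_pow[OF \<aa>] by blast

text \<open>This forces the cohomology of \<open>\<aa>\<close>-torsion modules to vanish in positive degrees: up to
  homotopy, the transition map sends boundaries into \<open>\<aa>\<^sup>cF\<close>, which by Artin--Rees a given
  cocycle with torsion values does not see.\<close>

lemma transition_deep:
  assumes noeth: "noetherian_ring R"
  shows "\<exists>k s. lin_map R (F (n + k) i) (F n (Suc i)) s \<and> 
    (\<forall>z\<in>carrier (F (n + k) (Suc i)). \<Phi> n k i (d (n + k) i z) \<ominus>\<^bsub>F n i\<^esub> d n i (s (d (n + k) i z))
       \<in> ideal_sub R (ideal_pow R \<aa> c) (F n i) (carrier (F n i)))"
proof (induction i arbitrary: c)
  case 0
  let ?k = c
  interpret n: cyclic_resolution R "ideal_pow R \<aa> n" "r n" "d n" "\<rho> n" by (rule res)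
  interpret m: cyclic_resolution R "ideal_pow R \<aa> (n + c)" "r (n + c)" "d (n + c)" "\<rho> (n + c)" by (rule res)
  interpret F0: Module.module R "F n 0" by (rule F)
  interpret An: ideal "ideal_pow R \<aa> n" R by (rule ideal_pow_ideal[OF \<aa>])
  \<comment> \<open>t lies over 1. The map \<Phi>x - \<rho>(x)t has augmentation in \<aa>^n and
    hence equals d(s(x)) for a linear s. On a boundary x = dz, \<rho>(x) lies in \<aa>^(n+c), so
    \<Phi>x - d(s(x)) = \<rho>(x)t lies in \<aa>^c F: the choice k = c suffices.\<close>
  obtain t where t: "t \<in> carrier (F n 0)" "\<rho> n t \<ominus> \<one> \<in> ideal_pow R \<aa> n" using n.aug_surj by blast
  let ?g = "\<lambda>x. \<Phi> n c 0 x \<ominus>\<^bsub>F n 0\<^esub> \<rho> (n + c) x \<odot>\<^bsub>F n 0\<^esub> t"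
  have rt: "lin_map R (F (n + c) 0) (F n 0) (\<lambda>x. \<rho> (n + c) x \<odot>\<^bsub>F n 0\<^esub> t)"
    by (rule lin_map_comp[OF m.\<rho> F0.smult_left_lin_map[OF t(1)]])
  have g: "lin_map R (F (n + c) 0) (F n 0) ?g"
    by (rule lin_map_sub[OF F F \<Phi>_lin rt])
  have "\<exists>y\<in>carrier (F n (Suc 0)). ?g x = d n 0 y" if x: "x \<in> carrier (F (n + c) 0)" for x
  proof -
    have c: "\<Phi> n c 0 x \<in> carrier (F n 0)" "\<rho> (n + c) x \<odot>\<^bsub>F n 0\<^esub> t \<in> carrier (F n 0)"
      using lin_map_closed[OF \<Phi>_lin x] lin_map_closed[OF rt x] by auto
    note cr = n.\<rho>_closed[OF c(1)] m.\<rho>_closed[OF x] n.\<rho>_closed[OF t(1)]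
    have "\<rho> n (?g x) = \<rho> n (\<Phi> n c 0 x) \<ominus>\<^bsub>self_module R\<^esub> \<rho> n (\<rho> (n + c) x \<odot>\<^bsub>F n 0\<^esub> t)"
      by (rule lin_map_diff[OF F n.self n.\<rho> c])
    also have "\<rho> n (\<rho> (n + c) x \<odot>\<^bsub>F n 0\<^esub> t) = \<rho> (n + c) x \<otimes> \<rho> n t"
      using lin_map_smult_comm[OF n.\<rho> cr(2) t(1)] by (simp add: self_module_def)
    also have "\<rho> n (\<Phi> n c 0 x) \<ominus>\<^bsub>self_module R\<^esub> \<rho> (n + c) x \<otimes> \<rho> n t
        = \<rho> n (\<Phi> n c 0 x) \<ominus> \<rho> (n + c) x \<otimes> \<rho> n t"
      by (simp add: self_module_def a_minus_def a_inv_def m_inv_def)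
    also have "\<dots> = (\<rho> n (\<Phi> n c 0 x) \<ominus> \<rho> (n + c) x) \<ominus> \<rho> (n + c) x \<otimes> (\<rho> n t \<ominus> \<one>)"
      using cr by (simp add: a_minus_def r_distr minus_add r_minus a_ac r_neg1 r_neg2)
    also have "\<dots> \<in> ideal_pow R \<aa> n"
      using \<Phi>_aug[OF x] An.I_l_closed[OF t(2) cr(2)] unfolding a_minus_def by blast
    finally show ?thesis using n.aug_exact[OF lin_map_closed[OF g x]] by blast
  qed
  then have "\<exists>y\<in>carrier (F n (Suc 0)). eqmod (F n 0) {\<zero>\<^bsub>F n 0\<^esub>} (?g x) (d n 0 y)" if "x \<in> carrier (F (n + c) 0)" for x
    using that lin_map_closed[OF g that] F0.eqmod_refl[OF F0.zero_submodule] by metis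
  then obtain s where s: "lin_map R (F (n + c) 0) (F n (Suc 0)) s" 
    "\<And>x. x \<in> carrier (F (n + c) 0) \<Longrightarrow> eqmod (F n 0) {\<zero>\<^bsub>F n 0\<^esub>} (?g x) (d n 0 (s x))"
    using free_module_lift[OF F F g n.d F0.zero_submodule] by blast
  have "\<Phi> n c 0 (d (n + c) 0 z) \<ominus>\<^bsub>F n 0\<^esub> d n 0 (s (d (n + c) 0 z))
      \<in> ideal_sub R (ideal_pow R \<aa> c) (F n 0) (carrier (F n 0))" if z: "z \<in> carrier (F (n + c) (Suc 0))" for z
  proof -
    let ?x = "d (n + c) 0 z"
    have x: "?x \<in> carrier (F (n + c) 0)" using m.d_closed[OF z] .
    have c: "\<Phi> n c 0 ?x \<in> carrier (F n 0)" "\<rho> (n + c) ?x \<odot>\<^bsub>F n 0\<^esub> t \<in> carrier (F n 0)" "?g ?x \<in> carrier (F n 0)"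
      using lin_map_closed[OF \<Phi>_lin x] lin_map_closed[OF rt x] lin_map_closed[OF g x] by auto
    have "?g ?x = d n 0 (s ?x)"
      using s(2)[OF x] F0.eqmod_alt[OF F0.zero_submodule] by auto
    then have "\<Phi> n c 0 ?x \<ominus>\<^bsub>F n 0\<^esub> d n 0 (s ?x) = \<Phi> n c 0 ?x \<ominus>\<^bsub>F n 0\<^esub> ?g ?x" by simp
    also have "\<dots> = \<rho> (n + c) ?x \<odot>\<^bsub>F n 0\<^esub> t"
      using c by (simp add: a_minus_def F0.M.minus_add F0.M.r_neg1 F0.M.r_neg2)
    also have "\<dots> \<in> ideal_sub R (ideal_pow R \<aa> c) (F n 0) (carrier (F n 0))"
      using m.\<rho>_d[OF z] ideal_pow_antimono'[OF \<aa>, of c "n + c"] t(1)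
      by (intro F0.ideal_sub_mem) auto
    finally show ?thesis .
  qed
  then show ?case using s(1) by blast
next
  case (Suc i)
  interpret n: cyclic_resolution R "ideal_pow R \<aa> n" "r n" "d n" "\<rho> n" by (rule res)
  interpret Fi: Module.module R "F n i" by (rule F)
  interpret FS: Module.module R "F n (Suc i)" by (rule F)
  let ?Z = "d n i ` carrier (F n (Suc i))"
  have Ac: "ideal_pow R \<aa> c \<subseteq> carrier R" 
    using ideal_pow_ideal[OF \<aa>, of c] by (simp add: additive_subgroup.a_subset ideal.axioms(1))
  let ?P = "ideal_sub R (ideal_pow R \<aa> c) (F n (Suc i)) (carrier (F n (Suc i)))"
  have P: "submodule ?P R (F n (Suc i))" by (rule FS.ideal_sub_submodule[OF Ac order_refl])
  have Z: "submodule ?Z R (F n i)" by (rule image_submodule[OF F F n.d FS.carrier_is_submodule])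
  \<comment> \<open>Artin--Rees for the boundaries Z in degree i: the induction hypothesis is used
    at depth c' so that depth c survives one degree higher. This is why c is arbitrary in the
    induction.\<close>
  obtain c' where c': "ideal_sub R (ideal_pow R \<aa> c') (F n i) (carrier (F n i)) \<inter> ?Z 
      \<subseteq> ideal_sub R (ideal_pow R \<aa> c) (F n i) ?Z"
    using Fi.artin_rees[OF noeth free_module_noetherian[OF noeth] \<aa> ideal_pow_ideal[OF \<aa>] 
        pow_in_ideal_pow Z, of c] by blast
  obtain k s where s: "lin_map R (F (n + k) i) (F n (Suc i)) s"
    "\<And>z. z\<in>carrier (F (n + k) (Suc i)) \<Longrightarrow> \<Phi> n k i (d (n + k) i z) \<ominus>\<^bsub>F n i\<^esub> d n i (s (d (n + k) i z))
       \<in> ideal_sub R (ideal_pow R \<aa> c') (F n i) (carrier (F n i))"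
    using Suc.IH[of c'] by blast
  interpret m: cyclic_resolution R "ideal_pow R \<aa> (n + k)" "r (n + k)" "d (n + k)" "\<rho> (n + k)" by (rule res)
  let ?g = "\<lambda>z. \<Phi> n k (Suc i) z \<ominus>\<^bsub>F n (Suc i)\<^esub> s (d (n + k) i z)"
  have g: "lin_map R (F (n + k) (Suc i)) (F n (Suc i)) ?g"
    by (rule lin_map_sub[OF F F \<Phi>_lin lin_map_comp[OF m.d s(1)]])
  \<comment> \<open>d(gz) lies in \<aa>^(c') F \<inter> Z, hence in \<aa>^c Z, which consists of
    images under d of elements of \<aa>^c F. Thus gz differs from some q \<in> \<aa>^c F by a cycle,
    which exactness makes a boundary dv.\<close>
  have "\<exists>v\<in>carrier (F n (Suc (Suc i))). eqmod (F n (Suc i)) ?P (?g z) (d n (Suc i) v)" 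
    if z: "z \<in> carrier (F (n + k) (Suc i))" for z
  proof -
    have gz: "?g z \<in> carrier (F n (Suc i))" by (rule lin_map_closed[OF g z])
    have "d n i (?g z) = d n i (\<Phi> n k (Suc i) z) \<ominus>\<^bsub>F n i\<^esub> d n i (s (d (n + k) i z))"
      by (rule lin_map_diff[OF F F n.d lin_map_closed[OF \<Phi>_lin z] lin_map_closed[OF s(1) m.d_closed[OF z]]])
    then have "d n i (?g z) \<in> ideal_sub R (ideal_pow R \<aa> c') (F n i) (carrier (F n i))"
      using s(2)[OF z] \<Phi>_d[OF z] by simp
    then have "d n i (?g z) \<in> ideal_sub R (ideal_pow R \<aa> c) (F n i) ?Z" using c' gz by blast
    then obtain q where q: "q \<in> ?P" "d n i (?g z) = d n i q"
      using ideal_sub_image[OF F F n.d Ac] by blast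
    have qc: "q \<in> carrier (F n (Suc i))" using FS.submodule_carrier[OF P q(1)] .
    have "d n i (?g z \<ominus>\<^bsub>F n (Suc i)\<^esub> q) = d n i (?g z) \<ominus>\<^bsub>F n i\<^esub> d n i q"
      by (rule lin_map_diff[OF F F n.d gz qc])
    then have "d n i (?g z \<ominus>\<^bsub>F n (Suc i)\<^esub> q) = \<zero>\<^bsub>F n i\<^esub>"
      using q(2) n.d_closed[OF qc] by (simp add: a_minus_def Fi.M.r_neg)
    then obtain v where v: "v \<in> carrier (F n (Suc (Suc i)))" "?g z \<ominus>\<^bsub>F n (Suc i)\<^esub> q = d n (Suc i) v"
      using n.exact[OF FS.M.minus_closed[OF gz qc]] by blast
    have "?g z = q \<oplus>\<^bsub>F n (Suc i)\<^esub> d n (Suc i) v"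
      unfolding v(2)[symmetric] using gz qc by (simp only: a_minus_def FS.M.a_ac FS.M.a_inv_closed FS.M.add.m_closed FS.M.r_neg1 FS.M.r_neg2 FS.M.r_neg)
    then have "eqmod (F n (Suc i)) ?P (?g z) (d n (Suc i) v)"
      unfolding FS.eqmod_alt[OF P] using q(1) n.d_closed[OF v(1)] by blast
    then show ?thesis using v(1) by blast
  qed
  then obtain s' where s': "lin_map R (F (n + k) (Suc i)) (F n (Suc (Suc i))) s'" 
    "\<And>z. z \<in> carrier (F (n + k) (Suc i)) \<Longrightarrow> eqmod (F n (Suc i)) ?P (?g z) (d n (Suc i) (s' z))"
    using free_module_lift[OF F F g n.d P] by blast
  have "\<Phi> n k (Suc i) (d (n + k) (Suc i) z) \<ominus>\<^bsub>F n (Suc i)\<^esub> d n (Suc i) (s' (d (n + k) (Suc i) z)) \<in> ?P" 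
    if z: "z \<in> carrier (F (n + k) (Suc (Suc i)))" for z
  proof -
    have x: "d (n + k) (Suc i) z \<in> carrier (F (n + k) (Suc i))" using m.d_closed[OF z] .
    have "s (d (n + k) i (d (n + k) (Suc i) z)) = \<zero>\<^bsub>F n (Suc i)\<^esub>" 
      using m.d_d[OF z] lin_map_zero[OF F F s(1)] by simp
    then have "?g (d (n + k) (Suc i) z) = \<Phi> n k (Suc i) (d (n + k) (Suc i) z)"
      using lin_map_closed[OF \<Phi>_lin x] by (simp add: a_minus_def)
    then show ?thesis using s'(2)[OF x] by (simp add: eqmod_def)
  qed
  then show ?case using s'(1) by blast
qed

text \<open>The class of f vanishes in the direct limit, that is, in the local cohomology of
  N/P.\<close>

definition eventually_coboundary where
  "eventually_coboundary N P n i f \<longleftrightarrow> 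
     (\<exists>k. coboundary R (r (n + k)) (d (n + k)) N P i (\<lambda>x. f (\<Phi> n k i x)))"

text \<open>J kills N/P, so f vanishes modulo P on JF; as a cocycle it also vanishes there on
  boundaries. At a late enough stage, \<open>transition_deep\<close> and Artin--Rees for J write
  \<Phi>z - s(dz) as an element of JF plus a boundary, so f\<Phi> is the coboundary of fs.\<close>

lemma torsion_eventually_coboundary:
  assumes noeth: "noetherian_ring R" and N: "Module.module R N" and P: "submodule P R N"
    and J: "ideal J R" and pw: "\<And>w. w \<in> \<aa> \<Longrightarrow> \<exists>k::nat. w [^] k \<in> J"
    and JN: "\<And>j x. j \<in> J \<Longrightarrow> x \<in> carrier N \<Longrightarrow> j \<odot>\<^bsub>N\<^esub> x \<in> P"
    and f: "cocycle R (r n) (d n) N P (Suc i) f"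
  shows "eventually_coboundary N P n (Suc i) f"
proof -
  interpret N: Module.module R N by fact
  interpret n: cyclic_resolution R "ideal_pow R \<aa> n" "r n" "d n" "\<rho> n" by (rule res)
  interpret Fi: Module.module R "F n i" by (rule F)
  interpret FS: Module.module R "F n (Suc i)" by (rule F)
  have fl: "lin_map R (F n (Suc i)) N f" using f by (simp add: cocycle_def)
  let ?Z = "d n i ` carrier (F n (Suc i))"
  have Jc: "J \<subseteq> carrier R" using J by (simp add: additive_subgroup.a_subset ideal.axioms(1))
  have Z: "submodule ?Z R (F n i)" by (rule image_submodule[OF F F n.d FS.carrier_is_submodule])
  obtain c where c: "ideal_sub R (ideal_pow R \<aa> c) (F n i) (carrier (F n i)) \<inter> ?Z 
      \<subseteq> ideal_sub R J (F n i) ?Z"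
    using Fi.artin_rees[OF noeth free_module_noetherian[OF noeth] \<aa> J pw Z] by blast
  obtain k s where s: "lin_map R (F (n + k) i) (F n (Suc i)) s"
    "\<And>z. z\<in>carrier (F (n + k) (Suc i)) \<Longrightarrow> \<Phi> n k i (d (n + k) i z) \<ominus>\<^bsub>F n i\<^esub> d n i (s (d (n + k) i z))
       \<in> ideal_sub R (ideal_pow R \<aa> c) (F n i) (carrier (F n i))"
    using transition_deep[OF noeth, of n i c] by blast
  interpret m: cyclic_resolution R "ideal_pow R \<aa> (n + k)" "r (n + k)" "d (n + k)" "\<rho> (n + k)" by (rule res)
  have "ideal_sub R J (F n (Suc i)) (carrier (F n (Suc i))) \<subseteq> {x \<in> carrier (F n (Suc i)). f x \<in> P}"
    by (rule FS.ideal_sub_minimal[OF vimage_submodule[OF F N fl P]])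
       (use JN Jc lin_map_smult_comm[OF fl] lin_map_closed[OF fl] in auto)
  then have fJ: "f q \<in> P" if "q \<in> ideal_sub R J (F n (Suc i)) (carrier (F n (Suc i)))" for q
    using that by blast
  have "eqmod N P (f (\<Phi> n k (Suc i) z)) (f (s (d (n + k) i z)))" 
    if z: "z \<in> carrier (F (n + k) (Suc i))" for z
  proof -
    have zc: "\<Phi> n k (Suc i) z \<in> carrier (F n (Suc i))" "s (d (n + k) i z) \<in> carrier (F n (Suc i))"
      using lin_map_closed[OF \<Phi>_lin z] lin_map_closed[OF s(1) m.d_closed[OF z]] by auto
    let ?g = "\<Phi> n k (Suc i) z \<ominus>\<^bsub>F n (Suc i)\<^esub> s (d (n + k) i z)"
    have gz: "?g \<in> carrier (F n (Suc i))" using zc by simp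
    have "d n i ?g = d n i (\<Phi> n k (Suc i) z) \<ominus>\<^bsub>F n i\<^esub> d n i (s (d (n + k) i z))"
      by (rule lin_map_diff[OF F F n.d zc])
    then have "d n i ?g \<in> ideal_sub R (ideal_pow R \<aa> c) (F n i) (carrier (F n i))"
      using s(2)[OF z] \<Phi>_d[OF z] by simp
    then have "d n i ?g \<in> ideal_sub R J (F n i) ?Z" using c gz by blast
    then obtain q where q: "q \<in> ideal_sub R J (F n (Suc i)) (carrier (F n (Suc i)))" "d n i ?g = d n i q"
      using ideal_sub_image[OF F F n.d Jc] by blast
    have qc: "q \<in> carrier (F n (Suc i))" 
      using FS.submodule_carrier[OF FS.ideal_sub_submodule[OF Jc order_refl] q(1)] .
    have "d n i (?g \<ominus>\<^bsub>F n (Suc i)\<^esub> q) = d n i ?g \<ominus>\<^bsub>F n i\<^esub> d n i q"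
      by (rule lin_map_diff[OF F F n.d gz qc])
    then have "d n i (?g \<ominus>\<^bsub>F n (Suc i)\<^esub> q) = \<zero>\<^bsub>F n i\<^esub>"
      using q(2) n.d_closed[OF qc] by (simp add: a_minus_def Fi.M.r_neg)
    then obtain v where "v \<in> carrier (F n (Suc (Suc i)))" "?g \<ominus>\<^bsub>F n (Suc i)\<^esub> q = d n (Suc i) v"
      using n.exact[OF FS.M.minus_closed[OF gz qc]] by blast
    then have "f (?g \<ominus>\<^bsub>F n (Suc i)\<^esub> q) \<in> P" using f by (simp add: cocycle_def)
    then have "f ?g \<ominus>\<^bsub>N\<^esub> f q \<in> P" using lin_map_diff[OF F N fl gz qc] by simp
    then have "eqmod N P (f ?g) (f q)" 
      using lin_map_closed[OF fl gz] lin_map_closed[OF fl qc] by (simp add: eqmod_def)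
    then have "f ?g \<in> P" using N.eqmod_mem[OF P] fJ[OF q(1)] by blast
    then show ?thesis using lin_map_diff[OF F N fl zc] lin_map_closed[OF fl] zc by (simp add: eqmod_def)
  qed
  then have "coboundary R (r (n + k)) (d (n + k)) N P (Suc i) (\<lambda>x. f (\<Phi> n k (Suc i) x))"
    unfolding coboundary_Suc using lin_map_comp[OF s(1) fl]
    by (intro exI[of _ "\<lambda>x. f (s x)"]) blast
  then show ?thesis unfolding eventually_coboundary_def by blast
qed

lemma eventually_coboundary_later:
  assumes "eventually_coboundary N P (n + k) i (\<lambda>x. f (\<Phi> n k i x))"
  shows "eventually_coboundary N P n i f"
proof -
  obtain l where "coboundary R (r (n + k + l)) (d (n + k + l)) N P i (\<lambda>x. f (\<Phi> n k i (\<Phi> (n + k) l i x)))"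
    using assms unfolding eventually_coboundary_def by blast
  then have "coboundary R (r (n + (k + l))) (d (n + (k + l))) N P i (\<lambda>x. f (\<Phi> n (k + l) i x))"
    by (simp only: \<Phi>_add add.assoc[symmetric])
  then show ?thesis unfolding eventually_coboundary_def by blast
qed

lemma eventually_coboundaryI:
  assumes "coboundary R (r n) (d n) N P i f" shows "eventually_coboundary N P n i f"
  unfolding eventually_coboundary_def using assms by (intro exI[of _ 0]) simp

text \<open>The limit version of \<open>ext_vanish_of_quotient\<close>: y^n lies in \<aa>^n and
  kills the class at stage n, and the factors y are cancelled one at a time. Each cancellation may
  move to a later stage, so the induction on the exponent leaves n and f arbitrary.\<close>

lemma eventually_coboundary_of_quotient:
  assumes N: "Module.module R N" and P: "submodule P R N" and y: "y \<in> \<aa>" "nonzd N P y"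
    and H: "\<And>n j u. i = Suc j \<Longrightarrow> cocycle R (r n) (d n) N (add_mult N P y) j u \<Longrightarrow> 
      eventually_coboundary N (add_mult N P y) n j u"
    and f: "cocycle R (r n) (d n) N P i f"
  shows "eventually_coboundary N P n i f"
proof -
  interpret N: Module.module R N by fact
  have yc: "y \<in> carrier R" using ideal.Icarr[OF \<aa> y(1)] .
  have step: "eventually_coboundary N P n i f" 
    if f: "cocycle R (r n) (d n) N P i f" and yf: "coboundary R (r n) (d n) N P i (\<lambda>x. y \<odot>\<^bsub>N\<^esub> f x)" 
    for n f
  proof (cases i)
    case 0
    show ?thesis 
      by (rule eventually_coboundaryI) 
         (use smult_coboundary_0[of R "r n" "d n" N P f y] f yf y(2) 0 in simp)
  next
    case (Suc j)
    obtain u where u: "cocycle R (r n) (d n) N (add_mult N P y) j u"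
      "\<And>k. coboundary R (r (n + k)) (d (n + k)) N (add_mult N P y) j (\<lambda>x. u (\<Phi> n k j x)) \<Longrightarrow>
         coboundary R (r (n + k)) (d (n + k)) N P (Suc j) (\<lambda>x. f (\<Phi> n k (Suc j) x))"
      using smult_coboundary_cocycle[OF res N P yc y(2) f[unfolded Suc] yf[unfolded Suc]] res \<Phi>_chain by blast
    then show ?thesis using H[OF Suc u(1)] unfolding eventually_coboundary_def Suc by blast
  qed
  have pow: "cocycle R (r n) (d n) N P i f \<Longrightarrow> coboundary R (r n) (d n) N P i (\<lambda>x. y [^] q \<odot>\<^bsub>N\<^esub> f x) \<Longrightarrow> 
    eventually_coboundary N P n i f" for q :: nat and n f
  proof (induction q arbitrary: n f)
    case 0
    have "\<And>x. x \<in> carrier (F n i) \<Longrightarrow> f x \<in> carrier N" 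
      using 0(1) lin_map_closed[of R "F n i" N f] unfolding cocycle_def by blast
    then have "coboundary R (r n) (d n) N P i f" 
      by (intro coboundary_cong[OF N P 0(2)]) (simp add: N.eqmod_refl[OF P])
    then show ?case by (rule eventually_coboundaryI)
  next
    case (Suc q)
    have fc: "\<And>x. x \<in> carrier (F n i) \<Longrightarrow> f x \<in> carrier N" 
      using Suc.prems(1) lin_map_closed[of R "F n i" N f] unfolding cocycle_def by blast
    have c: "coboundary R (r n) (d n) N P i (\<lambda>x. y \<odot>\<^bsub>N\<^esub> (y [^] q \<odot>\<^bsub>N\<^esub> f x))"
      by (rule coboundary_cong[OF N P Suc.prems(2)])
         (use fc yc in \<open>simp add: N.eqmod_refl[OF P] N.smult_assoc1 N.smult_commute[of y]\<close>)
    have "cocycle R (r n) (d n) N P i (\<lambda>x. y [^] q \<odot>\<^bsub>N\<^esub> f x)"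
      using cyclic_resolution.cocycle_smult[OF res N P _ Suc.prems(1), of "y [^] q"] yc by simp
    then obtain k where k: "coboundary R (r (n + k)) (d (n + k)) N P i (\<lambda>x. y [^] q \<odot>\<^bsub>N\<^esub> f (\<Phi> n k i x))"
      using step[OF _ c] unfolding eventually_coboundary_def by blast
    have "eventually_coboundary N P (n + k) i (\<lambda>x. f (\<Phi> n k i x))"
      by (rule Suc.IH[OF cocycle_comp[OF \<Phi>_chain Suc.prems(1)] k])
    then show ?case by (rule eventually_coboundary_later)
  qed
  have "coboundary R (r n) (d n) N P i (\<lambda>x. y [^] n \<odot>\<^bsub>N\<^esub> f x)"
    by (rule cyclic_resolution.smult_coboundary[OF res N P pow_mem_ideal_pow[OF \<aa> y(1)] f])
  then show ?thesis by (rule pow[OF f])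
qed

text \<open>Each element of ys lowers the length and the degree by one, so the torsion case is
  reached in a positive degree.\<close>

lemma reg_seq_eventually_coboundary:
  assumes noeth: "noetherian_ring R" and N: "Module.module R N" 
    and J: "ideal J R" and pw: "\<And>w. w \<in> \<aa> \<Longrightarrow> \<exists>k::nat. w [^] k \<in> J"
  shows "submodule P R N \<Longrightarrow> reg_seq N P ys \<Longrightarrow> set ys \<subseteq> \<aa> \<Longrightarrow>
    (\<And>j x. j \<in> J \<Longrightarrow> x \<in> carrier N \<Longrightarrow> j \<odot>\<^bsub>N\<^esub> x \<in> add_mults N P ys) \<Longrightarrow> 
    length ys < i \<Longrightarrow> cocycle R (r n) (d n) N P i f \<Longrightarrow> eventually_coboundary N P n i f"
proof (induction ys arbitrary: P i n f)
  case Nil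
  then obtain j where "i = Suc j" by (cases i) auto
  then show ?case using torsion_eventually_coboundary[OF noeth N Nil.prems(1) J pw] Nil.prems by simp
next
  case (Cons y ys)
  interpret N: Module.module R N by fact
  have yc: "y \<in> carrier R" using ideal.Icarr[OF \<aa>] Cons.prems(3) by simp
  show ?case
  proof (rule eventually_coboundary_of_quotient[OF N Cons.prems(1) _ _ _ Cons.prems(6)])
    fix n j u assume "i = Suc j" "cocycle R (r n) (d n) N (add_mult N P y) j u"
    then show "eventually_coboundary N (add_mult N P y) n j u"
      using Cons.IH[OF N.add_mult_submodule[OF Cons.prems(1) yc]] Cons.prems by simp
  qed (use Cons.prems in auto)
qed

text \<open>v defines a homomorphism on R/\<aa>, which is why stage \<open>Suc 0\<close> occurs. It
  survives all transition maps, and the connecting maps that raise its degree along ys are injective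
  at every stage, because Ext(R/\<aa>^n, N/P) vanishes below the length of the sequence.\<close>

lemma reg_seq_not_eventually_coboundary:
  assumes N: "Module.module R N" and v: "v \<in> carrier N"
  shows "submodule P R N \<Longrightarrow> reg_seq N P ys \<Longrightarrow> set ys \<subseteq> \<aa> \<Longrightarrow> v \<notin> add_mults N P ys \<Longrightarrow>
    (\<And>a. a \<in> \<aa> \<Longrightarrow> a \<odot>\<^bsub>N\<^esub> v \<in> add_mults N P ys) \<Longrightarrow>
    \<exists>f. cocycle R (r (Suc 0)) (d (Suc 0)) N P (length ys) f \<and> 
      \<not> eventually_coboundary N P (Suc 0) (length ys) f"
proof (induction ys arbitrary: P)
  case Nil
  interpret N: Module.module R N by fact
  interpret \<aa>: ideal \<aa> R by (rule \<aa>)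
  let ?f = "\<lambda>x. \<rho> (Suc 0) x \<odot>\<^bsub>N\<^esub> v"
  have "cocycle R (r (Suc 0)) (d (Suc 0)) N P 0 ?f"
    by (rule cyclic_resolution.socle_cocycle[OF res N Nil.prems(1) v]) 
       (use Nil.prems ideal_pow_1[OF \<aa>] in auto)
  moreover have "\<not> eventually_coboundary N P (Suc 0) 0 ?f"
  proof
    assume "eventually_coboundary N P (Suc 0) 0 ?f"
    then obtain k where k: "\<And>x. x \<in> carrier (F (Suc 0 + k) 0) \<Longrightarrow> \<rho> (Suc 0) (\<Phi> (Suc 0) k 0 x) \<odot>\<^bsub>N\<^esub> v \<in> P"
      unfolding eventually_coboundary_def coboundary_0 by blast
    interpret m: cyclic_resolution R "ideal_pow R \<aa> (Suc 0 + k)" "r (Suc 0 + k)" "d (Suc 0 + k)" "\<rho> (Suc 0 + k)" 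
      by (rule res)
    \<comment> \<open>t lies over 1 at the later stage; its image at stage \<open>Suc 0\<close> has
      augmentation congruent to 1 modulo \<aa>, so the pulled back homomorphism still takes it to v
      modulo P.\<close>
    obtain t where t: "t \<in> carrier (F (Suc 0 + k) 0)" "\<rho> (Suc 0 + k) t \<ominus> \<one> \<in> ideal_pow R \<aa> (Suc 0 + k)" 
      using m.aug_surj by blast
    then have t1: "\<rho> (Suc 0 + k) t \<ominus> \<one> \<in> \<aa>" 
      using ideal_pow_antimono[OF \<aa>, of "Suc 0" k] ideal_pow_1[OF \<aa>] by blast
    have t2: "\<rho> (Suc 0) (\<Phi> (Suc 0) k 0 t) \<ominus> \<rho> (Suc 0 + k) t \<in> \<aa>"
      using \<Phi>_aug[OF t(1)] ideal_pow_1[OF \<aa>] by simp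
    have tc: "\<rho> (Suc 0) (\<Phi> (Suc 0) k 0 t) \<in> carrier R" "\<rho> (Suc 0 + k) t \<in> carrier R"
      using res_closed(1)[OF lin_map_closed[OF \<Phi>_lin t(1)]] res_closed(1)[OF t(1)] by auto
    have "(\<rho> (Suc 0) (\<Phi> (Suc 0) k 0 t) \<ominus> \<rho> (Suc 0 + k) t) \<oplus> (\<rho> (Suc 0 + k) t \<ominus> \<one>) \<in> \<aa>"
      using t1 t2 by blast
    then have "\<rho> (Suc 0) (\<Phi> (Suc 0) k 0 t) \<ominus> \<one> \<in> \<aa>"
      using tc by (simp add: a_minus_def a_assoc r_neg1 r_neg2)
    then have "v \<in> P" 
      using m.socle_mem[OF N Nil.prems(1) v \<aa>] Nil.prems(5) tc(1) k[OF t(1)] by simp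
    then show False using Nil.prems by simp
  qed
  ultimately show ?case by auto
next
  case (Cons y ys)
  interpret N: Module.module R N by fact
  have yc: "y \<in> carrier R" using ideal.Icarr[OF \<aa>] Cons.prems(3) by simp
  have ac: "\<aa> \<subseteq> carrier R" using ideal.Icarr[OF \<aa>] by blast
  have "\<exists>f. cocycle R (r (Suc 0)) (d (Suc 0)) N (add_mult N P y) (length ys) f \<and> 
      \<not> eventually_coboundary N (add_mult N P y) (Suc 0) (length ys) f"
    by (rule Cons.IH[OF N.add_mult_submodule[OF Cons.prems(1) yc]]) (use Cons.prems in auto)
  then obtain f where f: "cocycle R (r (Suc 0)) (d (Suc 0)) N (add_mult N P y) (length ys) f"
      "\<not> eventually_coboundary N (add_mult N P y) (Suc 0) (length ys) f" by blast
  have reg: "nonzd N P y" using Cons.prems by simp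
  obtain h where h: "cocycle R (r (Suc 0)) (d (Suc 0)) N P (Suc (length ys)) h"
    "\<And>k. ext_vanish R (r (Suc 0 + k)) (d (Suc 0 + k)) N P (Suc (length ys)) \<Longrightarrow>
      coboundary R (r (Suc 0 + k)) (d (Suc 0 + k)) N P (Suc (length ys)) (\<lambda>x. h (\<Phi> (Suc 0) k (Suc (length ys)) x)) \<Longrightarrow>
      coboundary R (r (Suc 0 + k)) (d (Suc 0 + k)) N (add_mult N P y) (length ys) (\<lambda>x. f (\<Phi> (Suc 0) k (length ys) x))"
    using connecting_cocycle[OF res N Cons.prems(1) yc reg f(1)] res \<Phi>_chain by blast
  have "ext_vanish R (r m) (d m) N P (Suc (length ys))" for m
    using cyclic_resolution.ext_vanish_reg_seq[OF res N Cons.prems(1,2), of m] Cons.prems(3) ac pow_in_ideal_pow 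
    by auto
  then have "\<not> eventually_coboundary N P (Suc 0) (Suc (length ys)) h"
    using h(2) f(2) unfolding eventually_coboundary_def by blast
  then show ?case using h(1) by auto
qed

end

section \<open>Quotient modules\<close>

context Module.module
begin

lemma submodule_abelian_subgroup: "submodule P R M \<Longrightarrow> abelian_subgroup P M"
  by (rule abelian_subgroupI3)
     (auto simp: additive_subgroup_def submodule_def M.abelian_group_axioms)

lemma a_rcoset_mem_iff:
  assumes P: "submodule P R M" and x: "x \<in> carrier M"
  shows "y \<in> P +>\<^bsub>M\<^esub> x \<longleftrightarrow> eqmod M P y x"
  using eqmod_alt[OF P] x by (auto simp: a_r_coset_def')

lemma a_rcoset_eq_iff:
  assumes P: "submodule P R M" and xy: "x \<in> carrier M" "y \<in> carrier M"
  shows "P +>\<^bsub>M\<^esub> x = P +>\<^bsub>M\<^esub> y \<longleftrightarrow> eqmod M P x y"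
proof
  assume "P +>\<^bsub>M\<^esub> x = P +>\<^bsub>M\<^esub> y"
  then show "eqmod M P x y"
    using a_rcoset_mem_iff[OF P xy(1), of x] a_rcoset_mem_iff[OF P xy(2), of x] eqmod_refl[OF P xy(1)] by simp
next
  assume e: "eqmod M P x y"
  show "P +>\<^bsub>M\<^esub> x = P +>\<^bsub>M\<^esub> y"
  proof (rule Set.set_eqI)
    fix z 
    show "z \<in> P +>\<^bsub>M\<^esub> x \<longleftrightarrow> z \<in> P +>\<^bsub>M\<^esub> y"
      unfolding a_rcoset_mem_iff[OF P xy(1)] a_rcoset_mem_iff[OF P xy(2)] 
      using e eqmod_trans[OF P] eqmod_sym[OF P] by blast
  qed
qed

text \<open>Well-definedness for maps given as a union over the representatives of a coset; scalar
  multiplication on quotients, \<open>power_proj\<close> and \<open>Ext_map\<close> all have this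
  shape.\<close>

lemma UN_a_rcoset:
  assumes P: "submodule P R M" and Q: "submodule Q R M'" and M': "Module.module R M'"
    and x: "x \<in> carrier M" 
    and f: "\<And>y. eqmod M P y x \<Longrightarrow> f y \<in> carrier M' \<and> eqmod M' Q (f y) (f x)"
  shows "(\<Union>y\<in>P +>\<^bsub>M\<^esub> x. Q +>\<^bsub>M'\<^esub> f y) = Q +>\<^bsub>M'\<^esub> f x"
proof -
  interpret M': Module.module R M' by fact
  have "Q +>\<^bsub>M'\<^esub> f y = Q +>\<^bsub>M'\<^esub> f x" if "y \<in> P +>\<^bsub>M\<^esub> x" for y
    using that M'.a_rcoset_eq_iff[OF Q, of "f y" "f x"] a_rcoset_mem_iff[OF P x] f eqmod_refl[OF P x] by blast
  moreover have "x \<in> P +>\<^bsub>M\<^esub> x" using a_rcoset_mem_iff[OF P x] eqmod_refl[OF P x] by blast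
  ultimately show ?thesis by blast
qed

lemma quotient_module_simps:
  assumes P: "submodule P R M"
  shows quotient_carrier: "carrier (quotient_module M P) = (\<lambda>x. P +>\<^bsub>M\<^esub> x) ` carrier M"
    and quotient_zero: "\<zero>\<^bsub>quotient_module M P\<^esub> = P +>\<^bsub>M\<^esub> \<zero>\<^bsub>M\<^esub>"
    and quotient_add: "\<And>x y. x \<in> carrier M \<Longrightarrow> y \<in> carrier M \<Longrightarrow> 
       (P +>\<^bsub>M\<^esub> x) \<oplus>\<^bsub>quotient_module M P\<^esub> (P +>\<^bsub>M\<^esub> y) = P +>\<^bsub>M\<^esub> (x \<oplus>\<^bsub>M\<^esub> y)"
    and quotient_smult: "\<And>r x. r \<in> carrier R \<Longrightarrow> x \<in> carrier M \<Longrightarrow> 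
       r \<odot>\<^bsub>quotient_module M P\<^esub> (P +>\<^bsub>M\<^esub> x) = P +>\<^bsub>M\<^esub> (r \<odot>\<^bsub>M\<^esub> x)"
proof -
  interpret P: abelian_subgroup P M by (rule submodule_abelian_subgroup[OF P])
  show "carrier (quotient_module M P) = (\<lambda>x. P +>\<^bsub>M\<^esub> x) ` carrier M"
    by (auto simp: quotient_module_def A_RCOSETS_def')
  show "\<zero>\<^bsub>quotient_module M P\<^esub> = P +>\<^bsub>M\<^esub> \<zero>\<^bsub>M\<^esub>"
    using P.a_subset by (simp add: quotient_module_def)
  show "(P +>\<^bsub>M\<^esub> x) \<oplus>\<^bsub>quotient_module M P\<^esub> (P +>\<^bsub>M\<^esub> y) = P +>\<^bsub>M\<^esub> (x \<oplus>\<^bsub>M\<^esub> y)"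
    if "x \<in> carrier M" "y \<in> carrier M" for x y
    using P.a_rcos_sum[OF that] by (simp add: quotient_module_def)
  show "r \<odot>\<^bsub>quotient_module M P\<^esub> (P +>\<^bsub>M\<^esub> x) = P +>\<^bsub>M\<^esub> (r \<odot>\<^bsub>M\<^esub> x)"
    if "r \<in> carrier R" "x \<in> carrier M" for r x
    unfolding quotient_module_def using that
    by (simp, intro UN_a_rcoset P module_axioms) (auto intro: eqmod_smult[OF P] dest: eqmod_carrier)
qed

lemma quotient_module:
  assumes P: "submodule P R M"
  shows "Module.module R (quotient_module M P)"
proof (rule moduleI[OF R.is_cring])
  note [simp] = quotient_module_simps[OF P]
  show "abelian_group (quotient_module M P)"
  proof (rule abelian_groupI)
    fix X assume "X \<in> carrier (quotient_module M P)"
    then obtain x where x: "x \<in> carrier M" "X = P +>\<^bsub>M\<^esub> x" by auto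
    then have "(P +>\<^bsub>M\<^esub> (\<ominus>\<^bsub>M\<^esub> x)) \<oplus>\<^bsub>quotient_module M P\<^esub> X = \<zero>\<^bsub>quotient_module M P\<^esub>"
      by (simp add: M.l_neg)
    then show "\<exists>Y\<in>carrier (quotient_module M P). Y \<oplus>\<^bsub>quotient_module M P\<^esub> X = \<zero>\<^bsub>quotient_module M P\<^esub>"
      using x(1) by auto
  qed (auto simp: M.a_ac)
qed (auto simp: quotient_module_simps[OF P] smult_l_distr smult_r_distr smult_assoc1)

lemma quotient_proj:
  assumes P: "submodule P R M"
  shows "lin_map R M (quotient_module M P) (\<lambda>x. P +>\<^bsub>M\<^esub> x)"
  using quotient_module_simps[OF P] by (auto simp: lin_map_def)

lemma quotient_proj_zero_iff:
  assumes P: "submodule P R M" and x: "x \<in> carrier M"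
  shows "P +>\<^bsub>M\<^esub> x = \<zero>\<^bsub>quotient_module M P\<^esub> \<longleftrightarrow> x \<in> P"
  using a_rcoset_eq_iff[OF P x, of "\<zero>\<^bsub>M\<^esub>"] eqmod_zero_iff[OF P] quotient_zero[OF P] by simp

lemma nonzd_quotient_iff:
  assumes P: "submodule P R M" and y: "y \<in> carrier R"
  shows "(\<forall>q\<in>carrier (quotient_module M P). y \<odot>\<^bsub>quotient_module M P\<^esub> q = \<zero>\<^bsub>quotient_module M P\<^esub> \<longrightarrow>
      q = \<zero>\<^bsub>quotient_module M P\<^esub>) \<longleftrightarrow> nonzd M P y"
  using y by (auto simp: nonzd_def quotient_carrier[OF P] quotient_smult[OF P] quotient_proj_zero_iff[OF P])

lemma regular_sequence_iff:
  "regular_sequence R M xs \<longleftrightarrow> set xs \<subseteq> carrier R \<and> reg_seq M {\<zero>\<^bsub>M\<^esub>} xs \<and> add_mults M {\<zero>\<^bsub>M\<^esub>} xs \<noteq> carrier M"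
proof (cases "set xs \<subseteq> carrier R")
  case True
  have "(\<forall>j<length xs. let Q = quotient_module M (ideal_smult R (Idl (set (take j xs))) M) in
          \<forall>q \<in> carrier Q. xs ! j \<odot>\<^bsub>Q\<^esub> q = \<zero>\<^bsub>Q\<^esub> \<longrightarrow> q = \<zero>\<^bsub>Q\<^esub>) \<longleftrightarrow>
        (\<forall>j<length xs. nonzd M (add_mults M {\<zero>\<^bsub>M\<^esub>} (take j xs)) (xs ! j))"
  proof (intro all_cong)
    fix j assume j: "j < length xs"
    have t: "set (take j xs) \<subseteq> carrier R" using True set_take_subset[of j xs] by blast
    have y: "xs ! j \<in> carrier R" using True j by auto
    show "(let Q = quotient_module M (ideal_smult R (Idl (set (take j xs))) M) in
          \<forall>q \<in> carrier Q. xs ! j \<odot>\<^bsub>Q\<^esub> q = \<zero>\<^bsub>Q\<^esub> \<longrightarrow> q = \<zero>\<^bsub>Q\<^esub>) \<longleftrightarrow> nonzd M (add_mults M {\<zero>\<^bsub>M\<^esub>} (take j xs)) (xs ! j)"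
      unfolding Let_def ideal_smult_add_mults[OF t]
      by (rule nonzd_quotient_iff[OF add_mults_submodule[OF zero_submodule t] y])
  qed
  also have "\<dots> \<longleftrightarrow> reg_seq M {\<zero>\<^bsub>M\<^esub>} xs"
  proof -
    have "reg_seq M P xs \<longleftrightarrow> (\<forall>j<length xs. nonzd M (add_mults M P (take j xs)) (xs ! j))" for P
    proof (induction xs arbitrary: P)
      case (Cons x xs)
      then show ?case by (auto simp: All_less_Suc2)
    qed simp
    then show ?thesis by simp
  qed
  finally show ?thesis unfolding regular_sequence_def using True ideal_smult_add_mults[OF True] by simp
qed (simp add: regular_sequence_def)

end

section \<open>Regular sequences under surjections\<close>

lemma image_add_mults:
  assumes A: "Module.module R A" and B: "Module.module R B" and q: "lin_map R A B q" 
    and surj: "q ` carrier A = carrier B"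
  shows "submodule H R A \<Longrightarrow> set ys \<subseteq> carrier R \<Longrightarrow> add_mults B (q ` H) ys = q ` add_mults A H ys"
proof (induction ys arbitrary: H)
  case (Cons y ys)
  interpret A: Module.module R A by fact
  have y: "y \<in> carrier R" using Cons.prems by simp
  have e: "q (p \<oplus>\<^bsub>A\<^esub> y \<odot>\<^bsub>A\<^esub> m) = q p \<oplus>\<^bsub>B\<^esub> y \<odot>\<^bsub>B\<^esub> q m" if "p \<in> H" "m \<in> carrier A" for p m
    using that y A.submodule_carrier[OF Cons.prems(1)] lin_mapD[OF q] by simp
  have "add_mult B (q ` H) y = q ` add_mult A H y"
  proof (intro equalityI subsetI)
    fix z assume "z \<in> add_mult B (q ` H) y"
    then obtain p m where pm: "p \<in> H" "m \<in> carrier A" "z = q p \<oplus>\<^bsub>B\<^esub> y \<odot>\<^bsub>B\<^esub> q m"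
      unfolding add_mult_def surj[symmetric] by blast
    have "z = q (p \<oplus>\<^bsub>A\<^esub> y \<odot>\<^bsub>A\<^esub> m)" using e[OF pm(1,2)] pm(3) by simp
    then show "z \<in> q ` add_mult A H y" unfolding add_mult_def using pm(1,2) by blast
  next
    fix z assume "z \<in> q ` add_mult A H y"
    then obtain p m where pm: "p \<in> H" "m \<in> carrier A" "z = q (p \<oplus>\<^bsub>A\<^esub> y \<odot>\<^bsub>A\<^esub> m)"
      unfolding add_mult_def by blast
    then show "z \<in> add_mult B (q ` H) y" 
      unfolding add_mult_def using e[OF pm(1,2)] lin_map_closed[OF q pm(2)] by blast
  qed
  then show ?case using Cons.IH[OF A.add_mult_submodule[OF Cons.prems(1) y]] Cons.prems by simp
qed simp

text \<open>Every submodule H met along the sequence contains P, which contains the kernel of q; so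
  each H is the full preimage of its image, and regularity carries over.\<close>

lemma image_reg_seq:
  assumes A: "Module.module R A" and B: "Module.module R B" and q: "lin_map R A B q" 
    and surj: "q ` carrier A = carrier B" and ker: "\<And>x. x \<in> carrier A \<Longrightarrow> q x = \<zero>\<^bsub>B\<^esub> \<Longrightarrow> x \<in> P"
  shows "submodule H R A \<Longrightarrow> P \<subseteq> H \<Longrightarrow> set ys \<subseteq> carrier R \<Longrightarrow> reg_seq A H ys \<Longrightarrow> reg_seq B (q ` H) ys"
proof (induction ys arbitrary: H)
  case (Cons y ys)
  interpret A: Module.module R A by fact
  interpret B: Module.module R B by fact
  have y: "y \<in> carrier R" using Cons.prems by simp
  have mem: "x \<in> H" if x: "x \<in> carrier A" "q x \<in> q ` H" for x
  proof -
    obtain h where h: "h \<in> H" "q x = q h" using x by blast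
    have hc: "h \<in> carrier A" using A.submodule_carrier[OF Cons.prems(1) h(1)] .
    have "q (x \<ominus>\<^bsub>A\<^esub> h) = \<zero>\<^bsub>B\<^esub>"
      using lin_map_diff[OF A B q x(1) hc] h lin_map_closed[OF q hc] by (simp add: a_minus_def B.M.r_neg)
    then have "x \<ominus>\<^bsub>A\<^esub> h \<in> H" using ker[of "x \<ominus>\<^bsub>A\<^esub> h"] x hc Cons.prems(2) by auto
    then have "eqmod A H x h" using x hc by (simp add: eqmod_def)
    then show ?thesis using A.eqmod_mem[OF Cons.prems(1)] h by blast
  qed
  have "nonzd B (q ` H) y"
    unfolding nonzd_def
  proof (intro ballI impI)
    fix b assume b: "b \<in> carrier B" "y \<odot>\<^bsub>B\<^esub> b \<in> q ` H"
    then obtain m where m: "m \<in> carrier A" "b = q m" using surj by blast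
    then have "q (y \<odot>\<^bsub>A\<^esub> m) \<in> q ` H" using b lin_map_smult_comm[OF q y] by simp
    then have "y \<odot>\<^bsub>A\<^esub> m \<in> H" using mem y m by blast
    then show "b \<in> q ` H" using Cons.prems(4) m by (simp add: nonzd_def)
  qed
  moreover have "reg_seq B (q ` add_mult A H y) ys"
    using Cons.IH[OF A.add_mult_submodule[OF Cons.prems(1) y]] A.add_mult_superset[OF Cons.prems(1) y] 
      Cons.prems by auto
  moreover have "add_mult B (q ` H) y = q ` add_mult A H y"
    using image_add_mults[OF A B q surj Cons.prems(1), of "[y]"] y by simp
  ultimately show ?case by simp
qed simp

section \<open>Grade\<close>

lemma ext_vanish_mono: "ext_vanish R r d N P e \<Longrightarrow> e' \<le> e \<Longrightarrow> ext_vanish R r d N P e'"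
  by (auto simp: ext_vanish_def)

lemma (in Module.module) nonzd_pow:
  assumes "w \<in> carrier R" "nonzd M P w" shows "nonzd M P (w [^] (k::nat))"
proof (induction k)
  case (Suc k)
  show ?case
    unfolding nonzd_def
  proof (intro ballI impI)
    fix m assume m: "m \<in> carrier M" "w [^] Suc k \<odot>\<^bsub>M\<^esub> m \<in> P"
    then have "w [^] k \<odot>\<^bsub>M\<^esub> (w \<odot>\<^bsub>M\<^esub> m) \<in> P" using assms(1) by (simp add: smult_assoc1)
    then have "w \<odot>\<^bsub>M\<^esub> m \<in> P" using Suc assms(1) m(1) unfolding nonzd_def by blast
    then show "m \<in> P" using assms(2) m(1) unfolding nonzd_def by blast
  qed
qed (simp add: nonzd_def)

lemma (in Module.module) genideal_smult_mem:
  assumes "submodule Q R M" "v \<in> carrier M" "S \<subseteq> carrier R" "\<And>z. z \<in> S \<Longrightarrow> z \<odot>\<^bsub>M\<^esub> v \<in> Q" "u \<in> Idl S"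
  shows "u \<odot>\<^bsub>M\<^esub> v \<in> Q"
proof -
  have "Idl S \<subseteq> {r \<in> carrier R. \<forall>x\<in>{v}. r \<odot>\<^bsub>M\<^esub> x \<in> Q}"
    by (rule R.genideal_minimal[OF annihilating_ideal[OF assms(1)]]) (use assms in auto)
  then show ?thesis using assms(5) by blast
qed

text \<open>Every element of \<open>I\<close> has a power in \<open>\<langle>zs\<rangle> + Ann (N/P)\<close>, in a form that is inherited by larger
  submodules \<open>P\<close>.\<close>

definition power_bounded ::
    "('a, 'r) ring_scheme \<Rightarrow> 'a set \<Rightarrow> ('a, 'b, 'm) module_scheme \<Rightarrow> 'b set \<Rightarrow> 'a list \<Rightarrow> bool" where
  "power_bounded R I N P zs \<longleftrightarrow> (\<forall>w\<in>I. \<exists>k::nat. \<forall>Q v. submodule Q R N \<longrightarrow> P \<subseteq> Q \<longrightarrow> v \<in> carrier N \<longrightarrow>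
     (\<forall>z\<in>set zs. z \<odot>\<^bsub>N\<^esub> v \<in> Q) \<longrightarrow> w [^]\<^bsub>R\<^esub> k \<odot>\<^bsub>N\<^esub> v \<in> Q)"

lemma (in Module.module) power_bounded_add_mults:
  assumes "power_bounded R I M P zs" "submodule P R M" "set zs \<subseteq> carrier R" "w \<in> I"
  shows "\<exists>k::nat. \<forall>v\<in>carrier M. w [^] k \<odot>\<^bsub>M\<^esub> v \<in> add_mults M P zs"
proof -
  obtain k :: nat where k: "\<And>Q v. submodule Q R M \<Longrightarrow> P \<subseteq> Q \<Longrightarrow> v \<in> carrier M \<Longrightarrow>
     (\<forall>z\<in>set zs. z \<odot>\<^bsub>M\<^esub> v \<in> Q) \<Longrightarrow> w [^]\<^bsub>R\<^esub> k \<odot>\<^bsub>M\<^esub> v \<in> Q"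
    using assms(1,4) unfolding power_bounded_def by meson
  show ?thesis
    using k[OF add_mults_submodule[OF assms(2,3)] add_mults_superset[OF assms(2,3)]] 
      add_mults_mem[OF assms(2,3)] by blast
qed

text \<open>A submodule Q that contains (z + u)M and into which all of zs carry v also receives uv,
  hence zv = (z + u)v - uv. So the same exponent works after z is replaced by z + u and divided
  out.\<close>

lemma (in Module.module) power_bounded_add_mult:
  assumes pb: "power_bounded R I M P (z # zs)" and P: "submodule P R M" and zs: "set (z # zs) \<subseteq> carrier R"
    and u: "u \<in> Idl (set zs)"
  shows "power_bounded R I M (add_mult M P (z \<oplus> u)) zs"
  unfolding power_bounded_def
proof (intro ballI)
  have zc: "z \<in> carrier R" using zs by simp
  have "ideal (Idl (set zs)) R" by (rule R.genideal_ideal) (use zs in simp)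
  then have uc: "u \<in> carrier R" using u ideal.Icarr by fast
  have zuc: "z \<oplus> u \<in> carrier R" using zc uc by simp
  fix w assume "w \<in> I"
  then obtain k :: nat where k: "\<And>Q v. submodule Q R M \<Longrightarrow> P \<subseteq> Q \<Longrightarrow> v \<in> carrier M \<Longrightarrow>
     (\<forall>z\<in>set (z # zs). z \<odot>\<^bsub>M\<^esub> v \<in> Q) \<Longrightarrow> w [^]\<^bsub>R\<^esub> k \<odot>\<^bsub>M\<^esub> v \<in> Q"
    using pb unfolding power_bounded_def by meson
  show "\<exists>k::nat. \<forall>Q v. submodule Q R M \<longrightarrow> add_mult M P (z \<oplus> u) \<subseteq> Q \<longrightarrow> v \<in> carrier M \<longrightarrow>
     (\<forall>z\<in>set zs. z \<odot>\<^bsub>M\<^esub> v \<in> Q) \<longrightarrow> w [^]\<^bsub>R\<^esub> k \<odot>\<^bsub>M\<^esub> v \<in> Q"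
  proof (intro exI allI impI)
    fix Q v assume Q: "submodule Q R M" "add_mult M P (z \<oplus> u) \<subseteq> Q" and v: "v \<in> carrier M" 
      and zv: "\<forall>z\<in>set zs. z \<odot>\<^bsub>M\<^esub> v \<in> Q"
    have uv: "u \<odot>\<^bsub>M\<^esub> v \<in> Q" by (rule genideal_smult_mem[OF Q(1) v _ _ u]) (use zs zv in auto)
    have "(z \<oplus> u) \<odot>\<^bsub>M\<^esub> v \<in> Q" using add_mult_mem[OF P zuc v] Q by blast
    then have "(z \<oplus> u) \<odot>\<^bsub>M\<^esub> v \<ominus>\<^bsub>M\<^esub> u \<odot>\<^bsub>M\<^esub> v \<in> Q" using submodule_diff[OF Q(1)] uv by blast
    moreover have "(z \<oplus> u) \<odot>\<^bsub>M\<^esub> v \<ominus>\<^bsub>M\<^esub> u \<odot>\<^bsub>M\<^esub> v = z \<odot>\<^bsub>M\<^esub> v"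
      using zc uc v by (simp add: smult_l_distr a_minus_def M.a_assoc M.r_neg)
    ultimately show "w [^]\<^bsub>R\<^esub> k \<odot>\<^bsub>M\<^esub> v \<in> Q"
      using k[OF Q(1)] add_mult_superset[OF P zuc] Q(2) v zv by simp
  qed
qed

section \<open>Rees' theorem and the regularity of a system of parameters\<close>

context cyclic_resolution
begin

text \<open>Coset avoidance with x = 0: since Hom(R/I, N/P) = 0, no nonzero element of N/P is killed
  by I.\<close>

lemma ext_vanish_nonzd:
  assumes noeth: "noetherian_ring R" and N: "Module.module R N" and NM: "noetherian_module R N" 
    and P: "submodule P R N" and van: "ext_vanish R r d N P (Suc e)"
  shows "\<exists>z\<in>I. nonzd N P z"
proof -
  interpret N: Module.module R N by fact
  have "\<exists>u\<in>I. nonzd N P (\<zero> \<oplus> u)"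
    by (rule N.coset_avoidance[OF noeth NM P I]) (use ext_vanish_socle[OF N P _ _ van] in auto)
  then show ?thesis using ideal.Icarr[OF I] by auto
qed

lemma ext_vanish_add_mults:
  assumes N: "Module.module R N"
  shows "submodule P R N \<Longrightarrow> set ys \<subseteq> carrier R \<Longrightarrow> reg_seq N P ys \<Longrightarrow> 
    ext_vanish R r d N P (length ys + e) \<Longrightarrow> ext_vanish R r d N (add_mults N P ys) e"
proof (induction ys arbitrary: P)
  case (Cons y ys)
  interpret N: Module.module R N by fact
  show ?case 
    using Cons.IH[OF N.add_mult_submodule[of P y]] ext_vanish_quotient[OF N Cons.prems(1), of y "length ys + e"]
      Cons.prems by simp
qed simp

text \<open>Choosing \<open>u \<in> \<langle>zs\<rangle>\<close> with \<open>z + u\<close> regular on \<open>N/P\<close> reduces to \<open>N/(P + (z + u)N)\<close>; in the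
  end \<open>last zs\<close> belongs to a regular sequence and can be moved to its front.\<close>

lemma nonzd_last:
  assumes noeth: "noetherian_ring R" and N: "Module.module R N" and NM: "noetherian_module R N" 
    and jac: "I \<subseteq> jacobson_radical R"
  shows "submodule P R N \<Longrightarrow> zs \<noteq> [] \<Longrightarrow> set zs \<subseteq> I \<Longrightarrow> power_bounded R I N P zs \<Longrightarrow> 
    ext_vanish R r d N P (length zs) \<Longrightarrow> nonzd N P (last zs)"
proof (induction zs arbitrary: P)
  case (Cons z zs)
  interpret N: Module.module R N by fact
  interpret I: ideal I R by (rule I)
  have zc: "z \<in> carrier R" "z \<in> I" "set zs \<subseteq> carrier R" "set zs \<subseteq> I" using Cons.prems(3) I.Icarr by auto
  obtain w where w: "w \<in> I" "nonzd N P w"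
    using ext_vanish_nonzd[OF noeth N NM Cons.prems(1)] Cons.prems(5) by auto
  \<comment> \<open>If \<open>z # zs\<close> carries v into P, so does a power of the nonzerodivisor
    w. This is the hypothesis that coset avoidance needs for z and the ideal generated by zs; for a
    single element it is already the claim.\<close>
  have no_socle: "v \<in> P" if v: "v \<in> carrier N" "\<And>x. x \<in> set (z # zs) \<Longrightarrow> x \<odot>\<^bsub>N\<^esub> v \<in> P" for v
  proof -
    obtain k :: nat where "w [^] k \<odot>\<^bsub>N\<^esub> v \<in> P"
      using Cons.prems(4,1) w(1) v unfolding power_bounded_def by blast
    then show ?thesis using N.nonzd_pow[OF I.Icarr[OF w(1)] w(2), of k] v(1) by (simp add: nonzd_def)
  qed
  show ?case
  proof (cases "zs = []")
    case True
    then show ?thesis using no_socle by (simp add: nonzd_def)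
  next
    case False
    have "\<exists>u\<in>Idl (set zs). nonzd N P (z \<oplus> u)"
    proof (rule N.coset_avoidance[OF noeth NM Cons.prems(1) genideal_ideal[OF zc(3)] zc(1)])
      fix v assume "v \<in> carrier N" "z \<odot>\<^bsub>N\<^esub> v \<in> P" "\<And>j. j \<in> Idl (set zs) \<Longrightarrow> j \<odot>\<^bsub>N\<^esub> v \<in> P"
      then show "v \<in> P" using no_socle genideal_self[OF zc(3)] by auto
    qed
    then obtain u where u: "u \<in> Idl (set zs)" "nonzd N P (z \<oplus> u)" by blast
    have "Idl (set zs) \<subseteq> I" by (rule genideal_minimal[OF I zc(4)])
    then have zu: "z \<oplus> u \<in> I" "z \<oplus> u \<in> carrier R" using u zc I.Icarr by auto
    have "nonzd N (add_mult N P (z \<oplus> u)) (last zs)"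
    proof (rule Cons.IH[OF N.add_mult_submodule[OF Cons.prems(1) zu(2)] False zc(4)])
      show "power_bounded R I N (add_mult N P (z \<oplus> u)) zs"
        by (rule N.power_bounded_add_mult[OF Cons.prems(4,1) _ u(1)]) (use zc in auto)
      show "ext_vanish R r d N (add_mult N P (z \<oplus> u)) (length zs)"
        by (rule ext_vanish_quotient[OF N Cons.prems(1) zu(2) u(2)]) (use Cons.prems(5) in simp)
    qed
    then have "nonzd N P (last zs)"
      using N.nonzd_swap(1)[OF NM Cons.prems(1) _ _ u(2)] zu jac zc(3) last_in_set[OF False] by blast
    then show ?thesis using False by simp
  qed
qed simp

text \<open>The last element is a nonzerodivisor by \<open>nonzd_last\<close>, so it is divided out
  first. The others are regular on the quotient by induction, and \<open>reg_seq_rotate\<close> puts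
  the last element back in its place.\<close>

lemma reg_seq_of_ext_vanish:
  assumes noeth: "noetherian_ring R" and N: "Module.module R N" and NM: "noetherian_module R N" 
    and jac: "I \<subseteq> jacobson_radical R"
  shows "submodule P R N \<Longrightarrow> set zs \<subseteq> I \<Longrightarrow> power_bounded R I N P zs \<Longrightarrow> 
    ext_vanish R r d N P (length zs) \<Longrightarrow> reg_seq N P zs"
proof (induction zs arbitrary: P rule: rev_induct)
  case (snoc z zs)
  interpret N: Module.module R N by fact
  interpret I: ideal I R by (rule I)
  have zc: "z \<in> carrier R" "z \<in> I" "set zs \<subseteq> carrier R" "set zs \<subseteq> I" using snoc.prems(2) I.Icarr by auto
  have z: "nonzd N P z" 
    using nonzd_last[OF noeth N NM jac snoc.prems(1) _ snoc.prems(2-4)] by simp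
  have "power_bounded R I N P (z # zs)" using snoc.prems(3) unfolding power_bounded_def by simp
  \<comment> \<open>The change of generators with u = 0.\<close>
  then have "power_bounded R I N (add_mult N P (z \<oplus> \<zero>)) zs"
    by (rule N.power_bounded_add_mult[OF _ snoc.prems(1)])
       (use zc genideal_ideal[OF zc(3)] in \<open>auto simp: additive_subgroup.zero_closed ideal.axioms(1)\<close>)
  then have "power_bounded R I N (add_mult N P z) zs" using zc by simp
  moreover have "ext_vanish R r d N (add_mult N P z) (length zs)"
    by (rule ext_vanish_quotient[OF N snoc.prems(1) zc(1) z]) (use snoc.prems(4) in simp)
  ultimately have "reg_seq N (add_mult N P z) zs"
    by (intro snoc.IH[OF N.add_mult_submodule[OF snoc.prems(1) zc(1)] zc(4)])
  then have "reg_seq N P (z # zs)" using z by simp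
  moreover have "set (z # zs) \<subseteq> jacobson_radical R" using zc jac by auto
  ultimately show ?case using N.reg_seq_rotate[OF NM snoc.prems(1)] by blast
qed simp

lemma add_mults_neq_carrier:
  assumes N: "Module.module R N" and ne: "carrier N \<noteq> ideal_smult R I N" and ys: "set ys \<subseteq> I"
  shows "add_mults N {\<zero>\<^bsub>N\<^esub>} ys \<noteq> carrier N"
proof -
  interpret N: Module.module R N by fact
  interpret I: ideal I R by (rule I)
  have IN: "submodule (ideal_smult R I N) R N" 
    unfolding ideal_smult_eq by (rule N.ideal_sub_submodule[OF I.a_subset order_refl])
  have "add_mults N {\<zero>\<^bsub>N\<^esub>} ys \<subseteq> ideal_smult R I N"
    by (rule N.add_mults_minimal[OF IN]) 
       (use N.submodule_zero[OF IN] ys in \<open>auto simp: ideal_smult_eq intro: N.ideal_sub_mem\<close>)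
  then show ?thesis using ne N.submoduleE(1)[OF IN] by blast
qed

lemma regular_sequence_in_iff:
  assumes N: "Module.module R N" and ne: "carrier N \<noteq> ideal_smult R I N" and ys: "set ys \<subseteq> I"
  shows "regular_sequence R N ys \<longleftrightarrow> reg_seq N {\<zero>\<^bsub>N\<^esub>} ys"
proof -
  interpret N: Module.module R N by fact
  show ?thesis
    using N.regular_sequence_iff[of ys] add_mults_neq_carrier[OF N ne ys] ys ideal.Icarr[OF I] by blast
qed

lemma ext_vanish_regular_sequence:
  assumes N: "Module.module R N" and ys: "set ys \<subseteq> I" "reg_seq N {\<zero>\<^bsub>N\<^esub>} ys"
  shows "ext_vanish R r d N {\<zero>\<^bsub>N\<^esub>} (length ys)"
proof -
  interpret N: Module.module R N by fact
  have "\<exists>q::nat. y [^] q \<in> I" if "y \<in> set ys" for y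
    using that ys(1) ideal.Icarr[OF I] by (intro exI[of _ "1::nat"]) auto
  then show ?thesis
    using ext_vanish_reg_seq[OF N N.zero_submodule ys(2)] ys(1) ideal.Icarr[OF I] by blast
qed

text \<open>Were xs longer than the maximal sequence ys, Ext(R/I, N) would vanish through degree
  \<open>length ys\<close>. Dividing by ys leaves Hom(R/I, N/ys N) = 0, so I contains a
  nonzerodivisor on N/ys N and ys can be extended. Hence the set of lengths in the definition of
  \<open>grade\<close> is a singleton.\<close>

lemma grade_eq_length:
  assumes noeth: "noetherian_ring R" and N: "Module.module R N" and NM: "noetherian_module R N" 
    and ne: "carrier N \<noteq> ideal_smult R I N" and ys: "maximal_regular_sequence R I N ys"
  shows "grade R I N = length ys"
proof -
  interpret N: Module.module R N by fact
  have le: "length xs \<le> length ys" 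
    if xs: "maximal_regular_sequence R I N xs" and ys: "maximal_regular_sequence R I N ys" for xs ys
  proof (rule ccontr)
    assume "\<not> ?thesis"
    then have l: "length ys + Suc 0 \<le> length xs" by simp
    have xI: "set xs \<subseteq> I" and yI: "set ys \<subseteq> I" using xs ys by (auto simp: maximal_regular_sequence_def)
    have xr: "reg_seq N {\<zero>\<^bsub>N\<^esub>} xs" and yr: "reg_seq N {\<zero>\<^bsub>N\<^esub>} ys"
      using xs ys regular_sequence_in_iff[OF N ne] xI yI by (auto simp: maximal_regular_sequence_def)
    have yc: "set ys \<subseteq> carrier R" using yI ideal.Icarr[OF I] by blast
    have "ext_vanish R r d N {\<zero>\<^bsub>N\<^esub>} (length ys + Suc 0)"
      by (rule ext_vanish_mono[OF ext_vanish_regular_sequence[OF N xI xr] l])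
    then have "ext_vanish R r d N (add_mults N {\<zero>\<^bsub>N\<^esub>} ys) (Suc 0)"
      by (rule ext_vanish_add_mults[OF N N.zero_submodule yc yr])
    then obtain z where z: "z \<in> I" "nonzd N (add_mults N {\<zero>\<^bsub>N\<^esub>} ys) z"
      using ext_vanish_nonzd[OF noeth N NM N.add_mults_submodule[OF N.zero_submodule yc]] by blast
    then have "reg_seq N {\<zero>\<^bsub>N\<^esub>} (ys @ [z])" using yr by (simp add: reg_seq_append)
    then have "regular_sequence R N (ys @ [z])"
      using regular_sequence_in_iff[OF N ne, of "ys @ [z]"] yI z by simp
    then show False using ys z by (auto simp: maximal_regular_sequence_def)
  qed
  have "length ` {xs. maximal_regular_sequence R I N xs} = {length ys}"
    using le[OF _ ys] le[OF ys] ys by (auto intro!: le_antisym)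
  then show ?thesis unfolding grade_def by simp
qed

text \<open>N/ys N is nonzero and each element of I is nilpotent on it, so none can be a
  nonzerodivisor.\<close>

lemma not_ext_vanish_power_bounded:
  assumes noeth: "noetherian_ring R" and N: "Module.module R N" and NM: "noetherian_module R N" 
    and ne: "carrier N \<noteq> ideal_smult R I N" 
    and ys: "set ys \<subseteq> I" and z: "z \<in> I" "nonzd N (add_mults N {\<zero>\<^bsub>N\<^esub>} ys) z"
    and pb: "\<And>w. w \<in> I \<Longrightarrow> \<exists>k::nat. \<forall>v\<in>carrier N. w [^] k \<odot>\<^bsub>N\<^esub> v \<in> add_mults N {\<zero>\<^bsub>N\<^esub>} ys"
  shows False
proof -
  interpret N: Module.module R N by fact
  have yc: "set ys \<subseteq> carrier R" using ys ideal.Icarr[OF I] by blast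
  obtain k :: nat where k: "\<forall>v\<in>carrier N. z [^] k \<odot>\<^bsub>N\<^esub> v \<in> add_mults N {\<zero>\<^bsub>N\<^esub>} ys" using pb z by blast
  have "nonzd N (add_mults N {\<zero>\<^bsub>N\<^esub>} ys) (z [^] k)"
    by (rule N.nonzd_pow[OF ideal.Icarr[OF I z(1)] z(2)])
  then have "carrier N \<subseteq> add_mults N {\<zero>\<^bsub>N\<^esub>} ys" using k by (auto simp: nonzd_def)
  then show False 
    using add_mults_neq_carrier[OF N ne ys] N.submoduleE(1)[OF N.add_mults_submodule[OF N.zero_submodule yc]] 
    by blast
qed

text \<open>\<open>grade\<close> is a definite description, so a maximal regular sequence must first
  be exhibited. If Ext vanished through degree \<open>length xs\<close>, then xs would be regular
  and I would contain a nonzerodivisor on N/xs N, where elements of I act nilpotently. So lengths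
  are bounded, a longest sequence exists, and the grade gives it the length of xs; its Ext vanishing
  then makes xs regular.\<close>

lemma reg_seq_of_grade:
  assumes noeth: "noetherian_ring R" and N: "Module.module R N" and NM: "noetherian_module R N" 
    and jac: "I \<subseteq> jacobson_radical R" and ne: "carrier N \<noteq> ideal_smult R I N" 
    and xs: "set xs \<subseteq> I" and pb: "power_bounded R I N {\<zero>\<^bsub>N\<^esub>} xs" and gr: "grade R I N = length xs"
  shows "reg_seq N {\<zero>\<^bsub>N\<^esub>} xs"
proof -
  interpret N: Module.module R N by fact
  note zs = N.zero_submodule
  have xc: "set xs \<subseteq> carrier R" using xs ideal.Icarr[OF I] by blast
  have "\<not> ext_vanish R r d N {\<zero>\<^bsub>N\<^esub>} (length xs + Suc 0)"
  proof
    assume v: "ext_vanish R r d N {\<zero>\<^bsub>N\<^esub>} (length xs + Suc 0)"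
    then have reg: "reg_seq N {\<zero>\<^bsub>N\<^esub>} xs"
      using reg_seq_of_ext_vanish[OF noeth N NM jac zs xs pb] ext_vanish_mono[OF v] by simp
    obtain z where z: "z \<in> I" "nonzd N (add_mults N {\<zero>\<^bsub>N\<^esub>} xs) z"
      using ext_vanish_nonzd[OF noeth N NM N.add_mults_submodule[OF zs xc] ext_vanish_add_mults[OF N zs xc reg v]] 
      by blast
    show False
      by (rule not_ext_vanish_power_bounded[OF noeth N NM ne xs z N.power_bounded_add_mults[OF pb zs xc]])
  qed
  then have bound: "length ys \<le> length xs" if "set ys \<subseteq> I" "regular_sequence R N ys" for ys
    using ext_vanish_regular_sequence[OF N that(1)] regular_sequence_in_iff[OF N ne that(1)] that(2)
      ext_vanish_mono[of R r d N "{\<zero>\<^bsub>N\<^esub>}" "length ys" "length xs + Suc 0"] by fastforce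
  let ?P = "\<lambda>ys. set ys \<subseteq> I \<and> regular_sequence R N ys"
  have P0: "?P []" using regular_sequence_in_iff[OF N ne, of "[]"] by simp
  have Pb: "\<forall>zs. ?P zs \<longrightarrow> length zs < Suc (length xs)" using bound le_imp_less_Suc by blast
  have "\<exists>ys. ?P ys \<and> (\<forall>zs. ?P zs \<longrightarrow> length zs \<le> length ys)"
    by (rule ex_has_greatest_nat[of ?P, OF P0 Pb])
  then obtain ys where "?P ys \<and> (\<forall>zs. ?P zs \<longrightarrow> length zs \<le> length ys)" by (rule exE)
  then have ys: "?P ys" and longest: "\<And>zs. ?P zs \<Longrightarrow> length zs \<le> length ys" by simp_all
  have max: "maximal_regular_sequence R I N ys"
    unfolding maximal_regular_sequence_def
  proof (intro conjI ballI notI)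
    fix y assume "y \<in> I" "regular_sequence R N (ys @ [y])"
    then show False using longest[of "ys @ [y]"] ys by simp
  qed (use ys in auto)
  then have "length ys = length xs" using grade_eq_length[OF noeth N NM ne] gr by simp
  then have "ext_vanish R r d N {\<zero>\<^bsub>N\<^esub>} (length xs)"
    using ext_vanish_regular_sequence[OF N, of ys] ys regular_sequence_in_iff[OF N ne, of ys] by simp
  then show ?thesis by (rule reg_seq_of_ext_vanish[OF noeth N NM jac zs xs pb])
qed

lemma grade_eq_of_reg_seq:
  assumes noeth: "noetherian_ring R" and N: "Module.module R N" and NM: "noetherian_module R N" 
    and ne: "carrier N \<noteq> ideal_smult R I N" 
    and ys: "set ys \<subseteq> I" "reg_seq N {\<zero>\<^bsub>N\<^esub>} ys"
    and pb: "\<And>w. w \<in> I \<Longrightarrow> \<exists>k::nat. \<forall>v\<in>carrier N. w [^] k \<odot>\<^bsub>N\<^esub> v \<in> add_mults N {\<zero>\<^bsub>N\<^esub>} ys"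
  shows "grade R I N = length ys"
proof (rule grade_eq_length[OF noeth N NM ne])
  have "\<not> regular_sequence R N (ys @ [y])" if "y \<in> I" for y
    using not_ext_vanish_power_bounded[OF noeth N NM ne ys(1) that _ pb] that ys(1)
      regular_sequence_in_iff[OF N ne, of "ys @ [y]"] by (auto simp: reg_seq_append)
  then show "maximal_regular_sequence R I N ys"
    unfolding maximal_regular_sequence_def using regular_sequence_in_iff[OF N ne ys(1)] ys by blast
qed

end

section \<open>Existence of resolutions and lifts\<close>

lemma module_homs_lin_map: "f \<in> module_homs R P M \<Longrightarrow> lin_map R P M f"
  by (auto simp: module_homs_def lin_map_def)

lemma restrict_module_homs:
  assumes "Module.module R P" "lin_map R P M f"
  shows "restrict f (carrier P) \<in> module_homs R P M"
proof -
  interpret P: Module.module R P by fact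
  show ?thesis using assms(2) by (auto simp: module_homs_def lin_map_def)
qed

lemma module_homs_eqI:
  assumes "f \<in> module_homs R P M" "g \<in> module_homs R P M" "\<And>x. x \<in> carrier P \<Longrightarrow> f x = g x"
  shows "f = g"
  using assms PiE_ext[of f "carrier P" "\<lambda>_. carrier M" g] by (auto simp: module_homs_def)

lemma hom_kernel_submodule:
  assumes "Module.module R P" "Module.module R M" "lin_map R P M f"
  shows "submodule (hom_kernel P M f) R P"
  using vimage_submodule[OF assms module.zero_submodule[OF assms(2)]] by (simp add: hom_kernel_def)

lemma (in cring) submodule_cover:
  assumes noeth: "noetherian_ring R" and H: "submodule H R (free_module R b)"
  shows "\<exists>c \<delta>. \<delta> \<in> module_homs R (free_module R c) (free_module R b) \<and> \<delta> ` carrier (free_module R c) = H"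
proof -
  interpret F: Module.module R "free_module R b" by (rule free_module)
  obtain S where S: "finite S" "S \<subseteq> H" "gen_submodule R (free_module R b) S = H"
    using free_module_noetherian[OF noeth, of b, unfolded noetherian_module_def, rule_format, OF H] by blast
  then have "S \<subseteq> carrier (free_module R b)" using F.submoduleE(1)[OF H] by blast
  from F.finite_generators_surj[OF S(1) this] obtain c \<delta> where
    "lin_map R (free_module R c) (free_module R b) \<delta>" "\<delta> ` carrier (free_module R c) = H"
    unfolding S(3) by blast
  then show ?thesis using restrict_module_homs[OF free_module] 
    by (intro exI[of _ c] exI[of _ "restrict \<delta> (carrier (free_module R c))"]) auto
qed

lemma (in cring) free_resolution_exists:
  assumes noeth: "noetherian_ring R" and N: "fin_gen_module R N"
  shows "\<exists>r d e. free_resolution R N r d e"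
proof -
  interpret N: Module.module R N using N by (simp add: fin_gen_module_def)
  obtain S where S: "finite S" "S \<subseteq> carrier N" "gen_submodule R N S = carrier N"
    using N by (auto simp: fin_gen_module_def)
  let ?F = "free_module R"
  obtain b0 e0 where e0: "lin_map R (?F b0) N e0" "e0 ` carrier (?F b0) = carrier N"
    using N.finite_generators_surj[OF S(1,2)] unfolding S(3) by blast
  define e where "e = restrict e0 (carrier (?F b0))"
  have e: "e \<in> module_homs R (?F b0) N" "e ` carrier (?F b0) = carrier N"
    using restrict_module_homs[OF free_module e0(1)] e0(2) by (auto simp: e_def)
  \<comment> \<open>A state s = (b, c, \<delta>) is a map \<delta> from R^c to R^b. In degree 0,
    \<delta> has to cover the kernel of the augmentation; \<open>?Q\<close> asks that the next map
    cover the kernel of the present one.\<close>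
  let ?P = "\<lambda>i s. snd (snd s) \<in> module_homs R (?F (fst (snd s))) (?F (fst s)) \<and>
     (i = 0 \<longrightarrow> fst s = b0 \<and> snd (snd s) ` carrier (?F (fst (snd s))) = hom_kernel (?F b0) N e)"
  let ?Q = "\<lambda>i::nat. \<lambda>s s'. fst s' = fst (snd s) \<and> hom_kernel (?F (fst (snd s))) (?F (fst s)) (snd (snd s)) =
      snd (snd s') ` carrier (?F (fst (snd s')))"
  have "\<exists>s. \<forall>i. ?P i (s i) \<and> ?Q i (s i) (s (Suc i))"
  proof (rule dependent_nat_choice)
    obtain c \<delta> where "\<delta> \<in> module_homs R (?F c) (?F b0)" "\<delta> ` carrier (?F c) = hom_kernel (?F b0) N e"
      using submodule_cover[OF noeth hom_kernel_submodule[OF free_module N.module_axioms module_homs_lin_map[OF e(1)]]]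
      by blast
    then show "\<exists>s. ?P 0 s" by (intro exI[of _ "(b0, c, \<delta>)"]) simp
  next
    fix s and i :: nat assume s: "?P i s"
    then have "snd (snd s) \<in> module_homs R (?F (fst (snd s))) (?F (fst s))" by simp
    from submodule_cover[OF noeth hom_kernel_submodule[OF free_module free_module module_homs_lin_map[OF this]]]
    obtain c \<delta> where \<delta>: "\<delta> \<in> module_homs R (?F c) (?F (fst (snd s)))" 
      "\<delta> ` carrier (?F c) = hom_kernel (?F (fst (snd s))) (?F (fst s)) (snd (snd s))" by blast
    have "?P (Suc i) (fst (snd s), c, \<delta>) \<and> ?Q i s (fst (snd s), c, \<delta>)" 
      using \<delta>(1) by (simp add: \<delta>(2))
    then show "\<exists>s'. ?P (Suc i) s' \<and> ?Q i s s'" by (rule exI)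
  qed
  then obtain s where "\<forall>i. ?P i (s i) \<and> ?Q i (s i) (s (Suc i))" by (rule exE)
  then have s: "\<And>i. ?P i (s i)" "\<And>i. ?Q i (s i) (s (Suc i))" by metis+
  have "free_resolution R N (\<lambda>i. fst (s i)) (\<lambda>i. snd (snd (s i))) e"
    unfolding free_resolution_def Let_def using e s(1) s(1)[of 0] s(2) by auto
  then show ?thesis by blast
qed

lemma (in cring) chain_lift_exists:
  assumes N: "Module.module R N" and N': "Module.module R N'" and h: "lin_map R N N' h"
    and res: "free_resolution R N r d e" and res': "free_resolution R N' r' d' e'"
  shows "\<exists>\<phi>. (\<forall>i. \<phi> i \<in> module_homs R (free_module R (r i)) (free_module R (r' i))) \<and>
     (\<forall>x\<in>carrier (free_module R (r 0)). e' (\<phi> 0 x) = h (e x)) \<and>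
     (\<forall>i. \<forall>x\<in>carrier (free_module R (r (Suc i))). d' i (\<phi> (Suc i) x) = \<phi> i (d i x))"
proof -
  let ?F = "\<lambda>i. free_module R (r i)" and ?F' = "\<lambda>i. free_module R (r' i)"
  have e: "lin_map R (?F 0) N e" and d: "lin_map R (?F (Suc i)) (?F i) (d i)" 
    and e': "lin_map R (?F' 0) N' e'" and d': "lin_map R (?F' (Suc i)) (?F' i) (d' i)" for i
    using res res' by (auto simp: free_resolution_def Let_def intro: module_homs_lin_map)
  have lift: "\<exists>g. g \<in> module_homs R (?F i) A \<and> (\<forall>x\<in>carrier (?F i). k (g x) = f x)"
    if A: "Module.module R A" and B: "Module.module R B" and f: "lin_map R (?F i) B f" and k: "lin_map R A B k"
      and ex: "\<And>x. x \<in> carrier (?F i) \<Longrightarrow> f x \<in> k ` carrier A" 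
    for A :: "('a, nat \<Rightarrow> 'a) module" and B :: "('a, 'x, 'y) module_scheme" and f k i
  proof -
    interpret B: Module.module R B by fact
    have "\<exists>y\<in>carrier A. eqmod B {\<zero>\<^bsub>B\<^esub>} (f x) (k y)" if "x \<in> carrier (?F i)" for x
      using ex[OF that] B.eqmod_refl[OF B.zero_submodule lin_map_closed[OF f that]] by force
    then obtain g where g: "lin_map R (?F i) A g" "\<And>x. x \<in> carrier (?F i) \<Longrightarrow> eqmod B {\<zero>\<^bsub>B\<^esub>} (f x) (k (g x))"
      using free_module_lift[OF A B f k B.zero_submodule] by blast
    have "k (g x) = f x" if "x \<in> carrier (?F i)" for x
      using g(2)[OF that] B.eqmod_alt[OF B.zero_submodule] by auto
    then show ?thesis using restrict_module_homs[OF free_module g(1)] 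
      by (intro exI[of _ "restrict g (carrier (?F i))"]) auto
  qed
  \<comment> \<open>The middle clause keeps the induction going: fd lands in the image of d', which
    is what the next lift through d' requires.\<close>
  let ?P = "\<lambda>i f. f \<in> module_homs R (?F i) (?F' i) \<and> 
      (\<forall>x\<in>carrier (?F (Suc i)). f (d i x) \<in> d' i ` carrier (?F' (Suc i))) \<and>
      (i = 0 \<longrightarrow> (\<forall>x\<in>carrier (?F 0). e' (f x) = h (e x)))"
  let ?Q = "\<lambda>i f g. \<forall>x\<in>carrier (?F (Suc i)). d' i (g x) = f (d i x)"
  have "\<exists>\<phi>. \<forall>i. ?P i (\<phi> i) \<and> ?Q i (\<phi> i) (\<phi> (Suc i))"
  proof (rule dependent_nat_choice)
    have "e' ` carrier (?F' 0) = carrier N'" using res' by (simp add: free_resolution_def Let_def)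
    then obtain g where g: "g \<in> module_homs R (?F 0) (?F' 0)" "\<forall>x\<in>carrier (?F 0). e' (g x) = h (e x)"
      using lift[OF free_module N' lin_map_comp[OF e h] e'] lin_map_closed[OF lin_map_comp[OF e h]] by blast
    have "g (d 0 x) \<in> d' 0 ` carrier (?F' 1)" if x: "x \<in> carrier (?F 1)" for x
    proof -
      have dx: "d 0 x \<in> carrier (?F 0)" using lin_map_closed[OF d] x by simp
      have "d 0 x \<in> hom_kernel (?F 0) N e" using res x by (simp add: free_resolution_def Let_def)
      then have "e' (g (d 0 x)) = \<zero>\<^bsub>N'\<^esub>" 
        using g(2) dx lin_map_zero[OF N N' h] by (simp add: hom_kernel_def)
      then have "g (d 0 x) \<in> hom_kernel (?F' 0) N' e'"
        using lin_map_closed[OF module_homs_lin_map[OF g(1)] dx] by (simp add: hom_kernel_def)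
      then show ?thesis using res' by (simp add: free_resolution_def Let_def)
    qed
    then show "\<exists>f. ?P 0 f" using g by auto
  next
    fix f i assume f: "?P i f"
    then have fl: "lin_map R (?F i) (?F' i) f" using module_homs_lin_map by blast
    from f obtain g where g: "g \<in> module_homs R (?F (Suc i)) (?F' (Suc i))" 
      "\<forall>x\<in>carrier (?F (Suc i)). d' i (g x) = f (d i x)"
      using lift[OF free_module free_module lin_map_comp[OF d fl] d'] by blast
    have "g (d (Suc i) x) \<in> d' (Suc i) ` carrier (?F' (Suc (Suc i)))" if x: "x \<in> carrier (?F (Suc (Suc i)))" for x
    proof -
      have dx: "d (Suc i) x \<in> carrier (?F (Suc i))" using lin_map_closed[OF d x] .
      have "d (Suc i) x \<in> hom_kernel (?F (Suc i)) (?F i) (d i)" 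
        using res x by (simp add: free_resolution_def Let_def)
      then have "d' i (g (d (Suc i) x)) = \<zero>\<^bsub>?F' i\<^esub>" 
        using g(2) dx f lin_map_zero[OF free_module free_module fl] by (simp add: hom_kernel_def)
      then have "g (d (Suc i) x) \<in> hom_kernel (?F' (Suc i)) (?F' i) (d' i)"
        using lin_map_closed[OF module_homs_lin_map[OF g(1)] dx] by (simp add: hom_kernel_def)
      then show ?thesis using res' by (simp add: free_resolution_def Let_def)
    qed
    then show "\<exists>g. ?P (Suc i) g \<and> ?Q i f g" using g by auto
  qed
  then show ?thesis by (rule ex_forward) (intro conjI allI ballI; simp)
qed

section \<open>The tower of resolutions defining local cohomology\<close>

lemma self_module_simps:
  "carrier (self_module R) = carrier R" "\<zero>\<^bsub>self_module R\<^esub> = \<zero>\<^bsub>R\<^esub>"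
  "x \<oplus>\<^bsub>self_module R\<^esub> y = x \<oplus>\<^bsub>R\<^esub> y" "r \<odot>\<^bsub>self_module R\<^esub> x = r \<otimes>\<^bsub>R\<^esub> x"
  "x \<ominus>\<^bsub>self_module R\<^esub> y = x \<ominus>\<^bsub>R\<^esub> y"
  "H +>\<^bsub>self_module R\<^esub> x = H +>\<^bsub>R\<^esub> x"
  by (simp_all add: self_module_def a_minus_def a_inv_def m_inv_def a_r_coset_def')

lemma resolution_free_resolution:
  assumes "\<exists>r d e. free_resolution R N r d e"
  shows "free_resolution R N (fst (resolution R N)) (res_diff R N) (res_aug R N)"
proof -
  have "\<exists>x. (\<lambda>(r, d, e). free_resolution R N r d e) x" using assms by auto
  from someI_ex[OF this] show ?thesis 
    unfolding resolution_def[symmetric] by (simp add: res_diff_def res_aug_def case_prod_beta)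
qed

text \<open>Ties the tower to the very resolutions and lifts that \<open>SOME\<close> selects in the
  definition of local cohomology, so no independence of choices has to be established.\<close>

locale canonical_tower = resolution_tower +
  assumes r_eq: "\<And>n. r n = fst (resolution R (power_quotient R \<aa> n))"
    and d_eq: "\<And>n. d n = res_diff R (power_quotient R \<aa> n)"
    and \<phi>_eq: "\<And>n. \<phi> n = lift R (power_quotient R \<aa> (Suc n)) (power_quotient R \<aa> n) (power_proj R \<aa> n)"

lemma canonical_tower_exists:
  fixes R (structure)
  assumes "cring R" and noeth: "noetherian_ring R" and a: "ideal \<aa> R"
  shows "\<exists>r d \<rho> \<phi>. canonical_tower R \<aa> r d \<rho> \<phi>"
proof -
  interpret cring R by fact
  interpret S: Module.module R "self_module R" by (rule self_module) (rule is_cring)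
  let ?A = "\<lambda>n. ideal_pow R \<aa> n" and ?Q = "power_quotient R \<aa>"
  define q where "q n x = ?A n +> x" for n x
  have A: "ideal (?A n) R" for n by (rule ideal_pow_ideal[OF a])
  have As: "submodule (?A n) R (self_module R)" for n 
    using A submodule_self_iff_ideal[OF is_cring] by blast
  have Q: "Module.module R (?Q n)" for n unfolding power_quotient_def by (rule S.quotient_module[OF As])
  have q: "lin_map R (self_module R) (?Q n) (q n)" for n
    using S.quotient_proj[OF As, of n] by (simp add: power_quotient_def q_def[abs_def] self_module_simps)
  have q_surj: "carrier (?Q n) = q n ` carrier R" for n
    using S.quotient_carrier[OF As, of n] by (simp add: power_quotient_def q_def[abs_def] self_module_simps)
  have q_zero: "q n x = \<zero>\<^bsub>?Q n\<^esub> \<longleftrightarrow> x \<in> ?A n" if "x \<in> carrier R" for n x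
    using S.quotient_proj_zero_iff[OF As, of x n] that by (simp add: power_quotient_def q_def self_module_simps)
  have q_eq: "q n x = q n y \<longleftrightarrow> x \<ominus> y \<in> ?A n" if "x \<in> carrier R" "y \<in> carrier R" for n x y
    using S.a_rcoset_eq_iff[OF As, of x y n] that by (simp add: eqmod_def q_def self_module_simps)
  \<comment> \<open>Generated by the class of 1; finite generation is what makes the choice in
    \<open>resolution\<close> an actual free resolution.\<close>
  have fg: "fin_gen_module R (?Q n)" for n
  proof -
    interpret Qn: Module.module R "?Q n" by (rule Q)
    have one: "q n \<one> \<in> carrier (?Q n)" using q_surj by auto
    then have G: "submodule (gen_submodule R (?Q n) {q n \<one>}) R (?Q n)" by (intro Qn.gen_submodule) auto
    have "q n x \<in> gen_submodule R (?Q n) {q n \<one>}" if x: "x \<in> carrier R" for x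
    proof -
      have "q n x = x \<odot>\<^bsub>?Q n\<^esub> q n \<one>"
        using lin_map_smult_comm[OF q x, of \<one> n] x by (simp add: self_module_simps)
      then show ?thesis 
        using Qn.submoduleE(4)[OF G x] Qn.gen_submodule_superset[of "{q n \<one>}"] by auto
    qed
    then have "gen_submodule R (?Q n) {q n \<one>} = carrier (?Q n)"
      using Qn.submoduleE(1)[OF G] q_surj by auto
    then show ?thesis unfolding fin_gen_module_def using Q one by (intro conjI exI[of _ "{q n \<one>}"]) auto
  qed
  define r where "r n = fst (resolution R (?Q n))" for n
  define d where "d n = res_diff R (?Q n)" for n
  define e where "e n = res_aug R (?Q n)" for n
  define \<phi> where "\<phi> n = lift R (?Q (Suc n)) (?Q n) (power_proj R \<aa> n)" for n
  let ?F = "\<lambda>n i. free_module R (r n i)"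
  have fr: "free_resolution R (?Q n) (r n) (d n) (e n)" for n
    unfolding r_def d_def e_def
    by (rule resolution_free_resolution[OF free_resolution_exists[OF noeth fg]])
  have el: "lin_map R (?F n 0) (?Q n) (e n)" and dl: "lin_map R (?F n (Suc i)) (?F n i) (d n i)" for n i
    using fr[of n] by (auto simp: free_resolution_def Let_def intro: module_homs_lin_map)
  \<comment> \<open>The chosen augmentation e has values in R/\<aa>^n; projectivity lifts it to a
    map \<rho> into R, as \<open>cyclic_resolution\<close> requires.\<close>
  have "\<exists>\<rho>. lin_map R (?F n 0) (self_module R) \<rho> \<and> (\<forall>x\<in>carrier (?F n 0). e n x = q n (\<rho> x))" for n
  proof -
    interpret Qn: Module.module R "?Q n" by (rule Q)
    have "\<exists>y\<in>carrier (self_module R). eqmod (?Q n) {\<zero>\<^bsub>?Q n\<^esub>} (e n x) (q n y)" if "x \<in> carrier (?F n 0)" for x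
      using lin_map_closed[OF el that] Qn.eqmod_refl[OF Qn.zero_submodule] unfolding q_surj self_module_simps 
      by force
    then obtain g where g: "lin_map R (?F n 0) (self_module R) g" 
      "\<And>x. x \<in> carrier (?F n 0) \<Longrightarrow> eqmod (?Q n) {\<zero>\<^bsub>?Q n\<^esub>} (e n x) (q n (g x))"
      using free_module_lift[OF S.module_axioms Q el q Qn.zero_submodule] by blast
    then show ?thesis using Qn.eqmod_alt[OF Qn.zero_submodule] by auto
  qed
  then obtain \<rho> where \<rho>: "\<And>n. lin_map R (?F n 0) (self_module R) (\<rho> n)" 
     "\<And>n x. x \<in> carrier (?F n 0) \<Longrightarrow> e n x = q n (\<rho> n x)" by metis
  have \<rho>c: "\<rho> n x \<in> carrier R" if "x \<in> carrier (?F n 0)" for n x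
    using lin_map_closed[OF \<rho>(1) that] by (simp add: self_module_simps)
  have cres: "cyclic_resolution R (?A n) (r n) (d n) (\<rho> n)" for n
  proof (intro cyclic_resolution.intro cyclic_resolution_axioms.intro is_cring A dl \<rho>(1))
    fix x assume x: "x \<in> carrier (?F n 0)"
    have "\<rho> n x \<in> ?A n \<longleftrightarrow> x \<in> hom_kernel (?F n 0) (?Q n) (e n)"
      using q_zero[OF \<rho>c[OF x], of n] \<rho>(2)[OF x] x by (simp add: hom_kernel_def)
    also have "\<dots> \<longleftrightarrow> x \<in> d n 0 ` carrier (?F n 1)" using fr[of n] by (simp add: free_resolution_def Let_def)
    finally show "\<rho> n x \<in> ?A n \<longleftrightarrow> (\<exists>y\<in>carrier (?F n (Suc 0)). x = d n 0 y)" by auto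
  next
    fix i x assume x: "x \<in> carrier (?F n (Suc i))"
    have "d n i x = \<zero>\<^bsub>?F n i\<^esub> \<longleftrightarrow> x \<in> hom_kernel (?F n (Suc i)) (?F n i) (d n i)" 
      using x by (simp add: hom_kernel_def)
    also have "\<dots> \<longleftrightarrow> x \<in> d n (Suc i) ` carrier (?F n (Suc (Suc i)))" 
      using fr[of n] by (simp add: free_resolution_def Let_def)
    finally show "d n i x = \<zero>\<^bsub>?F n i\<^esub> \<longleftrightarrow> (\<exists>y\<in>carrier (?F n (Suc (Suc i))). x = d n (Suc i) y)" by auto
  next
    have "q n \<one> \<in> e n ` carrier (?F n 0)" 
      using fr[of n] q_surj[of n] by (simp add: free_resolution_def Let_def)
    then obtain t where t: "t \<in> carrier (?F n 0)" "e n t = q n \<one>" by auto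
    then show "\<exists>t\<in>carrier (?F n 0). \<rho> n t \<ominus> \<one> \<in> ?A n"
      using q_eq[of "\<rho> n t" \<one> n] \<rho>(2) \<rho>c by auto
  qed
  \<comment> \<open>Since \<aa>^(n+1) \<subseteq> \<aa>^n, the union over representatives of the
    class of x is again a single coset.\<close>
  have pp: "power_proj R \<aa> n (q (Suc n) x) = q n x" if x: "x \<in> carrier R" for n x
  proof -
    have "(\<Union>y\<in>?A (Suc n) +>\<^bsub>self_module R\<^esub> x. ?A n +>\<^bsub>self_module R\<^esub> y) = ?A n +>\<^bsub>self_module R\<^esub> x"
      by (rule S.UN_a_rcoset[OF As As S.module_axioms])
         (use x ideal_pow_antimono[OF a, of n 1] in \<open>auto simp: eqmod_def self_module_simps\<close>)
    then show ?thesis by (simp add: power_proj_def q_def self_module_simps)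
  qed
  have ppl: "lin_map R (?Q (Suc n)) (?Q n) (power_proj R \<aa> n)" for n
    unfolding lin_map_def q_surj
  proof (intro conjI ballI)
    fix X Y assume "X \<in> q (Suc n) ` carrier R" "Y \<in> q (Suc n) ` carrier R"
    then obtain x y where xy: "x \<in> carrier R" "X = q (Suc n) x" "y \<in> carrier R" "Y = q (Suc n) y" by auto
    show "power_proj R \<aa> n X \<in> q n ` carrier R" using xy pp by auto
    have "X \<oplus>\<^bsub>?Q (Suc n)\<^esub> Y = q (Suc n) (x \<oplus> y)" 
      using lin_map_add[OF q, of x y "Suc n"] xy by (simp add: self_module_simps)
    then show "power_proj R \<aa> n (X \<oplus>\<^bsub>?Q (Suc n)\<^esub> Y) = power_proj R \<aa> n X \<oplus>\<^bsub>?Q n\<^esub> power_proj R \<aa> n Y"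
      using lin_map_add[OF q, of x y n] xy pp by (simp add: self_module_simps)
  next
    fix s X assume s: "s \<in> carrier R" and "X \<in> q (Suc n) ` carrier R"
    then obtain x where x: "x \<in> carrier R" "X = q (Suc n) x" by auto
    have "s \<odot>\<^bsub>?Q (Suc n)\<^esub> X = q (Suc n) (s \<otimes> x)" 
      using lin_map_smult_comm[OF q s, of x "Suc n"] x by (simp add: self_module_simps)
    then show "power_proj R \<aa> n (s \<odot>\<^bsub>?Q (Suc n)\<^esub> X) = s \<odot>\<^bsub>?Q n\<^esub> power_proj R \<aa> n X"
      using lin_map_smult_comm[OF q s, of x n] x s pp by (simp add: self_module_simps)
  qed
  have lift: "is_lift R (?Q (Suc n)) (?Q n) (power_proj R \<aa> n) (\<phi> n)" for n
    unfolding \<phi>_def lift_def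
  proof (rule someI_ex[of "is_lift R (?Q (Suc n)) (?Q n) (power_proj R \<aa> n)" for n])
    show "\<exists>\<phi>. is_lift R (?Q (Suc n)) (?Q n) (power_proj R \<aa> n) \<phi>" for n
      using chain_lift_exists[OF Q Q ppl fr fr] 
      by (simp add: is_lift_def res_module_def r_def d_def e_def)
  qed
  have \<phi>h: "\<phi> n i \<in> module_homs R (?F (Suc n) i) (?F n i)" for n i
    using lift[of n] by (simp add: is_lift_def res_module_def r_def)
  have \<phi>e: "e n (\<phi> n 0 x) = power_proj R \<aa> n (e (Suc n) x)" if "x \<in> carrier (?F (Suc n) 0)" for n x
    using lift[of n] that by (simp add: is_lift_def res_module_def r_def e_def)
  have \<phi>d: "d n i (\<phi> n (Suc i) x) = \<phi> n i (d (Suc n) i x)" if "x \<in> carrier (?F (Suc n) (Suc i))" for n i x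
    using lift[of n] that by (simp add: is_lift_def res_module_def r_def d_def)
  have "canonical_tower R \<aa> r d \<rho> \<phi>"
  proof (intro canonical_tower.intro resolution_tower.intro resolution_tower_axioms.intro 
      canonical_tower_axioms.intro is_cring a cres r_def d_def \<phi>_def)
    show "chain_map R (r (Suc n)) (d (Suc n)) (r n) (d n) (\<phi> n)" for n
      unfolding chain_map_def using module_homs_lin_map[OF \<phi>h] \<phi>d by blast
    fix n x assume x: "x \<in> carrier (?F (Suc n) 0)"
    have \<phi>x: "\<phi> n 0 x \<in> carrier (?F n 0)" using lin_map_closed[OF module_homs_lin_map[OF \<phi>h] x] .
    have "e n (\<phi> n 0 x) = power_proj R \<aa> n (e (Suc n) x)" by (rule \<phi>e[OF x])
    then have "q n (\<rho> n (\<phi> n 0 x)) = q n (\<rho> (Suc n) x)"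
      using \<rho>(2)[OF x] \<rho>(2)[OF \<phi>x] pp[OF \<rho>c[OF x]] by simp
    then show "\<rho> n (\<phi> n 0 x) \<ominus> \<rho> (Suc n) x \<in> ?A n"
      using q_eq \<rho>c[OF x] \<rho>c[OF \<phi>x] by simp
  qed
  then show ?thesis by blast
qed

section \<open>Local cohomology in terms of cocycles\<close>

lemma Hom_module:
  assumes P: "Module.module R P" and M: "Module.module R M"
  shows "Module.module R (Hom_module R P M)"
proof -
  interpret P: Module.module R P by fact
  interpret M: Module.module R M by fact
  let ?H = "Hom_module R P M"
  have c: "carrier ?H = module_homs R P M" by (simp add: Hom_module_def)
  have add: "f \<oplus>\<^bsub>?H\<^esub> g \<in> module_homs R P M" if "f \<in> module_homs R P M" "g \<in> module_homs R P M" for f g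
    using restrict_module_homs[OF P lin_map_plus[OF P M module_homs_lin_map[OF that(1)] module_homs_lin_map[OF that(2)]]]
    by (simp add: Hom_module_def)
  have smult: "r \<odot>\<^bsub>?H\<^esub> f \<in> module_homs R P M" if "f \<in> module_homs R P M" "r \<in> carrier R" for r f
    using restrict_module_homs[OF P lin_map_scale[OF P M module_homs_lin_map[OF that(1)] that(2)]]
    by (simp add: Hom_module_def)
  have zero: "\<zero>\<^bsub>?H\<^esub> \<in> module_homs R P M"
  proof -
    have "lin_map R P M (\<lambda>x. \<zero>\<^bsub>M\<^esub>)" by (simp add: lin_map_def)
    then show ?thesis using restrict_module_homs[OF P] by (simp add: Hom_module_def)
  qed
  have app: "(f \<oplus>\<^bsub>?H\<^esub> g) x = f x \<oplus>\<^bsub>M\<^esub> g x" "(r \<odot>\<^bsub>?H\<^esub> f) x = r \<odot>\<^bsub>M\<^esub> f x" "\<zero>\<^bsub>?H\<^esub> x = \<zero>\<^bsub>M\<^esub>"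
    if "x \<in> carrier P" for f g r x using that by (simp_all add: Hom_module_def)
  have cl: "f x \<in> carrier M" if "f \<in> module_homs R P M" "x \<in> carrier P" for f x
    using lin_map_closed[OF module_homs_lin_map[OF that(1)] that(2)] .
  show ?thesis
  proof (rule moduleI[OF P.R.is_cring])
    show "abelian_group ?H"
    proof (rule abelian_groupI, unfold c)
      fix f assume f: "f \<in> module_homs R P M"
      have m: "(\<ominus>\<^bsub>R\<^esub> \<one>\<^bsub>R\<^esub>) \<odot>\<^bsub>?H\<^esub> f \<in> module_homs R P M" by (rule smult[OF f]) simp
      have "((\<ominus>\<^bsub>R\<^esub> \<one>\<^bsub>R\<^esub>) \<odot>\<^bsub>?H\<^esub> f) \<oplus>\<^bsub>?H\<^esub> f = \<zero>\<^bsub>?H\<^esub>"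
        by (rule module_homs_eqI[OF add[OF m f] zero]) (simp add: app cl[OF f] M.smult_l_minus M.M.l_neg)
      then show "\<exists>g\<in>module_homs R P M. g \<oplus>\<^bsub>?H\<^esub> f = \<zero>\<^bsub>?H\<^esub>" using m by blast
      show "\<zero>\<^bsub>?H\<^esub> \<oplus>\<^bsub>?H\<^esub> f = f"
        by (rule module_homs_eqI[OF add[OF zero f] f]) (simp add: app cl[OF f])
      fix g assume g: "g \<in> module_homs R P M"
      show "f \<oplus>\<^bsub>?H\<^esub> g \<in> module_homs R P M" by (rule add[OF f g])
      show "f \<oplus>\<^bsub>?H\<^esub> g = g \<oplus>\<^bsub>?H\<^esub> f"
        by (rule module_homs_eqI[OF add[OF f g] add[OF g f]]) (simp add: app cl f g M.M.a_comm)
      fix h assume h: "h \<in> module_homs R P M"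
      show "f \<oplus>\<^bsub>?H\<^esub> g \<oplus>\<^bsub>?H\<^esub> h = f \<oplus>\<^bsub>?H\<^esub> (g \<oplus>\<^bsub>?H\<^esub> h)"
        by (rule module_homs_eqI[OF add[OF add[OF f g] h] add[OF f add[OF g h]]]) 
           (simp add: app cl f g h M.M.a_assoc)
    qed (rule zero)
  next
    fix a b f g assume a: "a \<in> carrier R" and b: "b \<in> carrier R" and fg: "f \<in> carrier ?H" "g \<in> carrier ?H"
    then have f: "f \<in> module_homs R P M" and g: "g \<in> module_homs R P M" by (simp_all add: c)
    show "a \<odot>\<^bsub>?H\<^esub> f \<in> carrier ?H" unfolding c by (rule smult[OF f a])
    show "(a \<oplus>\<^bsub>R\<^esub> b) \<odot>\<^bsub>?H\<^esub> f = a \<odot>\<^bsub>?H\<^esub> f \<oplus>\<^bsub>?H\<^esub> b \<odot>\<^bsub>?H\<^esub> f"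
      by (rule module_homs_eqI[OF smult[OF f P.R.a_closed[OF a b]] add[OF smult[OF f a] smult[OF f b]]])
         (simp add: app cl f a b M.smult_l_distr)
    show "a \<odot>\<^bsub>?H\<^esub> (f \<oplus>\<^bsub>?H\<^esub> g) = a \<odot>\<^bsub>?H\<^esub> f \<oplus>\<^bsub>?H\<^esub> a \<odot>\<^bsub>?H\<^esub> g"
      by (rule module_homs_eqI[OF smult[OF add[OF f g] a] add[OF smult[OF f a] smult[OF g a]]])
         (simp add: app cl f g a M.smult_r_distr)
    show "(a \<otimes>\<^bsub>R\<^esub> b) \<odot>\<^bsub>?H\<^esub> f = a \<odot>\<^bsub>?H\<^esub> (b \<odot>\<^bsub>?H\<^esub> f)"
      by (rule module_homs_eqI[OF smult[OF f P.R.m_closed[OF a b]] smult[OF smult[OF f b] a]])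
         (simp add: app cl f a b M.smult_assoc1)
  next
    fix f assume "f \<in> carrier ?H"
    then have f: "f \<in> module_homs R P M" by (simp add: c)
    show "\<one>\<^bsub>R\<^esub> \<odot>\<^bsub>?H\<^esub> f = f"
      by (rule module_homs_eqI[OF smult[OF f P.R.one_closed] f]) (simp add: app cl[OF f])
  qed
qed

lemma compose_lin_map:
  assumes P: "Module.module R P" and \<delta>: "lin_map R P P' \<delta>"
  shows "lin_map R (Hom_module R P' M) (Hom_module R P M) (\<lambda>g. compose (carrier P) g \<delta>)"
proof -
  have "compose (carrier P) g \<delta> \<in> module_homs R P M" if "g \<in> module_homs R P' M" for g
    using restrict_module_homs[OF P lin_map_comp[OF \<delta> module_homs_lin_map[OF that]]] 
    by (simp add: compose_def)
  then show ?thesis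
    using lin_map_closed[OF \<delta>] by (auto simp: lin_map_def Hom_module_def compose_def intro!: restrict_ext)
qed

section \<open>Ext and its transition maps in terms of cocycles\<close>

context canonical_tower
begin

lemma res_module_eq: "res_module R (power_quotient R \<aa> n) i = F n i"
  by (simp add: res_module_def r_eq)

context
  fixes N :: "('a, 'c, 'n) module_scheme"
  assumes N: "Module.module R N"
begin

interpretation N: Module.module R N by (rule N)

abbreviation "Hom n i \<equiv> Hom_module R (F n i) N"

abbreviation "E n i \<equiv> Ext R i (power_quotient R \<aa> n) N"

abbreviation "Z n i \<equiv> Ext_cocycles R i (power_quotient R \<aa> n) N"

abbreviation "B n i \<equiv> Ext_coboundaries R i (power_quotient R \<aa> n) N"

lemma Hom: "Module.module R (Hom n i)"
  by (rule Hom_module[OF F N])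

lemma Hom_carrier: "carrier (Hom n i) = module_homs R (F n i) N"
  by (simp add: Hom_module_def)

lemma zero_in_homs: "\<zero>\<^bsub>Hom n i\<^esub> \<in> module_homs R (F n i) N"
  using module.submodule_zero[OF Hom module.carrier_is_submodule[OF Hom]] by (simp add: Hom_carrier)

lemma eqmod_zero: "eqmod N {\<zero>\<^bsub>N\<^esub>} x y \<longleftrightarrow> x \<in> carrier N \<and> x = y"
  using N.eqmod_alt[OF N.zero_submodule, of x y] by auto

lemma cocycles_eq: "Z n i = {f \<in> module_homs R (F n i) N. cocycle R (r n) (d n) N {\<zero>\<^bsub>N\<^esub>} i f}"
  unfolding Ext_cocycles_def cocycle_def res_module_eq d_eq[symmetric]
  by (auto intro: module_homs_lin_map)

text \<open>In the definition of Ext a positive-degree coboundary is an extensional composite with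
  an extensional homomorphism, whereas \<open>coboundary\<close> admits any linear u; restricting u
  to its domain reconciles the two.\<close>

lemma coboundaries_eq: "B n i = {f \<in> module_homs R (F n i) N. coboundary R (r n) (d n) N {\<zero>\<^bsub>N\<^esub>} i f}"
proof (cases i)
  case 0
  have z: "\<zero>\<^bsub>Hom n 0\<^esub> \<in> module_homs R (F n 0) N" 
    using zero_in_homs[where n = n and i = 0] by (simp add: Hom_carrier)
  have "f = \<zero>\<^bsub>Hom n 0\<^esub> \<longleftrightarrow> (\<forall>x\<in>carrier (F n 0). f x = \<zero>\<^bsub>N\<^esub>)" if "f \<in> module_homs R (F n 0) N" for f
    using module_homs_eqI[OF that z] by (auto simp: Hom_module_def)
  then show ?thesis using z unfolding Ext_coboundaries_def 0 coboundary_0 res_module_eq by auto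
next
  case (Suc j)
  interpret n: cyclic_resolution R "ideal_pow R \<aa> n" "r n" "d n" "\<rho> n" by (rule res)
  have comp: "compose (carrier (F n (Suc j))) g (d n j) \<in> module_homs R (F n (Suc j)) N" if "g \<in> module_homs R (F n j) N" for g
  proof -
    have "compose (carrier (F n (Suc j))) g (d n j) \<in> carrier (Hom n (Suc j))"
      by (rule lin_map_closed[OF compose_lin_map[OF F n.d]]) (use that in \<open>simp add: Hom_carrier\<close>)
    then show ?thesis by (simp add: Hom_carrier)
  qed
  show ?thesis
    unfolding Ext_coboundaries_def Suc coboundary_Suc res_module_eq d_eq[symmetric] nat.case
  proof (intro equalityI subsetI)
    fix f assume "f \<in> (\<lambda>g. compose (carrier (F n (Suc j))) g (d n j)) ` module_homs R (F n j) N"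
    then obtain g where g: "g \<in> module_homs R (F n j) N" "f = compose (carrier (F n (Suc j))) g (d n j)" by blast
    have gl: "lin_map R (F n j) N g" by (rule module_homs_lin_map[OF g(1)])
    have "\<forall>x\<in>carrier (F n (Suc j)). eqmod N {\<zero>\<^bsub>N\<^esub>} (f x) (g (d n j x))"
      unfolding eqmod_zero using lin_map_closed[OF gl n.d_closed] g(2) by (simp add: compose_def)
    then show "f \<in> {f \<in> module_homs R (F n (Suc j)) N. \<exists>u. lin_map R (F n j) N u \<and> 
         (\<forall>x\<in>carrier (F n (Suc j)). eqmod N {\<zero>\<^bsub>N\<^esub>} (f x) (u (d n j x)))}"
      using comp[OF g(1)] g(2) gl by blast
  next
    fix f assume "f \<in> {f \<in> module_homs R (F n (Suc j)) N. \<exists>u. lin_map R (F n j) N u \<and> 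
         (\<forall>x\<in>carrier (F n (Suc j)). eqmod N {\<zero>\<^bsub>N\<^esub>} (f x) (u (d n j x)))}"
    then obtain u where f: "f \<in> module_homs R (F n (Suc j)) N" and u: "lin_map R (F n j) N u" 
      "\<And>x. x\<in>carrier (F n (Suc j)) \<Longrightarrow> f x = u (d n j x)" by (auto simp: eqmod_zero)
    have ru: "restrict u (carrier (F n j)) \<in> module_homs R (F n j) N" by (rule restrict_module_homs[OF F u(1)])
    have "f = compose (carrier (F n (Suc j))) (restrict u (carrier (F n j))) (d n j)"
      by (rule module_homs_eqI[OF f comp[OF ru]]) (simp add: compose_def u(2) n.d_closed)
    then show "f \<in> (\<lambda>g. compose (carrier (F n (Suc j))) g (d n j)) ` module_homs R (F n j) N" using ru by blast
  qed
qed

lemma coboundaries_submodule: "submodule (B n i) R (Hom n i)"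
proof (cases i)
  case 0
  then show ?thesis using module.zero_submodule[OF Hom] by (simp add: Ext_coboundaries_def res_module_eq)
next
  case (Suc j)
  have dl: "lin_map R (F n (Suc j)) (F n j) (d n j)" by (rule cyclic_resolution.d[OF res])
  show ?thesis 
    using image_submodule[OF Hom Hom compose_lin_map[OF F dl] module.carrier_is_submodule[OF Hom]]
    by (simp add: Ext_coboundaries_def Suc res_module_eq Hom_carrier flip: d_eq)
qed

text \<open>Cosets depend only on the addition, so those formed in the module of cocycles are cosets
  in the whole Hom module.\<close>

lemma Ext_carrier: "carrier (E n i) = (\<lambda>f. B n i +>\<^bsub>Hom n i\<^esub> f) ` Z n i"
  by (auto simp: Ext_def quotient_module_def A_RCOSETS_def' a_r_coset_def' res_module_eq)

lemma Ext_zero: "\<zero>\<^bsub>E n i\<^esub> = B n i"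
  by (simp add: Ext_def quotient_module_def)

lemma coset_eq_coboundaries_iff: 
  assumes "f \<in> module_homs R (F n i) N" shows "B n i +>\<^bsub>Hom n i\<^esub> f = B n i \<longleftrightarrow> f \<in> B n i"
proof -
  interpret H: Module.module R "Hom n i" by (rule Hom)
  have "B n i +>\<^bsub>Hom n i\<^esub> \<zero>\<^bsub>Hom n i\<^esub> = B n i" 
    using H.submoduleE(1)[OF coboundaries_submodule] by simp
  then show ?thesis
    using H.a_rcoset_eq_iff[OF coboundaries_submodule, of f "\<zero>\<^bsub>Hom n i\<^esub>"] 
      H.eqmod_zero_iff[OF coboundaries_submodule] assms zero_in_homs by (simp add: Hom_carrier)
qed

abbreviation "t i n \<equiv> Ext_map R i (power_quotient R \<aa> (Suc n)) (power_quotient R \<aa> n) (power_proj R \<aa> n) N"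

lemma Ext_map_coset:
  assumes f: "f \<in> module_homs R (F n i) N"
  shows "t i n (B n i +>\<^bsub>Hom n i\<^esub> f) = 
    B (Suc n) i +>\<^bsub>Hom (Suc n) i\<^esub> compose (carrier (F (Suc n) i)) f (\<phi> n i)"
proof -
  interpret H: Module.module R "Hom n i" by (rule Hom)
  let ?c = "\<lambda>f. compose (carrier (F (Suc n) i)) f (\<phi> n i)"
  have cl: "lin_map R (Hom n i) (Hom (Suc n) i) ?c" by (rule compose_lin_map[OF F \<phi>_lin])
  have cB: "?c g \<in> B (Suc n) i" if g: "g \<in> B n i" for g
  proof -
    have g': "g \<in> module_homs R (F n i) N" "coboundary R (r n) (d n) N {\<zero>\<^bsub>N\<^esub>} i g"
      using g by (simp_all add: coboundaries_eq)
    have "coboundary R (r (Suc n)) (d (Suc n)) N {\<zero>\<^bsub>N\<^esub>} i (\<lambda>x. g (\<phi> n i x))"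
      by (rule coboundary_comp[OF \<phi> g'(2)])
    then have "coboundary R (r (Suc n)) (d (Suc n)) N {\<zero>\<^bsub>N\<^esub>} i (?c g)"
      by (rule coboundary_cong[OF N N.zero_submodule])
         (use lin_map_closed[OF lin_map_comp[OF \<phi>_lin module_homs_lin_map[OF g'(1)]]] 
           in \<open>simp add: eqmod_zero compose_def\<close>)
    then show ?thesis using lin_map_closed[OF cl] g' by (simp add: coboundaries_eq Hom_carrier)
  qed
  have "(\<Union>g\<in>B n i +>\<^bsub>Hom n i\<^esub> f. B (Suc n) i +>\<^bsub>Hom (Suc n) i\<^esub> ?c g) = B (Suc n) i +>\<^bsub>Hom (Suc n) i\<^esub> ?c f"
  proof (rule H.UN_a_rcoset[OF coboundaries_submodule coboundaries_submodule Hom])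
    show "f \<in> carrier (Hom n i)" using f by (simp add: Hom_carrier)
    fix g assume g: "eqmod (Hom n i) (B n i) g f"
    show "?c g \<in> carrier (Hom (Suc n) i) \<and> eqmod (Hom (Suc n) i) (B (Suc n) i) (?c g) (?c f)"
      using lin_map_eqmod[OF Hom Hom cl g] cB lin_map_closed[OF cl] g
      by (auto simp: eqmod_def)
  qed
  then show ?thesis unfolding Ext_map_def res_module_eq \<phi>_eq[symmetric] .
qed

lemma trans_map_coset:
  assumes f: "f \<in> module_homs R (F n i) N"
  shows "trans_map (t i) n k (B n i +>\<^bsub>Hom n i\<^esub> f) = 
    B (n + k) i +>\<^bsub>Hom (n + k) i\<^esub> restrict (\<lambda>x. f (\<Phi> n k i x)) (carrier (F (n + k) i))"
proof (induction k)
  case 0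
  have "restrict f (carrier (F n i)) = f"
    by (rule module_homs_eqI[OF restrict_module_homs[OF F module_homs_lin_map[OF f]] f]) simp
  then show ?case by simp
next
  case (Suc k)
  let ?f = "restrict (\<lambda>x. f (\<Phi> n k i x)) (carrier (F (n + k) i))"
  have rf: "?f \<in> module_homs R (F (n + k) i) N" 
    by (rule restrict_module_homs[OF F lin_map_comp[OF \<Phi>_lin module_homs_lin_map[OF f]]])
  have "compose (carrier (F (Suc (n + k)) i)) ?f (\<phi> (n + k) i) 
      = restrict (\<lambda>x. f (\<Phi> n (Suc k) i x)) (carrier (F (n + Suc k) i))"
    using lin_map_closed[OF \<phi>_lin] by (auto simp: compose_def intro!: restrict_ext)
  then show ?case using Suc.IH Ext_map_coset[OF rf] by (simp only: trans_map.simps add_Suc_right)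
qed

text \<open>With k existentially quantified, this identifies vanishing in the limit with
  \<open>eventually_coboundary\<close> for P = 0.\<close>

lemma trans_map_zero_iff:
  assumes f: "f \<in> module_homs R (F n i) N"
  shows "trans_map (t i) n k (B n i +>\<^bsub>Hom n i\<^esub> f) = B (n + k) i \<longleftrightarrow>
    coboundary R (r (n + k)) (d (n + k)) N {\<zero>\<^bsub>N\<^esub>} i (\<lambda>x. f (\<Phi> n k i x))"
proof -
  let ?f = "restrict (\<lambda>x. f (\<Phi> n k i x)) (carrier (F (n + k) i))"
  have fl: "lin_map R (F (n + k) i) N (\<lambda>x. f (\<Phi> n k i x))" 
    by (rule lin_map_comp[OF \<Phi>_lin module_homs_lin_map[OF f]])
  have rf: "?f \<in> module_homs R (F (n + k) i) N" by (rule restrict_module_homs[OF F fl])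
  have "coboundary R (r (n + k)) (d (n + k)) N {\<zero>\<^bsub>N\<^esub>} i ?f \<longleftrightarrow> 
      coboundary R (r (n + k)) (d (n + k)) N {\<zero>\<^bsub>N\<^esub>} i (\<lambda>x. f (\<Phi> n k i x))"
    using coboundary_cong[OF N N.zero_submodule] lin_map_closed[OF fl] by (auto simp: eqmod_zero)
  moreover have "?f \<in> B (n + k) i \<longleftrightarrow> coboundary R (r (n + k)) (d (n + k)) N {\<zero>\<^bsub>N\<^esub>} i ?f"
    using rf unfolding coboundaries_eq by blast
  ultimately show ?thesis
    unfolding trans_map_coset[OF f] coset_eq_coboundaries_iff[OF rf] by blast
qed

lemma coboundaries_subset: "B n i \<subseteq> Z n i"
proof
  fix f assume "f \<in> B n i"
  then have f: "f \<in> module_homs R (F n i) N" "coboundary R (r n) (d n) N {\<zero>\<^bsub>N\<^esub>} i f" 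
    by (simp_all add: coboundaries_eq)
  interpret n: cyclic_resolution R "ideal_pow R \<aa> n" "r n" "d n" "\<rho> n" by (rule res)
  have "f (d n i x) = \<zero>\<^bsub>N\<^esub>" if x: "x \<in> carrier (F n (Suc i))" for x
  proof (cases i)
    case 0
    then show ?thesis using f(2) n.d_closed[OF x] by (simp add: coboundary_0)
  next
    case (Suc j)
    then obtain u where u: "lin_map R (F n j) N u" "\<And>x. x \<in> carrier (F n i) \<Longrightarrow> f x = u (d n j x)"
      using f(2) by (auto simp: coboundary_Suc eqmod_zero)
    have "f (d n i x) = u (d n j (d n (Suc j) x))" using u(2)[OF n.d_closed[OF x]] Suc by simp
    also have "\<dots> = \<zero>\<^bsub>N\<^esub>" using n.d_d[of x j] x Suc lin_map_zero[OF F N u(1)] by simp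
    finally show ?thesis .
  qed
  then show "f \<in> Z n i" using f(1) by (simp add: cocycles_eq cocycle_def module_homs_lin_map)
qed

lemma Ext_zero_coset: "B n i +>\<^bsub>Hom n i\<^esub> \<zero>\<^bsub>Hom n i\<^esub> = B n i"
  using coset_eq_coboundaries_iff[OF zero_in_homs] module.submodule_zero[OF Hom coboundaries_submodule] by simp

lemma Ext_zero_closed: "B n i \<in> carrier (E n i)"
proof -
  have "\<zero>\<^bsub>Hom n i\<^esub> \<in> Z n i" 
    using module.submodule_zero[OF Hom coboundaries_submodule[where n = n and i = i]] coboundaries_subset[where n = n and i = i] by blast
  then have "B n i +>\<^bsub>Hom n i\<^esub> \<zero>\<^bsub>Hom n i\<^esub> \<in> carrier (E n i)" unfolding Ext_carrier by (rule imageI)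
  then show ?thesis by (simp only: Ext_zero_coset)
qed

lemma trans_map_zero: "trans_map (t i) n k (B n i) = B (n + k) i"
proof -
  have "coboundary R (r n) (d n) N {\<zero>\<^bsub>N\<^esub>} i \<zero>\<^bsub>Hom n i\<^esub>"
    using module.submodule_zero[OF Hom coboundaries_submodule[where n = n and i = i]] by (simp add: coboundaries_eq)
  then have "trans_map (t i) n k (B n i +>\<^bsub>Hom n i\<^esub> \<zero>\<^bsub>Hom n i\<^esub>) = B (n + k) i"
    unfolding trans_map_zero_iff[OF zero_in_homs] by (rule coboundary_comp[OF \<Phi>_chain])
  then show ?thesis by (simp only: Ext_zero_coset)
qed

lemma trans_map_add: "trans_map (t i) n (k + l) x = trans_map (t i) (n + k) l (trans_map (t i) n k x)"
  by (induction l) (simp_all add: add.assoc)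

section \<open>The direct limit and the value of cd\<close>

lemma local_cohomology_eq: "local_cohomology R i \<aa> N = direct_limit (\<lambda>n. E n i) (t i)"
  by (simp add: local_cohomology_def)

text \<open>When every class dies at some stage, any two elements of the disjoint union become equal
  later on; the limit relation is total and its quotient has one point.\<close>

lemma local_cohomology_trivial:
  assumes ev: "\<And>n f. cocycle R (r n) (d n) N {\<zero>\<^bsub>N\<^esub>} i f \<Longrightarrow> eventually_coboundary N {\<zero>\<^bsub>N\<^esub>} n i f"
  shows "carrier (local_cohomology R i \<aa> N) = {\<zero>\<^bsub>local_cohomology R i \<aa> N\<^esub>}"
proof -
  have vanish: "\<exists>k. trans_map (t i) n k X = B (n + k) i" if X: "X \<in> carrier (E n i)" for n X
  proof -
    obtain f where f: "f \<in> Z n i" "X = B n i +>\<^bsub>Hom n i\<^esub> f" using X unfolding Ext_carrier by blast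
    then have "f \<in> module_homs R (F n i) N" "cocycle R (r n) (d n) N {\<zero>\<^bsub>N\<^esub>} i f" by (simp_all add: cocycles_eq)
    then show ?thesis using ev[of n f] trans_map_zero_iff f(2) unfolding eventually_coboundary_def by blast
  qed
  have rel: "limit_rel (\<lambda>n. E n i) (t i) = (SIGMA n:UNIV. carrier (E n i)) \<times> (SIGMA n:UNIV. carrier (E n i))"
  proof (intro equalityI subsetI)
    fix z assume "z \<in> (SIGMA n:UNIV. carrier (E n i)) \<times> (SIGMA n:UNIV. carrier (E n i))"
    then obtain n X m Y where z: "z = ((n, X), (m, Y))" "X \<in> carrier (E n i)" "Y \<in> carrier (E m i)" by auto
    \<comment> \<open>X dies after k steps and Y after l; the extra m + l and n + k steps bring both
      to the common stage n + m + k + l.\<close>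
    obtain k l where k: "trans_map (t i) n k X = B (n + k) i" and l: "trans_map (t i) m l Y = B (m + l) i"
      using vanish[OF z(2)] vanish[OF z(3)] by (elim exE)
    have "trans_map (t i) n (k + (m + l)) X = B (n + (k + (m + l))) i"
      unfolding trans_map_add k trans_map_zero by (simp add: add.assoc)
    moreover have "trans_map (t i) m (l + (n + k)) Y = B (m + (l + (n + k))) i"
      unfolding trans_map_add l trans_map_zero by (simp add: add.assoc)
    moreover have "n + (k + (m + l)) = m + (l + (n + k))" by simp
    ultimately show "z \<in> limit_rel (\<lambda>n. E n i) (t i)"
      unfolding limit_rel_def z(1) using z(2,3) 
      by (simp only: mem_Collect_eq case_prod_conv)
         (intro conjI exI[of _ "k + (m + l)"] exI[of _ "l + (n + k)"]; simp only:)
  qed (auto simp: limit_rel_def)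
  have z: "(0, B 0 i) \<in> (SIGMA n:UNIV. carrier (E n i))" using Ext_zero_closed by simp
  have "(SIGMA n:UNIV. carrier (E n i)) // limit_rel (\<lambda>n. E n i) (t i) = {SIGMA n:UNIV. carrier (E n i)}"
    unfolding quotient_def rel using z by auto
  moreover have "limit_rel (\<lambda>n. E n i) (t i) `` {(0, B 0 i)} = (SIGMA n:UNIV. carrier (E n i))"
    unfolding rel using z by auto
  ultimately show ?thesis unfolding local_cohomology_eq direct_limit_def by (simp add: Ext_zero)
qed

lemma local_cohomology_nontrivial:
  assumes f: "cocycle R (r n) (d n) N {\<zero>\<^bsub>N\<^esub>} i f" and nev: "\<not> eventually_coboundary N {\<zero>\<^bsub>N\<^esub>} n i f"
  shows "carrier (local_cohomology R i \<aa> N) \<noteq> {\<zero>\<^bsub>local_cohomology R i \<aa> N\<^esub>}"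
proof
  have fl: "lin_map R (F n i) N f" using f by (simp add: cocycle_def)
  let ?f = "restrict f (carrier (F n i))"
  have rf: "?f \<in> module_homs R (F n i) N" by (rule restrict_module_homs[OF F fl])
  have "cocycle R (r n) (d n) N {\<zero>\<^bsub>N\<^esub>} i ?f"
    using f module_homs_lin_map[OF rf] cyclic_resolution.d_closed[OF res] by (simp add: cocycle_def)
  then have "?f \<in> Z n i" using rf by (simp add: cocycles_eq)
  then have X: "B n i +>\<^bsub>Hom n i\<^esub> ?f \<in> carrier (E n i)" unfolding Ext_carrier by blast
  let ?X = "B n i +>\<^bsub>Hom n i\<^esub> ?f" and ?rel = "limit_rel (\<lambda>n. E n i) (t i)"
  assume "carrier (local_cohomology R i \<aa> N) = {\<zero>\<^bsub>local_cohomology R i \<aa> N\<^esub>}"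
  then have "(SIGMA n:UNIV. carrier (E n i)) // ?rel = {?rel `` {(0, B 0 i)}}"
    unfolding local_cohomology_eq direct_limit_def by (simp add: Ext_zero)
  moreover have "?rel `` {(n, ?X)} \<in> (SIGMA n:UNIV. carrier (E n i)) // ?rel"
    by (rule quotientI) (use X in simp)
  ultimately have eq: "?rel `` {(n, ?X)} = ?rel `` {(0, B 0 i)}" by simp
  have "((n, ?X), (n, ?X)) \<in> ?rel" unfolding limit_rel_def using X by auto
  \<comment> \<open>Equality of classes means that X agrees at some later stage with the transported
    zero.\<close>
  then have "((0, B 0 i), (n, ?X)) \<in> ?rel" using eq by blast
  then obtain k l where kl: "0 + k = n + l" "trans_map (t i) 0 k (B 0 i) = trans_map (t i) n l ?X"
    unfolding limit_rel_def by auto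
  have "trans_map (t i) n l ?X = B (n + l) i" using kl trans_map_zero[where n = 0 and k = k and i = i] by simp
  then have "coboundary R (r (n + l)) (d (n + l)) N {\<zero>\<^bsub>N\<^esub>} i (\<lambda>x. ?f (\<Phi> n l i x))"
    using trans_map_zero_iff[OF rf] by simp
  then have "coboundary R (r (n + l)) (d (n + l)) N {\<zero>\<^bsub>N\<^esub>} i (\<lambda>x. f (\<Phi> n l i x))"
    by (rule coboundary_cong[OF N N.zero_submodule])
       (use lin_map_closed[OF \<Phi>_lin] lin_map_closed[OF fl] in \<open>simp add: eqmod_zero\<close>)
  then show False using nev unfolding eventually_coboundary_def by blast
qed

lemma cd_eq_length:
  assumes noeth: "noetherian_ring R" 
    and ys: "set ys \<subseteq> \<aa>" "reg_seq N {\<zero>\<^bsub>N\<^esub>} ys" and ne: "add_mults N {\<zero>\<^bsub>N\<^esub>} ys \<noteq> carrier N"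
    and NM: "noetherian_module R N"
    and pb: "\<And>w. w \<in> \<aa> \<Longrightarrow> \<exists>k::nat. \<forall>v\<in>carrier N. w [^] k \<odot>\<^bsub>N\<^esub> v \<in> add_mults N {\<zero>\<^bsub>N\<^esub>} ys"
  shows "cd R \<aa> N = ereal (real (length ys))"
proof -
  interpret \<aa>: ideal \<aa> R by (rule \<aa>)
  let ?P = "add_mults N {\<zero>\<^bsub>N\<^esub>} ys"
  have yc: "set ys \<subseteq> carrier R" using ys(1) \<aa>.Icarr by blast
  have P: "submodule ?P R N" by (rule N.add_mults_submodule[OF N.zero_submodule yc])
  have vanish: "carrier (local_cohomology R i \<aa> N) = {\<zero>\<^bsub>local_cohomology R i \<aa> N\<^esub>}" if i: "length ys < i" for i
  proof (rule local_cohomology_trivial)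
    fix n f assume f: "cocycle R (r n) (d n) N {\<zero>\<^bsub>N\<^esub>} i f"
    \<comment> \<open>The annihilator of N/ys N, into which every element of \<aa> has a power by
      \<open>pb\<close>.\<close>
    let ?J = "{x \<in> carrier R. \<forall>v\<in>carrier N. x \<odot>\<^bsub>N\<^esub> v \<in> ?P}"
    show "eventually_coboundary N {\<zero>\<^bsub>N\<^esub>} n i f"
    proof (rule reg_seq_eventually_coboundary[OF noeth N N.annihilating_ideal[OF P order_refl] _ N.zero_submodule ys(2,1) _ i f])
      fix w assume "w \<in> \<aa>"
      then show "\<exists>k::nat. w [^] k \<in> ?J" using pb \<aa>.Icarr by simp
    qed simp
  qed
  \<comment> \<open>A socle element of N/ys N: without one, coset avoidance with x = 0 would yield a
    nonzerodivisor in \<aa>, some power of which kills the nonzero module N/ys N.\<close>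
  have "\<exists>v\<in>carrier N. v \<notin> ?P \<and> (\<forall>a\<in>\<aa>. a \<odot>\<^bsub>N\<^esub> v \<in> ?P)"
  proof (rule ccontr)
    assume neg: "\<not> ?thesis"
    have "\<exists>u\<in>\<aa>. nonzd N ?P (\<zero> \<oplus> u)"
      by (rule N.coset_avoidance[OF noeth NM P \<aa>]) (use neg in auto)
    then obtain u where u: "u \<in> \<aa>" "nonzd N ?P u" using \<aa>.Icarr by auto
    obtain k :: nat where "\<forall>v\<in>carrier N. u [^] k \<odot>\<^bsub>N\<^esub> v \<in> ?P" using pb u by blast
    then have "carrier N \<subseteq> ?P" using N.nonzd_pow[OF \<aa>.Icarr[OF u(1)] u(2), of k] by (auto simp: nonzd_def)
    then show False using ne N.submoduleE(1)[OF P] by blast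
  qed
  then obtain v where v: "v \<in> carrier N" "v \<notin> ?P" "\<And>a. a \<in> \<aa> \<Longrightarrow> a \<odot>\<^bsub>N\<^esub> v \<in> ?P" by blast
  obtain f where "cocycle R (r (Suc 0)) (d (Suc 0)) N {\<zero>\<^bsub>N\<^esub>} (length ys) f" 
      "\<not> eventually_coboundary N {\<zero>\<^bsub>N\<^esub>} (Suc 0) (length ys) f"
    using reg_seq_not_eventually_coboundary[OF N v(1) N.zero_submodule ys(2,1) v(2,3)] by blast
  then have nontriv: "carrier (local_cohomology R (length ys) \<aa> N) \<noteq> {\<zero>\<^bsub>local_cohomology R (length ys) \<aa> N\<^esub>}"
    by (rule local_cohomology_nontrivial)
  show ?thesis
    unfolding cd_def
  proof (rule antisym[OF Sup_least Sup_upper])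
    fix x assume "x \<in> {ereal (real i) | i. carrier (local_cohomology R i \<aa> N) \<noteq> {\<zero>\<^bsub>local_cohomology R i \<aa> N\<^esub>}}"
    then obtain i where "x = ereal (real i)" "\<not> length ys < i" using vanish by blast
    then show "x \<le> ereal (real (length ys))" by simp
  qed (use nontriv in blast)
qed

end

end

theorem corollary3p5:
  fixes R :: "('a, 'r) ring_scheme"
    and M :: "('a, 'b, 'm) module_scheme"
    and \<aa> :: "'a set"
    and c :: nat
    and xs :: "'a list"
  assumes "cring R" and "noetherian_ring R"
    and "ideal \<aa> R" and "\<aa> \<subseteq> jacobson_radical R"
    and "relative_CM R \<aa> M"
    and "cd R \<aa> M = ereal (real c)"
    and "length xs = c" and "relative_sop R \<aa> M xs"
  shows "\<forall>i \<in> {1..c}.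
    relative_CM R \<aa> (quotient_module M (ideal_smult R (genideal R (set (take i xs))) M))"
proof
  fix i assume i: "i \<in> {1..c}"
  interpret cring R by fact
  interpret \<aa>: ideal \<aa> R by fact
  note noeth = assms(2) and a = assms(3)
  have fg: "fin_gen_module R M" and ne: "carrier M \<noteq> ideal_smult R \<aa> M"
    and gr: "grade R \<aa> M = length xs"
    using assms(5,6,7) by (auto simp: relative_CM_def)
  have xs: "set xs \<subseteq> \<aa>" and Rad: "ideal_Rad R (genideal R (set xs) <+>\<^bsub>R\<^esub> annihilator R M) =
       ideal_Rad R (\<aa> <+>\<^bsub>R\<^esub> annihilator R M)"
    using assms(8) by (auto simp: relative_sop_def)
  have xc: "set xs \<subseteq> carrier R" using xs \<aa>.Icarr by blast
  interpret M: Module.module R M using fg by (simp add: fin_gen_module_def)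
  have NM: "noetherian_module R M" by (rule fin_gen_noetherian[OF noeth fg])
  obtain r d \<rho> \<phi> where "canonical_tower R \<aa> r d \<rho> \<phi>"
    using canonical_tower_exists[OF assms(1) noeth a] by blast
  then interpret T: canonical_tower R \<aa> r d \<rho> \<phi> .
  \<comment> \<open>Stage \<open>Suc 0\<close> of the tower resolves R/\<aa>, which is what the
    grade arguments use.\<close>
  interpret C: cyclic_resolution R \<aa> "r (Suc 0)" "d (Suc 0)" "\<rho> (Suc 0)"
    using T.res[of "Suc 0"] unfolding ideal_pow_1[OF a] .
  \<comment> \<open>The radical condition gives w^k = u + b with u in the ideal generated by xs and
    b \<in> Ann M; if xs carries v into Q, then w^k v = uv lies in Q.\<close>
  have pb: "power_bounded R \<aa> M {\<zero>\<^bsub>M\<^esub>} xs"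
    unfolding power_bounded_def
  proof
    fix w assume w: "w \<in> \<aa>"
    have wc: "w \<in> carrier R" using w \<aa>.Icarr by blast
    have "w \<oplus>\<^bsub>R\<^esub> \<zero>\<^bsub>R\<^esub> \<in> \<aa> <+>\<^bsub>R\<^esub> annihilator R M"
    proof -
      have "\<zero>\<^bsub>R\<^esub> \<in> annihilator R M" by (simp add: annihilator_def)
      then show ?thesis unfolding set_add_def' using w by blast
    qed
    then have "w \<in> ideal_Rad R (\<aa> <+>\<^bsub>R\<^esub> annihilator R M)"
      unfolding ideal_Rad_def using wc 
      by (intro CollectI conjI exI[of _ "1::nat"]) simp_all
    then have "w \<in> ideal_Rad R (genideal R (set xs) <+>\<^bsub>R\<^esub> annihilator R M)" by (simp only: Rad)
    then obtain k :: nat where "w [^]\<^bsub>R\<^esub> k \<in> genideal R (set xs) <+>\<^bsub>R\<^esub> annihilator R M"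
      unfolding ideal_Rad_def by blast
    then obtain u b where ub: "u \<in> genideal R (set xs)" "b \<in> annihilator R M" "w [^]\<^bsub>R\<^esub> k = u \<oplus>\<^bsub>R\<^esub> b"
      unfolding set_add_def' by blast
    have c: "u \<in> carrier R" "b \<in> carrier R" 
      using ub ideal.Icarr[OF genideal_ideal[OF xc]] by (auto simp: annihilator_def)
    have "w [^]\<^bsub>R\<^esub> k \<odot>\<^bsub>M\<^esub> v \<in> Q" 
      if Q: "submodule Q R M" and v: "v \<in> carrier M" and zv: "\<forall>z\<in>set xs. z \<odot>\<^bsub>M\<^esub> v \<in> Q" for Q v
    proof -
      have "u \<odot>\<^bsub>M\<^esub> v \<in> Q" by (rule M.genideal_smult_mem[OF Q v xc _ ub(1)]) (use zv in auto)
      then show ?thesis using ub(2) v c by (simp add: ub(3) M.smult_l_distr annihilator_def)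
    qed
    then show "\<exists>k::nat. \<forall>Q v. submodule Q R M \<longrightarrow> {\<zero>\<^bsub>M\<^esub>} \<subseteq> Q \<longrightarrow> v \<in> carrier M \<longrightarrow>
        (\<forall>z\<in>set xs. z \<odot>\<^bsub>M\<^esub> v \<in> Q) \<longrightarrow> w [^]\<^bsub>R\<^esub> k \<odot>\<^bsub>M\<^esub> v \<in> Q" by blast
  qed
  have reg: "reg_seq M {\<zero>\<^bsub>M\<^esub>} xs"
    by (rule C.reg_seq_of_grade[OF noeth M.module_axioms NM assms(4) ne xs pb gr])
  \<comment> \<open>The c - i elements whose number will be both the grade and the cohomological
    dimension of the quotient.\<close>
  define ys where "ys = drop i xs"
  have split: "xs = take i xs @ ys" by (simp add: ys_def)
  have tc: "set (take i xs) \<subseteq> carrier R" "set (take i xs) \<subseteq> \<aa>" and yc: "set ys \<subseteq> carrier R" "set ys \<subseteq> \<aa>"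
    using set_take_subset[of i xs] set_drop_subset[of i xs] xs xc by (auto simp: ys_def)
  define P where "P = add_mults M {\<zero>\<^bsub>M\<^esub>} (take i xs)"
  have P: "submodule P R M" unfolding P_def by (rule M.add_mults_submodule[OF M.zero_submodule tc(1)])
  have P_eq: "ideal_smult R (genideal R (set (take i xs))) M = P"
    unfolding P_def by (rule M.ideal_smult_add_mults[OF tc(1)])
  have regP: "reg_seq M P ys"
    using reg unfolding P_def by (subst (asm) split) (simp add: reg_seq_append)
  \<comment> \<open>Dividing the quotient by ys gives M/xs M again, so the torsion property
    \<open>pb\<close> of xs carries over.\<close>
  have amP: "add_mults M {\<zero>\<^bsub>M\<^esub>} xs = add_mults M P ys"
    unfolding P_def by (subst split) (rule add_mults_append)
  let ?N = "quotient_module M P"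
  let ?q = "\<lambda>x. P +>\<^bsub>M\<^esub> x"
  have Nm: "Module.module R ?N" by (rule M.quotient_module[OF P])
  interpret N: Module.module R ?N by (rule Nm)
  note q = M.quotient_proj[OF P]
  have surj: "?q ` carrier M = carrier ?N" by (simp add: M.quotient_carrier[OF P])
  have qP: "?q ` P = {\<zero>\<^bsub>?N\<^esub>}"
  proof -
    have "?q x = \<zero>\<^bsub>?N\<^esub>" if "x \<in> P" for x 
      using M.quotient_proj_zero_iff[OF P M.submodule_carrier[OF P that]] that by simp
    then show ?thesis using M.submodule_zero[OF P] by force
  qed
  have NN: "noetherian_module R ?N" by (rule noetherian_module_image[OF M.module_axioms Nm q surj NM])
  have fgN: "fin_gen_module R ?N"
    unfolding fin_gen_module_def
    using NN[unfolded noetherian_module_def, rule_format, OF N.carrier_is_submodule] Nm by blast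
  \<comment> \<open>P lies in \<aa>M because x_1, ..., x_i \<in> \<aa>; so M/P = \<aa>(M/P) would
    pull back to M = \<aa>M.\<close>
  have neN: "carrier ?N \<noteq> ideal_smult R \<aa> ?N"
  proof
    assume e: "carrier ?N = ideal_smult R \<aa> ?N"
    let ?S = "ideal_sub R \<aa> M (carrier M)"
    have S: "submodule ?S R M" by (rule M.ideal_sub_submodule[OF \<aa>.a_subset order_refl])
    have PS: "P \<subseteq> ?S" unfolding P_def
      by (rule M.add_mults_minimal[OF S]) (use M.submodule_zero[OF S] tc in \<open>auto intro: M.ideal_sub_mem\<close>)
    have sub: "carrier ?N \<subseteq> ?q ` ?S"
      using ideal_sub_image[OF M.module_axioms Nm q \<aa>.a_subset] e unfolding surj ideal_smult_eq by simp
    have "carrier M \<subseteq> ?S"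
    proof
      fix x assume x: "x \<in> carrier M"
      then have "?q x \<in> ?q ` ?S" using sub surj by blast
      then obtain y where y: "y \<in> ?S" "?q x = ?q y" by blast
      then have "eqmod M P x y" using M.a_rcoset_eq_iff[OF P x] M.submodule_carrier[OF S] by blast
      then show "x \<in> ?S" using eqmod_mono[OF PS] M.eqmod_mem[OF S] y(1) by blast
    qed
    then show False using ne M.submoduleE(1)[OF S] by (simp add: ideal_smult_eq)
  qed
  have regN: "reg_seq ?N {\<zero>\<^bsub>?N\<^esub>} ys"
    using image_reg_seq[OF M.module_axioms Nm q surj _ P order_refl yc(1) regP] 
      M.quotient_proj_zero_iff[OF P] unfolding qP by blast
  have amN: "add_mults ?N {\<zero>\<^bsub>?N\<^esub>} ys = ?q ` add_mults M {\<zero>\<^bsub>M\<^esub>} xs"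
    using image_add_mults[OF M.module_axioms Nm q surj P yc(1)] unfolding qP amP .
  have pbN: "\<exists>k::nat. \<forall>v\<in>carrier ?N. w [^]\<^bsub>R\<^esub> k \<odot>\<^bsub>?N\<^esub> v \<in> add_mults ?N {\<zero>\<^bsub>?N\<^esub>} ys" if w: "w \<in> \<aa>" for w
  proof -
    obtain k :: nat where k: "\<forall>v\<in>carrier M. w [^]\<^bsub>R\<^esub> k \<odot>\<^bsub>M\<^esub> v \<in> add_mults M {\<zero>\<^bsub>M\<^esub>} xs"
      using M.power_bounded_add_mults[OF pb M.zero_submodule xc w] by blast
    have wk: "w [^]\<^bsub>R\<^esub> k \<in> carrier R" using \<aa>.Icarr[OF w] by simp
    have "w [^]\<^bsub>R\<^esub> k \<odot>\<^bsub>?N\<^esub> ?q x \<in> ?q ` add_mults M {\<zero>\<^bsub>M\<^esub>} xs" if "x \<in> carrier M" for x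
      using k that M.quotient_smult[OF P wk that] by auto
    then show ?thesis unfolding amN surj[symmetric] by blast
  qed
  have "grade R \<aa> ?N = length ys"
    by (rule C.grade_eq_of_reg_seq[OF noeth Nm NN neN yc(2) regN pbN])
  moreover have "cd R \<aa> ?N = ereal (real (length ys))"
    by (rule T.cd_eq_length[OF Nm noeth yc(2) regN C.add_mults_neq_carrier[OF Nm neN yc(2)] NN pbN])
  ultimately show "relative_CM R \<aa> (quotient_module M (ideal_smult R (genideal R (set (take i xs))) M))"
    unfolding P_eq relative_CM_def using fgN neN by simp
qed

end
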